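(* Let $\mathcal A=-\Delta$ be the self-adjoint operator, and let $\mathcal W$, $w$ and $w_h$ be, respectively, the elliptic reconstruction of $w_h$, the solution of the continuous parabolic variational inequality, and the solution of the semidiscrete variational inequality, with $\sigma_h$ the discrete multiplier (all as in the context). Then, for $0<t\le T$ and for all $v\in\mathcal V$, the following holds in the sense of distributions: $$(\mathcal W-w)_t+\mathcal A(\mathcal W-w)\le\sigma_h+(\mathcal W-w_h)_t.$$
   Context: **Continuous problem.** $\Omega\subset\mathbb R^d$, $d\in\{2,3\}$, is an open and bounded domain, $T>0$, $Q=\Omega\times(0,T]$, $\mathcal V=H^1_0(\Omega)$, $\mathcal V^*$ its dual, $\langle\cdot,\cdot\rangle_{-1,1}$ the duality pairing, $(\cdot,\cdot)$ the $L^2(\Omega)$ inner product, $a(p,q)=\int_\Omega\nabla p\cdot\nabla q\,dx$. Data: $f\in L^2(0,T;L^2(\Omega))$, $w_0\in L^2(\Omega)$, and an obstacle $\chi\in H^1(Q)$ with $\chi\le0$ on $[0,T]\times\partial\Omega$. For a.e. $t\in[0,T]$, $\mathcal K_\chi(t)=\{v\in\mathcal V: v\ge\chi(t)\text{ a.e. in }\Omega\}$ (nonempty, closed, convex). The continuous solution is a map $w:[0,T]\to\mathcal V$ with $w\in L^2(0,T;H^1(\Omega))\cap C^0([0,T];L^2(\Omega))$, $w_t\in L^2(0,T;\mathcal V^* )$, $w(0)=w_0$, $w(t)\in\mathcal K_\chi(t)$ for a.e. $t$, and, for a.e. $t\in[0,T]$, $$\langle w_t(t),v-w(t)\rangle_{-1,1}+a(w(t),v-w(t))\ge(f(t),v-w(t))\quad\forall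 v\in\mathcal K_\chi(t).$$ **Semidiscrete problem.** $\Omega_h$ is a shape-regular triangulation of $\Omega$ into $d$-simplices, $k\ge1$ an integer, $\mathcal V_h=\{v_h\in\mathcal V: v_h|_K\in\mathbb P_k(K)\ \forall K\in\Omega_h\}$, where $\mathbb P_k(K)$ denotes polynomials of degree at most $k$. $\chi_h$ is an approximation (for instance, Lagrange) of $\chi$ with $\chi_h\le0$ on $[0,T]\times\partial\Omega$, and $\mathcal K_{h,\chi}(t)=\{v_h\in\mathcal V_h: v_h|_K\ge\chi_h(t)|_K\ \forall K\in\Omega_h\}$. The discrete solution is $w_h:[0,T]\to\mathcal V_h$ with $w_h(0)=w_{h,0}\in\mathcal V_h$ and $$(w_{h,t}(t),v_h-w_h(t))+a(w_h(t),v_h-w_h(t))\ge(f(t),v_h-w_h(t))\quad\forall v_h\in\mathcal K_{h,\chi}(t).$$ For a.e. $t\in(0,T]$ the discrete multiplier $\sigma_h(t)\in\mathcal V_h$ is defined by $(\sigma_h(t),v_h)=(w_{h,t}(t),v_h)+a(w_h(t),v_h)-(f(t),v_h)$ for all $v_h\in\mathcal V_h$. **Elliptic reconstruction.** With $z_h(t)=(f+\sigma_h-w_{h,t})(t)\in L^2(\Omega)$, the elliptic reconstruction $\mathcal W(t)\in\mathcal V$ of $w_h(t)$ is the unique solution of $(\nabla\mathcal W(t),\nabla v)=(z_h(t),v)$ for all $v\in\mathcal V$. The subscript $t$ denotes the time derivative. *)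

theory Defs
  imports "HOL-Analysis.Analysis"
begin

section \<open>Lebesgue and Sobolev spaces\<close>

text \<open>
  Elements of the function spaces below are represented by functions, two representatives being
  identified when they agree almost everywhere; values outside the underlying set are irrelevant.
\<close>

definition L2 :: "'a::euclidean_space set \<Rightarrow> ('a \<Rightarrow> 'b::euclidean_space) set" where
  "L2 S = {u \<in> borel_measurable (lebesgue_on S). integrable (lebesgue_on S) (\<lambda>x. (norm (u x))\<^sup>2)}"

definition L2_inner :: "'a::euclidean_space set \<Rightarrow> ('a \<Rightarrow> 'b::euclidean_space) \<Rightarrow> ('a \<Rightarrow> 'b) \<Rightarrow> real" where
  "L2_inner S u v = (\<integral>x. u x \<bullet> v x \<partial>lebesgue_on S)"

definition L2_norm :: "'a::euclidean_space set \<Rightarrow> ('a \<Rightarrow> 'b::euclidean_space) \<Rightarrow> real" where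
  "L2_norm S u = sqrt (L2_inner S u u)"

primrec C_k :: "nat \<Rightarrow> ('a::euclidean_space \<Rightarrow> real) \<Rightarrow> bool" where
  "C_k 0 \<phi> \<longleftrightarrow> continuous_on UNIV \<phi>"
| "C_k (Suc m) \<phi> \<longleftrightarrow> (\<exists>g. (\<forall>x. GDERIV \<phi> x :> g x) \<and> (\<forall>b\<in>Basis. C_k m (\<lambda>x. g x \<bullet> b)))"

definition test_function :: "'a::euclidean_space set \<Rightarrow> ('a \<Rightarrow> real) \<Rightarrow> bool" where
  "test_function S \<phi> \<longleftrightarrow> (\<forall>m. C_k m \<phi>) \<and> (\<exists>C. compact C \<and> C \<subseteq> S \<and> (\<forall>x. x \<notin> C \<longrightarrow> \<phi> x = 0))"

definition weak_gradient :: "'a::euclidean_space set \<Rightarrow> ('a \<Rightarrow> real) \<Rightarrow> ('a \<Rightarrow> 'a) \<Rightarrow> bool" where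
  "weak_gradient S u g \<longleftrightarrow> (\<forall>\<phi>. test_function S \<phi> \<longrightarrow> (\<forall>b\<in>Basis.
     (\<integral>x. u x * frechet_derivative \<phi> (at x) b \<partial>lebesgue_on S)
       = - (\<integral>x. (g x \<bullet> b) * \<phi> x \<partial>lebesgue_on S)))"

definition H1 :: "'a::euclidean_space set \<Rightarrow> ('a \<Rightarrow> real) set" where
  "H1 S = {u \<in> L2 S. \<exists>g. g \<in> L2 S \<and> weak_gradient S u g}"

text \<open>Meaningful for functions in \<^term>\<open>H1 S\<close> only, where it is unique almost everywhere.\<close>

definition grad :: "'a::euclidean_space set \<Rightarrow> ('a \<Rightarrow> real) \<Rightarrow> 'a \<Rightarrow> 'a" where
  "grad S u = (SOME g. g \<in> L2 S \<and> weak_gradient S u g)"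

definition H1_norm :: "'a::euclidean_space set \<Rightarrow> ('a \<Rightarrow> real) \<Rightarrow> real" where
  "H1_norm S u = sqrt ((L2_norm S u)\<^sup>2 + (L2_norm S (grad S u))\<^sup>2)"

definition H10 :: "'a::euclidean_space set \<Rightarrow> ('a \<Rightarrow> real) set" where
  "H10 S = {u \<in> H1 S. \<exists>\<phi>. (\<forall>n::nat. test_function S (\<phi> n)) \<and>
     (\<lambda>n. H1_norm S (\<lambda>x. \<phi> n x - u x)) \<longlonglongrightarrow> 0}"

text \<open>
  The inequality \<open>u \<le> 0\<close> on a part \<open>E\<close> of the boundary of \<open>S\<close> in the sense of \<open>H\<^sup>1(S)\<close>, as in
  Kinderlehrer and Stampacchia: \<open>u\<close> is an \<open>H\<^sup>1\<close>-limit of Lipschitz functions that are nonpositive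
  on \<open>E\<close>. Pointwise values of \<open>u\<close> on \<open>E\<close> carry no information since \<open>E\<close> is a null set in general.
\<close>

definition H1_nonpos_on :: "'a::euclidean_space set \<Rightarrow> 'a set \<Rightarrow> ('a \<Rightarrow> real) \<Rightarrow> bool" where
  "H1_nonpos_on S E u \<longleftrightarrow> (\<exists>\<phi>.
     (\<forall>n::nat. \<phi> n \<in> H1 S \<and> (\<exists>L. L-lipschitz_on (closure S) (\<phi> n)) \<and> (\<forall>x\<in>E. \<phi> n x \<le> 0)) \<and>
     (\<lambda>n. H1_norm S (\<lambda>x. \<phi> n x - u x)) \<longlonglongrightarrow> 0)"

definition dirichlet_form :: "'a::euclidean_space set \<Rightarrow> ('a \<Rightarrow> real) \<Rightarrow> ('a \<Rightarrow> real) \<Rightarrow> real" where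
  "dirichlet_form \<Omega> u v = L2_inner \<Omega> (grad \<Omega> u) (grad \<Omega> v)"

text \<open>
  The dual of \<^term>\<open>H10 \<Omega>\<close>; the pairing of \<open>l\<close> with \<open>v\<close> is the application \<open>l v\<close>, and the values of
  \<open>l\<close> outside \<^term>\<open>H10 \<Omega>\<close> are irrelevant. Boundedness forces \<open>l\<close> to respect equality almost everywhere.
\<close>

definition H10_dual :: "'a::euclidean_space set \<Rightarrow> (('a \<Rightarrow> real) \<Rightarrow> real) set" where
  "H10_dual \<Omega> = {l.
     (\<forall>u\<in>H10 \<Omega>. \<forall>v\<in>H10 \<Omega>. \<forall>a b. l (\<lambda>x. a * u x + b * v x) = a * l u + b * l v) \<and>
     (\<exists>C. \<forall>v\<in>H10 \<Omega>. \<bar>l v\<bar> \<le> C * H1_norm \<Omega> v)}"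

definition H10_dual_norm :: "'a::euclidean_space set \<Rightarrow> (('a \<Rightarrow> real) \<Rightarrow> real) \<Rightarrow> real" where
  "H10_dual_norm \<Omega> l = (SUP v\<in>{v \<in> H10 \<Omega>. H1_norm \<Omega> v \<le> 1}. \<bar>l v\<bar>)"

text \<open>\<open>-\<Delta>\<close> as an operator from \<^term>\<open>H10 \<Omega>\<close> to its dual.\<close>

definition neg_laplacian :: "'a::euclidean_space set \<Rightarrow> ('a \<Rightarrow> real) \<Rightarrow> ('a \<Rightarrow> real) \<Rightarrow> real" where
  "neg_laplacian \<Omega> u = (\<lambda>v. dirichlet_form \<Omega> u v)"


section \<open>Functions of time with values in a function space\<close>

text \<open>
  Bochner spaces \<open>L\<^sup>p(I; X)\<close> for a space \<open>X\<close> of real-valued functions (or functionals) with norm \<open>N\<close>: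
  strongly measurable maps, that is, limits almost everywhere of simple functions, with
  \<open>t \<mapsto> N (u t)\<^sup>p\<close> integrable.
\<close>

definition strongly_measurable ::
  "real set \<Rightarrow> ('c \<Rightarrow> real) set \<Rightarrow> (('c \<Rightarrow> real) \<Rightarrow> real) \<Rightarrow> (real \<Rightarrow> 'c \<Rightarrow> real) \<Rightarrow> bool" where
  "strongly_measurable I X N u \<longleftrightarrow> (\<exists>s.
     (\<forall>n::nat. finite (s n ` I) \<and> s n ` I \<subseteq> X \<and> (\<forall>y. {t \<in> I. s n t = y} \<in> sets lebesgue)) \<and>
     (AE t in lebesgue_on I. (\<lambda>n. N (\<lambda>x. s n t x - u t x)) \<longlonglongrightarrow> 0))"

definition bochner ::
  "nat \<Rightarrow> real set \<Rightarrow> ('c \<Rightarrow> real) set \<Rightarrow> (('c \<Rightarrow> real) \<Rightarrow> real) \<Rightarrow> (real \<Rightarrow> 'c \<Rightarrow> real) set" where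
  "bochner p I X N = {u. (AE t in lebesgue_on I. u t \<in> X) \<and> strongly_measurable I X N u \<and>
     integrable (lebesgue_on I) (\<lambda>t. N (u t) ^ p)}"

definition time_continuous ::
  "real \<Rightarrow> ('c \<Rightarrow> real) set \<Rightarrow> (('c \<Rightarrow> real) \<Rightarrow> real) \<Rightarrow> (real \<Rightarrow> 'c \<Rightarrow> real) \<Rightarrow> bool" where
  "time_continuous T X N u \<longleftrightarrow> (\<forall>t\<in>{0..T}. u t \<in> X \<and>
     ((\<lambda>s. N (\<lambda>x. u s x - u t x)) \<longlongrightarrow> 0) (at t within {0..T}))"

text \<open>
  \<open>l\<close>, with values in the dual of \<^term>\<open>H10 \<Omega>\<close>, is the time derivative of \<open>u\<close>. A derivative \<open>u'\<close> with
  values in \<open>L\<^sup>2(\<Omega>)\<close> corresponds to \<open>l t = L2_inner \<Omega> (u' t)\<close>.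
\<close>

definition has_time_derivative ::
  "'a::euclidean_space set \<Rightarrow> real \<Rightarrow> (real \<Rightarrow> 'a \<Rightarrow> real) \<Rightarrow> (real \<Rightarrow> ('a \<Rightarrow> real) \<Rightarrow> real) \<Rightarrow> bool" where
  "has_time_derivative \<Omega> T u l \<longleftrightarrow>
     u \<in> bochner 1 {0<..<T} (L2 \<Omega>) (L2_norm \<Omega>) \<and>
     l \<in> bochner 1 {0<..<T} (H10_dual \<Omega>) (H10_dual_norm \<Omega>) \<and>
     (\<forall>\<psi>. test_function {0<..<T} \<psi> \<longrightarrow> (\<forall>v\<in>H10 \<Omega>.
        (\<integral>t. L2_inner \<Omega> (u t) v * deriv \<psi> t \<partial>lebesgue_on {0<..<T})
          = - (\<integral>t. l t v * \<psi> t \<partial>lebesgue_on {0<..<T})))"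

text \<open>
  Distributions on \<open>(0,T)\<close> with values in the dual of \<^term>\<open>H10 \<Omega>\<close>, as functionals of a scalar test
  function \<open>\<psi>\<close> of time and an element \<open>v\<close> of \<^term>\<open>H10 \<Omega>\<close>. The time derivative exists in this sense
  for every \<open>u\<close> in \<open>L\<^sup>1(0,T; L\<^sup>2(\<Omega>))\<close>.
\<close>

definition dist_of ::
  "real \<Rightarrow> (real \<Rightarrow> ('a \<Rightarrow> real) \<Rightarrow> real) \<Rightarrow> (real \<Rightarrow> real) \<Rightarrow> ('a::euclidean_space \<Rightarrow> real) \<Rightarrow> real" where
  "dist_of T l \<psi> v = (\<integral>t. l t v * \<psi> t \<partial>lebesgue_on {0<..<T})"

definition dist_dt ::
  "'a::euclidean_space set \<Rightarrow> real \<Rightarrow> (real \<Rightarrow> 'a \<Rightarrow> real) \<Rightarrow> (real \<Rightarrow> real) \<Rightarrow> ('a \<Rightarrow> real) \<Rightarrow> real" where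
  "dist_dt \<Omega> T u \<psi> v = - (\<integral>t. L2_inner \<Omega> (u t) v * deriv \<psi> t \<partial>lebesgue_on {0<..<T})"

definition H10_nonneg :: "'a::euclidean_space set \<Rightarrow> ('a \<Rightarrow> real) set" where
  "H10_nonneg \<Omega> = {v \<in> H10 \<Omega>. AE x in lebesgue_on \<Omega>. 0 \<le> v x}"

definition dist_le ::
  "'a::euclidean_space set \<Rightarrow> real \<Rightarrow> ((real \<Rightarrow> real) \<Rightarrow> ('a \<Rightarrow> real) \<Rightarrow> real) \<Rightarrow>
    ((real \<Rightarrow> real) \<Rightarrow> ('a \<Rightarrow> real) \<Rightarrow> real) \<Rightarrow> bool" where
  "dist_le \<Omega> T F G \<longleftrightarrow> (\<forall>\<psi>. test_function {0<..<T} \<psi> \<and> (\<forall>t. 0 \<le> \<psi> t) \<longrightarrow>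
     (\<forall>v\<in>H10_nonneg \<Omega>. F \<psi> v \<le> G \<psi> v))"


section \<open>The continuous variational inequality\<close>

definition obstacle_set :: "'a::euclidean_space set \<Rightarrow> ('a \<Rightarrow> real) \<Rightarrow> ('a \<Rightarrow> real) set" where
  "obstacle_set \<Omega> c = {v \<in> H10 \<Omega>. AE x in lebesgue_on \<Omega>. c x \<le> v x}"

text \<open>
  The space-time cylinder is taken without its top, which is a null set, so that the weak gradient
  in space-time is tested on an open set.
\<close>

definition admissible_obstacle ::
  "'a::euclidean_space set \<Rightarrow> real \<Rightarrow> (real \<Rightarrow> 'a \<Rightarrow> real) \<Rightarrow> bool" where
  "admissible_obstacle \<Omega> T obs \<longleftrightarrow>
     (\<lambda>(x, t). obs t x) \<in> H1 (\<Omega> \<times> {0<..<T}) \<and>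
     H1_nonpos_on (\<Omega> \<times> {0<..<T}) (frontier \<Omega> \<times> {0..T}) (\<lambda>(x, t). obs t x)"

definition continuous_solution ::
  "'a::euclidean_space set \<Rightarrow> real \<Rightarrow> (real \<Rightarrow> 'a \<Rightarrow> real) \<Rightarrow> (real \<Rightarrow> 'a \<Rightarrow> real) \<Rightarrow> ('a \<Rightarrow> real) \<Rightarrow>
    (real \<Rightarrow> 'a \<Rightarrow> real) \<Rightarrow> (real \<Rightarrow> ('a \<Rightarrow> real) \<Rightarrow> real) \<Rightarrow> bool" where
  "continuous_solution \<Omega> T f obs w0 w w_t \<longleftrightarrow>
     w \<in> bochner 2 {0<..<T} (H1 \<Omega>) (H1_norm \<Omega>) \<and>
     time_continuous T (L2 \<Omega>) (L2_norm \<Omega>) w \<and>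
     has_time_derivative \<Omega> T w w_t \<and>
     w_t \<in> bochner 2 {0<..<T} (H10_dual \<Omega>) (H10_dual_norm \<Omega>) \<and>
     (AE x in lebesgue_on \<Omega>. w 0 x = w0 x) \<and>
     (AE t in lebesgue_on {0<..<T}. w t \<in> obstacle_set \<Omega> (obs t) \<and>
        (\<forall>v\<in>obstacle_set \<Omega> (obs t).
           w_t t (\<lambda>x. v x - w t x) + dirichlet_form \<Omega> (w t) (\<lambda>x. v x - w t x)
             \<ge> L2_inner \<Omega> (f t) (\<lambda>x. v x - w t x)))"


section \<open>The semidiscrete variational inequality\<close>

definition simplicial_mesh :: "(real ^ 'n) set \<Rightarrow> (real ^ 'n) set set \<Rightarrow> bool" where
  "simplicial_mesh \<Omega> \<T> \<longleftrightarrow> triangulation \<T> \<and> (\<forall>K\<in>\<T>. int CARD('n) simplex K) \<and> \<Union>\<T> = closure \<Omega>"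

definition shape_regular :: "real \<Rightarrow> (real ^ 'n) set set \<Rightarrow> bool" where
  "shape_regular \<kappa> \<T> \<longleftrightarrow> (\<forall>K\<in>\<T>. \<exists>x r. 0 < r \<and> ball x r \<subseteq> K \<and> diameter K \<le> \<kappa> * r)"

text \<open>Polynomials of total degree at most \<open>k\<close>, with \<open>\<alpha>\<close> ranging over the finitely many multi-indices.\<close>

definition polynomials :: "nat \<Rightarrow> (real ^ 'n \<Rightarrow> real) set" where
  "polynomials k =
     {p. \<exists>c. \<forall>x. p x = (\<Sum>\<alpha> | (\<Sum>i\<in>UNIV. \<alpha> i) \<le> k. c \<alpha> * (\<Prod>i\<in>UNIV. (x $ i) ^ \<alpha> i))}"

text \<open>
  Finite element functions are continuous; the representative that is polynomial at every point of
  each closed simplex is used, so that the discrete obstacle constraint can be imposed pointwise.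
\<close>

definition fe_space :: "(real ^ 'n) set \<Rightarrow> (real ^ 'n) set set \<Rightarrow> nat \<Rightarrow> (real ^ 'n \<Rightarrow> real) set" where
  "fe_space \<Omega> \<T> k = {v \<in> H10 \<Omega>. \<forall>K\<in>\<T>. \<exists>p\<in>polynomials k. \<forall>x\<in>K. v x = p x}"

definition discrete_obstacle_set ::
  "(real ^ 'n) set \<Rightarrow> (real ^ 'n) set set \<Rightarrow> nat \<Rightarrow> (real ^ 'n \<Rightarrow> real) \<Rightarrow> (real ^ 'n \<Rightarrow> real) set" where
  "discrete_obstacle_set \<Omega> \<T> k c = {v \<in> fe_space \<Omega> \<T> k. \<forall>K\<in>\<T>. \<forall>x\<in>K. c x \<le> v x}"

text \<open>
  The regularity required of \<open>w\<^sub>h\<close> is that of an absolutely continuous map into the finite element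
  space, the weakest for which the inequality at almost every time makes sense together with the
  initial condition.
\<close>

definition discrete_solution ::
  "(real ^ 'n) set \<Rightarrow> real \<Rightarrow> (real ^ 'n) set set \<Rightarrow> nat \<Rightarrow> (real \<Rightarrow> real ^ 'n \<Rightarrow> real) \<Rightarrow>
    (real \<Rightarrow> real ^ 'n \<Rightarrow> real) \<Rightarrow> (real ^ 'n \<Rightarrow> real) \<Rightarrow>
    (real \<Rightarrow> real ^ 'n \<Rightarrow> real) \<Rightarrow> (real \<Rightarrow> real ^ 'n \<Rightarrow> real) \<Rightarrow> bool" where
  "discrete_solution \<Omega> T \<T> k f obs_h wh0 wh wh_t \<longleftrightarrow>
     wh0 \<in> fe_space \<Omega> \<T> k \<and>
     time_continuous T (fe_space \<Omega> \<T> k) (H1_norm \<Omega>) wh \<and>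
     wh_t \<in> bochner 1 {0<..<T} (fe_space \<Omega> \<T> k) (H1_norm \<Omega>) \<and>
     has_time_derivative \<Omega> T wh (\<lambda>t. L2_inner \<Omega> (wh_t t)) \<and>
     (AE x in lebesgue_on \<Omega>. wh 0 x = wh0 x) \<and>
     (AE t in lebesgue_on {0<..<T}. wh t \<in> discrete_obstacle_set \<Omega> \<T> k (obs_h t) \<and>
        (\<forall>v\<in>discrete_obstacle_set \<Omega> \<T> k (obs_h t).
           L2_inner \<Omega> (wh_t t) (\<lambda>x. v x - wh t x) + dirichlet_form \<Omega> (wh t) (\<lambda>x. v x - wh t x)
             \<ge> L2_inner \<Omega> (f t) (\<lambda>x. v x - wh t x)))"

definition discrete_multiplier ::
  "(real ^ 'n) set \<Rightarrow> real \<Rightarrow> (real ^ 'n) set set \<Rightarrow> nat \<Rightarrow> (real \<Rightarrow> real ^ 'n \<Rightarrow> real) \<Rightarrow>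
    (real \<Rightarrow> real ^ 'n \<Rightarrow> real) \<Rightarrow> (real \<Rightarrow> real ^ 'n \<Rightarrow> real) \<Rightarrow>
    (real \<Rightarrow> real ^ 'n \<Rightarrow> real) \<Rightarrow> bool" where
  "discrete_multiplier \<Omega> T \<T> k f wh wh_t \<sigma>h \<longleftrightarrow>
     (AE t in lebesgue_on {0<..<T}. \<sigma>h t \<in> fe_space \<Omega> \<T> k \<and>
        (\<forall>v\<in>fe_space \<Omega> \<T> k.
           L2_inner \<Omega> (\<sigma>h t) v
             = L2_inner \<Omega> (wh_t t) v + dirichlet_form \<Omega> (wh t) v - L2_inner \<Omega> (f t) v))"

definition elliptic_reconstruction ::
  "'a::euclidean_space set \<Rightarrow> real \<Rightarrow> (real \<Rightarrow> 'a \<Rightarrow> real) \<Rightarrow> (real \<Rightarrow> 'a \<Rightarrow> real) \<Rightarrow>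
    (real \<Rightarrow> 'a \<Rightarrow> real) \<Rightarrow> (real \<Rightarrow> 'a \<Rightarrow> real) \<Rightarrow> bool" where
  "elliptic_reconstruction \<Omega> T f \<sigma>h wh_t W \<longleftrightarrow>
     (AE t in lebesgue_on {0<..<T}. W t \<in> H10 \<Omega> \<and>
        (\<forall>v\<in>H10 \<Omega>. dirichlet_form \<Omega> (W t) v
           = L2_inner \<Omega> (\<lambda>x. f t x + \<sigma>h t x - wh_t t x) v))"

end

theory Submission
  imports Defs
begin

text \<open>
  At almost every time, testing the variational inequality with \<open>w(t) + v\<close>, where \<open>v \<ge> 0\<close>, gives
  \<open>w\<^sub>t + \<A> w \<ge> f\<close>, since adding a nonnegative function preserves the obstacle constraint. The
  reconstruction satisfies \<open>\<A> W = f + \<sigma>\<^sub>h - w\<^sub>h\<^sub>,\<^sub>t\<close> by definition. Subtracting,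
  \<open>\<A> (W - w) \<le> w\<^sub>t + \<sigma>\<^sub>h - w\<^sub>h\<^sub>,\<^sub>t\<close>, which is the claim once \<open>W\<^sub>t\<close> is added to both sides as a
  distribution. The work lies in justifying these steps.

  \<^item> The gradient of an \<open>H\<^sup>1\<close> function is a choice among almost everywhere equal functions, so even
    linearity of the Dirichlet form needs uniqueness of weak gradients. This follows from the
    fundamental lemma of the calculus of variations (\<open>fundamental_lemma_variations\<close>), proved with
    explicit smooth bumps. The space \<open>H\<^sup>1\<^sub>0\<close> is a linear space because test functions have their
    classical gradients as weak gradients (\<open>weak_gradient_test_function\<close>).

  \<^item> The distributional inequality is obtained by integrating the pointwise one against \<open>\<psi> \<ge> 0\<close> and
    cancelling \<open>\<integral> (W, v) \<psi>'\<close>, which is legitimate only if the integrands are integrable in time.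
    The multiplier and the reconstruction are given separately at almost every time. The multiplier
    takes values in a finite-dimensional space, so it is a combination of fixed functions whose
    coefficients are pairings of the data (\<open>fe_reproducing_system\<close>,
    \<open>discrete_multiplier_integrable\<close>). For the reconstruction, symmetry of the Dirichlet form turns
    \<open>(W, v)\<close> into a limit of pairings of \<open>f + \<sigma>\<^sub>h - w\<^sub>h\<^sub>,\<^sub>t\<close> with fixed functions, and the Poincare
    inequality provides the bound (\<open>elliptic_solution_integrable\<close>).

  \<^item> If \<open>W - w\<close> and \<open>W - w\<^sub>h\<close> have time derivatives \<open>p\<close> and \<open>q\<close>, then testing gives
    \<open>p - q = w\<^sub>h\<^sub>,\<^sub>t - w\<^sub>t\<close>, with an exceptional null set of times for each \<open>v\<close>. Strong measurability
    of the derivatives yields a single null set (\<open>dual_AE_eq\<close>), and the pointwise inequality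
    concludes.
\<close>

section \<open>Semi-inner product spaces of functions\<close>

lemma discriminant_le:
  fixes a b c :: real
  assumes nonneg: "\<And>s. 0 \<le> c + 2 * b * s + a * s\<^sup>2" and "0 \<le> a"
  shows "b\<^sup>2 \<le> a * c"
proof (cases "a = 0")
  case True
  have "b = 0"
  proof (rule ccontr)
    assume "b \<noteq> 0"
    then show False
      using nonneg[of "- (c + 1) / (2 * b)"] True by simp
  qed
  then show ?thesis using True by simp
next
  case False
  then have a: "a > 0" using assms(2) by simp
  have "c + 2 * b * (- b / a) + a * (- b / a)\<^sup>2 = c - b\<^sup>2 / a"
    using a by (simp add: field_simps power2_eq_square)
  then have "b\<^sup>2 / a \<le> c"
    using nonneg[of "- b / a"] by simp
  then show ?thesis
    using a by (simp add: field_simps)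
qed

text \<open>
  Functions that agree almost everywhere are different members of the function spaces, so their inner
  products are only semidefinite. The locale covers \<open>L\<^sup>2\<close> for scalar and vector functions, \<open>H\<^sup>1\<close>, the
  Dirichlet form on \<open>H\<^sup>1\<close> and on \<open>H\<^sup>1\<^sub>0\<close>, and the finite element space with the \<open>L\<^sup>2\<close> product.
\<close>

locale semi_inner_space =
  fixes X :: "('c \<Rightarrow> 'b::real_vector) set" and ip :: "('c \<Rightarrow> 'b) \<Rightarrow> ('c \<Rightarrow> 'b) \<Rightarrow> real"
  assumes zero_mem: "(\<lambda>x. 0) \<in> X"
    and comb_mem: "\<lbrakk>u \<in> X; v \<in> X\<rbrakk> \<Longrightarrow> (\<lambda>x. a *\<^sub>R u x + b *\<^sub>R v x) \<in> X"
    and ip_comb: "\<lbrakk>u \<in> X; v \<in> X; g \<in> X\<rbrakk> \<Longrightarrow>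
      ip (\<lambda>x. a *\<^sub>R u x + b *\<^sub>R v x) g = a * ip u g + b * ip v g"
    and ip_sym: "\<lbrakk>u \<in> X; v \<in> X\<rbrakk> \<Longrightarrow> ip u v = ip v u"
    and ip_nonneg: "u \<in> X \<Longrightarrow> 0 \<le> ip u u"
begin

definition nrm :: "('c \<Rightarrow> 'b) \<Rightarrow> real" where
  "nrm u = sqrt (ip u u)"

lemma add_mem: "\<lbrakk>u \<in> X; v \<in> X\<rbrakk> \<Longrightarrow> (\<lambda>x. u x + v x) \<in> X"
  using comb_mem[of u v 1 1] by simp

lemma diff_mem: "\<lbrakk>u \<in> X; v \<in> X\<rbrakk> \<Longrightarrow> (\<lambda>x. u x - v x) \<in> X"
  using comb_mem[of u v 1 "-1"] by simp

lemma scale_mem: "u \<in> X \<Longrightarrow> (\<lambda>x. a *\<^sub>R u x) \<in> X"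
  using comb_mem[of u u a 0] by simp

lemma ip_add: "\<lbrakk>u \<in> X; v \<in> X; g \<in> X\<rbrakk> \<Longrightarrow> ip (\<lambda>x. u x + v x) g = ip u g + ip v g"
  using ip_comb[of u v g 1 1] by simp

lemma ip_diff: "\<lbrakk>u \<in> X; v \<in> X; g \<in> X\<rbrakk> \<Longrightarrow> ip (\<lambda>x. u x - v x) g = ip u g - ip v g"
  using ip_comb[of u v g 1 "-1"] by simp

lemma ip_scale: "\<lbrakk>u \<in> X; g \<in> X\<rbrakk> \<Longrightarrow> ip (\<lambda>x. a *\<^sub>R u x) g = a * ip u g"
  using ip_comb[of u u g a 0] by simp

lemma ip_zero: "g \<in> X \<Longrightarrow> ip (\<lambda>x. 0) g = 0"
  using ip_comb[OF zero_mem zero_mem, of g 0 0] by simp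

lemma nrm_nonneg: "u \<in> X \<Longrightarrow> 0 \<le> nrm u"
  by (simp add: nrm_def ip_nonneg)

lemma nrm_square: "u \<in> X \<Longrightarrow> (nrm u)\<^sup>2 = ip u u"
  by (simp add: nrm_def ip_nonneg)

lemma nrm_square_comb:
  assumes "u \<in> X" "v \<in> X"
  shows "ip (\<lambda>x. u x + s *\<^sub>R v x) (\<lambda>x. u x + s *\<^sub>R v x) = ip u u + 2 * ip u v * s + ip v v * s\<^sup>2"
proof -
  have m: "(\<lambda>x. u x + s *\<^sub>R v x) \<in> X" (is "?g \<in> X")
    using comb_mem[OF assms, of 1 s] by simp
  have "ip ?g g = ip u g + s * ip v g" if "g \<in> X" for g
    using ip_comb[OF assms that, of 1 s] by simp
  then have "ip ?g ?g = ip u ?g + s * ip v ?g" "ip ?g u = ip u u + s * ip v u"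
    "ip ?g v = ip u v + s * ip v v"
    using assms m by auto
  then show ?thesis
    using ip_sym[OF m] ip_sym assms by (simp add: algebra_simps power2_eq_square)
qed

lemma Cauchy_Schwarz:
  assumes "u \<in> X" "v \<in> X"
  shows "\<bar>ip u v\<bar> \<le> nrm u * nrm v"
proof -
  have "(ip u v)\<^sup>2 \<le> ip v v * ip u u"
  proof (rule discriminant_le)
    fix s
    have "(\<lambda>x. u x + s *\<^sub>R v x) \<in> X"
      using comb_mem[OF assms, of 1 s] by simp
    then show "0 \<le> ip u u + 2 * ip u v * s + ip v v * s\<^sup>2"
      using nrm_square_comb[OF assms] ip_nonneg by metis
  qed (use assms ip_nonneg in auto)
  then have "\<bar>ip u v\<bar> \<le> sqrt (ip v v * ip u u)"
    by (metis real_sqrt_abs real_sqrt_le_iff)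
  then show ?thesis
    by (simp add: nrm_def real_sqrt_mult mult.commute)
qed

lemma nrm_triangle:
  assumes "u \<in> X" "v \<in> X"
  shows "nrm (\<lambda>x. u x + v x) \<le> nrm u + nrm v"
proof -
  have "(nrm (\<lambda>x. u x + v x))\<^sup>2 = (nrm u)\<^sup>2 + 2 * ip u v + (nrm v)\<^sup>2"
    using nrm_square_comb[OF assms, of 1] by (simp add: nrm_square add_mem assms)
  also have "\<dots> \<le> (nrm u + nrm v)\<^sup>2"
    using Cauchy_Schwarz[OF assms] by (simp add: power2_sum)
  finally show ?thesis
    using nrm_nonneg assms by (meson add_nonneg_nonneg power2_le_imp_le)
qed

lemma nrm_scale: "u \<in> X \<Longrightarrow> nrm (\<lambda>x. a *\<^sub>R u x) = \<bar>a\<bar> * nrm u"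
  using ip_scale[of u "\<lambda>x. a *\<^sub>R u x" a] ip_scale[of u u a]
  by (simp add: nrm_def scale_mem ip_sym real_sqrt_mult flip: mult.assoc)

lemma nrm_zero: "nrm (\<lambda>x. 0) = 0"
  by (simp add: nrm_def ip_zero zero_mem)

lemma nrm_diff_commute:
  assumes "u \<in> X" "v \<in> X"
  shows "nrm (\<lambda>x. u x - v x) = nrm (\<lambda>x. v x - u x)"
  using nrm_scale[OF diff_mem[OF assms], of "-1"] by simp

lemma nrm_triangle_diff:
  assumes "u \<in> X" "v \<in> X"
  shows "nrm (\<lambda>x. u x - v x) \<le> nrm u + nrm v"
  using nrm_triangle[OF assms(1) scale_mem[OF assms(2), of "-1"]] nrm_scale[OF assms(2), of "-1"]
  by simp

lemma nrm_reverse_triangle: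
  assumes "u \<in> X" "v \<in> X"
  shows "\<bar>nrm u - nrm v\<bar> \<le> nrm (\<lambda>x. u x - v x)"
  using nrm_triangle[OF diff_mem[OF assms] assms(2)]
    nrm_triangle[OF diff_mem[OF assms(2,1)] assms(1)] nrm_diff_commute[OF assms]
  by simp

text \<open>
  The Riesz representation theorem in a space that may be incomplete, with an error of \<open>1 / (n + 1)\<close>
  in the dual norm: if \<open>r\<close> minimises the energy \<open>ip u u / 2 - l u\<close> up to \<open>\<epsilon>\<close>, then the comparison of \<open>r\<close>
  with \<open>r + s u\<close> for all real \<open>s\<close> gives a quadratic polynomial in \<open>s\<close> that is nonnegative, and its
  discriminant bounds the linear coefficient \<open>ip r u - l u\<close>.
\<close>

lemma approximate_Riesz:
  fixes l :: "('c \<Rightarrow> 'b) \<Rightarrow> real"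
  assumes lin: "\<And>u v a b. \<lbrakk>u \<in> X; v \<in> X\<rbrakk> \<Longrightarrow> l (\<lambda>x. a *\<^sub>R u x + b *\<^sub>R v x) = a * l u + b * l v"
    and bound: "\<And>u. u \<in> X \<Longrightarrow> \<bar>l u\<bar> \<le> C * nrm u"
  obtains r where "\<And>n::nat. r n \<in> X"
    and "\<And>n u. u \<in> X \<Longrightarrow> \<bar>ip (r n) u - l u\<bar> \<le> nrm u / (real n + 1)"
proof -
  define J where "J u = ip u u / 2 - l u" for u
  have below: "- (C\<^sup>2 / 2) \<le> J u" if "u \<in> X" for u
  proof -
    have "0 \<le> (nrm u - C)\<^sup>2" by simp
    then have "C * nrm u \<le> (nrm u)\<^sup>2 / 2 + C\<^sup>2 / 2"
      by (simp add: power2_diff algebra_simps)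
    then show ?thesis
      using bound[OF that] that by (simp add: J_def nrm_square)
  qed
  have bdd: "bdd_below (J ` X)"
    using below by (auto simp: bdd_below_def)
  have "\<exists>r\<in>X. \<forall>u\<in>X. \<bar>ip r u - l u\<bar> \<le> nrm u / (real n + 1)" for n :: nat
  proof -
    \<comment> \<open>Minimality up to \<open>\<epsilon>\<close> gives \<open>(ip r u - l u)\<^sup>2 \<le> 2 \<epsilon> (nrm u)\<^sup>2\<close>.\<close>
    define \<epsilon> where "\<epsilon> = 1 / (2 * (real n + 1)\<^sup>2)"
    have "\<epsilon> > 0" by (simp add: \<epsilon>_def)
    then have "Inf (J ` X) < Inf (J ` X) + \<epsilon>" by simp
    then obtain r where r: "r \<in> X" "J r < Inf (J ` X) + \<epsilon>"
      using cInf_lessD[of "J ` X" "Inf (J ` X) + \<epsilon>"] zero_mem by blast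
    have min: "J r \<le> J u + \<epsilon>" if "u \<in> X" for u
      using cINF_lower[OF bdd that] r by simp
    have "\<bar>ip r u - l u\<bar> \<le> nrm u / (real n + 1)" if u: "u \<in> X" for u
    proof -
      have "(ip r u - l u)\<^sup>2 \<le> ip u u * (2 * \<epsilon>)"
      proof (rule discriminant_le)
        fix s
        have m: "(\<lambda>x. r x + s *\<^sub>R u x) \<in> X"
          using comb_mem[OF r(1) u, of 1 s] by simp
        have "l (\<lambda>x. r x + s *\<^sub>R u x) = l r + s * l u"
          using lin[OF r(1) u, of 1 s] by simp
        then show "0 \<le> 2 * \<epsilon> + 2 * (ip r u - l u) * s + ip u u * s\<^sup>2"
          using min[OF m] nrm_square_comb[OF r(1) u, of s] by (simp add: J_def field_simps)
      qed (use ip_nonneg[OF u] in simp)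
      also have "\<dots> = (nrm u / (real n + 1))\<^sup>2"
        by (simp add: \<epsilon>_def nrm_square u power_divide)
      finally show ?thesis
        using nrm_nonneg[OF u] by (simp add: abs_le_square_iff[symmetric])
    qed
    then show ?thesis using r(1) by blast
  qed
  then obtain r where "\<And>n::nat. r n \<in> X \<and> (\<forall>u\<in>X. \<bar>ip (r n) u - l u\<bar> \<le> nrm u / (real n + 1))"
    by metis
  then show ?thesis using that[of r] by blast
qed

end

section \<open>Square-integrable functions\<close>

lemma integrable_inner_L2:
  assumes "u \<in> L2 S" "v \<in> L2 S"
  shows "integrable (lebesgue_on S) (\<lambda>x. u x \<bullet> v x)"
proof (rule Bochner_Integration.integrable_bound)
  show "integrable (lebesgue_on S) (\<lambda>x. (norm (u x))\<^sup>2 + (norm (v x))\<^sup>2)"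
    using assms by (auto simp: L2_def)
  show "(\<lambda>x. u x \<bullet> v x) \<in> borel_measurable (lebesgue_on S)"
    using assms by (auto simp: L2_def)
  have "\<bar>a \<bullet> b\<bar> \<le> (norm a)\<^sup>2 + (norm b)\<^sup>2" for a b :: 'b
  proof -
    have "0 \<le> (norm a - norm b)\<^sup>2" by simp
    moreover have "\<bar>a \<bullet> b\<bar> \<le> norm a * norm b" by (rule Cauchy_Schwarz_ineq2)
    moreover have "0 \<le> norm a * norm b" by simp
    ultimately show ?thesis unfolding power2_diff by linarith
  qed
  then show "AE x in lebesgue_on S. norm (u x \<bullet> v x) \<le> norm ((norm (u x))\<^sup>2 + (norm (v x))\<^sup>2)"
    by (simp add: order_trans[OF _ abs_ge_self])
qed

lemma L2_comb:
  assumes "u \<in> L2 S" "v \<in> L2 S"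
  shows "(\<lambda>x. a *\<^sub>R u x + b *\<^sub>R v x) \<in> L2 S"
proof -
  have "(\<lambda>x. (norm (a *\<^sub>R u x + b *\<^sub>R v x))\<^sup>2) =
    (\<lambda>x. a\<^sup>2 * (norm (u x))\<^sup>2 + 2 * a * b * (u x \<bullet> v x) + b\<^sup>2 * (norm (v x))\<^sup>2)"
    unfolding power2_norm_eq_inner
    by (simp add: inner_add inner_commute algebra_simps power2_eq_square)
  moreover have "integrable (lebesgue_on S)
    (\<lambda>x. a\<^sup>2 * (norm (u x))\<^sup>2 + 2 * a * b * (u x \<bullet> v x) + b\<^sup>2 * (norm (v x))\<^sup>2)"
    using assms integrable_inner_L2[OF assms] by (auto simp: L2_def)
  ultimately show ?thesis
    using assms by (auto simp: L2_def)
qed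

lemma semi_inner_L2: "semi_inner_space (L2 S) (L2_inner S)"
proof
  show "(\<lambda>x. 0) \<in> L2 S" by (simp add: L2_def)
  show "(\<lambda>x. a *\<^sub>R u x + b *\<^sub>R v x) \<in> L2 S" if "u \<in> L2 S" "v \<in> L2 S" for u v :: "'a \<Rightarrow> 'b" and a b
    using that by (rule L2_comb)
  show "L2_inner S (\<lambda>x. a *\<^sub>R u x + b *\<^sub>R v x) g = a * L2_inner S u g + b * L2_inner S v g"
    if "u \<in> L2 S" "v \<in> L2 S" "g \<in> L2 S" for u v g :: "'a \<Rightarrow> 'b" and a b
    using integrable_inner_L2[OF that(1,3)] integrable_inner_L2[OF that(2,3)]
    by (simp add: L2_inner_def inner_add_left)
  show "L2_inner S u v = L2_inner S v u" for u v :: "'a \<Rightarrow> 'b"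
    by (simp add: L2_inner_def inner_commute)
  show "0 \<le> L2_inner S u u" for u :: "'a \<Rightarrow> 'b"
    by (simp add: L2_inner_def)
qed

interpretation L2: semi_inner_space "L2 S" "L2_inner S"
  rewrites "semi_inner_space.nrm (L2_inner S) = L2_norm S"
proof -
  show "semi_inner_space (L2 S) (L2_inner S)" by (rule semi_inner_L2)
  show "semi_inner_space.nrm (L2_inner S) = L2_norm S"
    by (simp add: semi_inner_space.nrm_def[OF semi_inner_L2] L2_norm_def fun_eq_iff)
qed

lemma L2_inner_cong_AE:
  assumes "AE x in lebesgue_on S. u x = u' x" "AE x in lebesgue_on S. v x = v' x"
    and "u \<in> L2 S" "u' \<in> L2 S" "v \<in> L2 S" "v' \<in> L2 S"
  shows "L2_inner S u v = L2_inner S u' v'"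
  unfolding L2_inner_def
proof (rule integral_cong_AE)
  show "AE x in lebesgue_on S. u x \<bullet> v x = u' x \<bullet> v' x"
    using assms(1,2) by eventually_elim simp
  show "(\<lambda>x. u x \<bullet> v x) \<in> borel_measurable (lebesgue_on S)"
    "(\<lambda>x. u' x \<bullet> v' x) \<in> borel_measurable (lebesgue_on S)"
    using integrable_inner_L2 assms(3-6) borel_measurable_integrable by blast+
qed

section \<open>Smooth functions of compact support\<close>

lemma GDERIV_component:
  "GDERIV (\<lambda>x. x \<bullet> b) x :> b"
  unfolding gderiv_def by (auto intro!: derivative_eq_intros)

lemma GDERIV_imp_continuous_on:
  assumes "\<And>x. GDERIV \<phi> x :> g x"
  shows "continuous_on A \<phi>"
  using assms unfolding gderiv_def
  by (meson continuous_at_imp_continuous_on has_derivative_continuous)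

lemma GDERIV_frechet_derivative:
  "GDERIV \<phi> x :> g \<Longrightarrow> frechet_derivative \<phi> (at x) b = g \<bullet> b"
  unfolding gderiv_def by (metis frechet_derivative_at inner_commute)

lemma GDERIV_unique:
  fixes \<phi> :: "'a::euclidean_space \<Rightarrow> real"
  assumes "\<And>x. GDERIV \<phi> x :> g x" "\<And>x. GDERIV \<phi> x :> g' x"
  shows "g = g'"
proof (rule ext, rule euclidean_eqI)
  show "g x \<bullet> b = g' x \<bullet> b" for x b
    using GDERIV_frechet_derivative[OF assms(1), of x b] GDERIV_frechet_derivative[OF assms(2), of x b]
    by simp
qed

lemma C_k_SucI:
  assumes "\<And>x. GDERIV \<phi> x :> g x" "\<And>b. b \<in> Basis \<Longrightarrow> C_k m (\<lambda>x. g x \<bullet> b)"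
  shows "C_k (Suc m) \<phi>"
  using assms by auto

lemma C_k_SucD: "C_k (Suc m) \<phi> \<Longrightarrow> C_k m \<phi>"
proof (induction m arbitrary: \<phi>)
  case 0
  then show ?case using GDERIV_imp_continuous_on by force
next
  case (Suc m)
  then obtain g where g: "\<And>x. GDERIV \<phi> x :> g x" "\<And>b. b \<in> Basis \<Longrightarrow> C_k (Suc m) (\<lambda>x. g x \<bullet> b)"
    by (subst (asm) C_k.simps) blast
  show ?case
    by (rule C_k_SucI[OF g(1)]) (use Suc.IH g(2) in blast)
qed

lemma C_k_const: "C_k m (\<lambda>x. c)"
proof (induction m arbitrary: c)
  case (Suc m)
  show ?case
    by (rule C_k_SucI[where g = "\<lambda>x. 0"]) (simp_all add: GDERIV_const Suc)
qed simp

lemma C_k_add: "\<lbrakk>C_k m \<phi>; C_k m \<eta>\<rbrakk> \<Longrightarrow> C_k m (\<lambda>x. \<phi> x + \<eta> x)"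
proof (induction m arbitrary: \<phi> \<eta>)
  case 0
  then show ?case by (simp add: continuous_on_add)
next
  case (Suc m)
  from Suc.prems obtain g h where g: "\<And>x. GDERIV \<phi> x :> g x" "\<And>b. b \<in> Basis \<Longrightarrow> C_k m (\<lambda>x. g x \<bullet> b)"
    and h: "\<And>x. GDERIV \<eta> x :> h x" "\<And>b. b \<in> Basis \<Longrightarrow> C_k m (\<lambda>x. h x \<bullet> b)"
    unfolding C_k.simps by blast
  show ?case
    by (rule C_k_SucI[OF GDERIV_add[OF g(1) h(1)]]) (simp add: inner_add_left Suc.IH g(2) h(2))
qed

lemma C_k_mult: "\<lbrakk>C_k m \<phi>; C_k m \<eta>\<rbrakk> \<Longrightarrow> C_k m (\<lambda>x. \<phi> x * \<eta> x)"
proof (induction m arbitrary: \<phi> \<eta>)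
  case 0
  then show ?case by (simp add: continuous_on_mult)
next
  case (Suc m)
  from Suc.prems obtain g h where g: "\<And>x. GDERIV \<phi> x :> g x" "\<And>b. b \<in> Basis \<Longrightarrow> C_k m (\<lambda>x. g x \<bullet> b)"
    and h: "\<And>x. GDERIV \<eta> x :> h x" "\<And>b. b \<in> Basis \<Longrightarrow> C_k m (\<lambda>x. h x \<bullet> b)"
    unfolding C_k.simps by blast
  have "C_k m \<phi>" "C_k m \<eta>"
    using Suc.prems C_k_SucD by blast+
  then show ?case
    by (intro C_k_SucI[OF GDERIV_mult[OF g(1) h(1)]])
      (simp add: inner_add_left C_k_add Suc.IH g(2) h(2))
qed

lemma C_k_prod: "(\<And>i. i \<in> I \<Longrightarrow> C_k m (\<phi> i)) \<Longrightarrow> C_k m (\<lambda>x. \<Prod>i\<in>I. \<phi> i x)"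
  by (induction I rule: infinite_finite_induct) (auto simp: C_k_const C_k_mult)

text \<open>
  The family \<open>s \<mapsto> exp (-1/s) / s\<^sup>j\<close>, extended by zero to \<open>s \<le> 0\<close>, is closed under
  differentiation up to linear combinations, which makes each member smooth.
\<close>

definition exp_recip :: "nat \<Rightarrow> real \<Rightarrow> real" where
  "exp_recip j s = (if s > 0 then exp (- 1 / s) / s ^ j else 0)"

lemma exp_recip_tendsto_0: "((\<lambda>s. exp_recip j s) \<longlongrightarrow> 0) (at 0)"
proof -
  have "((\<lambda>s::real. inverse s ^ j / exp (inverse s)) \<longlongrightarrow> 0) (at_right 0)"
    by (rule filterlim_compose[OF tendsto_power_div_exp_0 filterlim_inverse_at_top_right])
  then have "((\<lambda>s. exp_recip j s) \<longlongrightarrow> 0) (at_right 0)"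
    by (rule Lim_transform_eventually)
      (auto simp: exp_recip_def exp_minus field_simps intro!: eventually_mono[OF eventually_at_right_less])
  moreover have "((\<lambda>s. exp_recip j s) \<longlongrightarrow> 0) (at_left 0)"
    by (rule tendsto_eventually) (auto simp: exp_recip_def eventually_at_filter)
  ultimately show ?thesis
    by (simp add: filterlim_at_split)
qed

lemma DERIV_exp_recip:
  "DERIV (exp_recip j) s :> exp_recip (j + 2) s - real j * exp_recip (Suc j) s"
proof (cases s "0::real" rule: linorder_cases)
  case less
  have "DERIV (\<lambda>s. 0) s :> (0::real)" by simp
  then have "DERIV (exp_recip j) s :> 0"
    by (rule has_field_derivative_transform_within_open[where S = "{..<0}"])
      (use less in \<open>auto simp: exp_recip_def\<close>)
  then show ?thesis using less by (simp add: exp_recip_def)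
next
  case equal
  have "((\<lambda>h. exp_recip (Suc j) h) \<longlongrightarrow> 0) (at 0)" by (rule exp_recip_tendsto_0)
  then have "((\<lambda>h. (exp_recip j (0 + h) - exp_recip j 0) / h) \<longlongrightarrow> 0) (at 0)"
    by (rule Lim_transform_eventually) (auto simp: exp_recip_def)
  then show ?thesis
    using equal by (simp add: DERIV_def) (simp add: exp_recip_def)
next
  case greater
  have "DERIV (\<lambda>s. exp (- 1 / s) / s ^ j) s :>
      exp_recip (j + 2) s - real j * exp_recip (Suc j) s"
    using greater
    by (cases j) (auto intro!: derivative_eq_intros simp: exp_recip_def field_simps power2_eq_square,
        metis One_nat_def mult.commute neq0_conv power_minus_mult)
  then show ?thesis
    by (rule has_field_derivative_transform_within_open[where S = "{0<..}"])
      (use greater in \<open>auto simp: exp_recip_def\<close>)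
qed

lemma C_k_exp_recip: "C_k m (\<lambda>x. exp_recip j (\<alpha> + \<beta> * (x \<bullet> b)))"
proof (induction m arbitrary: j)
  case 0
  have "continuous_on UNIV (exp_recip j)"
    using DERIV_exp_recip DERIV_isCont continuous_at_imp_continuous_on by blast
  then show ?case
    by (auto intro!: continuous_on_compose2[of UNIV "exp_recip j"] continuous_intros)
next
  case (Suc m)
  let ?s = "\<lambda>x. \<alpha> + \<beta> * (x \<bullet> b)"
  have 1: "GDERIV ?s x :> \<beta> *\<^sub>R b" for x
    unfolding gderiv_def by (auto intro!: derivative_eq_intros)
  have 2: "GDERIV (\<lambda>x. exp_recip j (?s x)) x :>
      (exp_recip (j + 2) (?s x) - real j * exp_recip (Suc j) (?s x)) *\<^sub>R (\<beta> *\<^sub>R b)" for x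
    by (rule GDERIV_DERIV_compose[OF 1 DERIV_exp_recip])
  show ?case
  proof (rule C_k_SucI[OF 2])
    fix b' :: 'a
    have eq: "(exp_recip (j + 2) s - real j * exp_recip (Suc j) s) * (\<beta> * (b \<bullet> b')) =
      exp_recip (j + 2) s * (\<beta> * (b \<bullet> b')) + exp_recip (Suc j) s * (- real j * \<beta> * (b \<bullet> b'))" for s
      by (simp add: algebra_simps)
    show "C_k m (\<lambda>x. ((exp_recip (j + 2) (?s x) - real j * exp_recip (Suc j) (?s x)) *\<^sub>R (\<beta> *\<^sub>R b)) \<bullet> b')"
      by (simp only: inner_scaleR_left eq) (intro C_k_add C_k_mult C_k_const Suc)
  qed
qed

text \<open>Smooth functions that increase to the indicator function of the open box from \<open>a\<close> to \<open>b\<close>.\<close>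

definition box_bump :: "'a::euclidean_space \<Rightarrow> 'a \<Rightarrow> nat \<Rightarrow> 'a \<Rightarrow> real" where
  "box_bump a b n x = (\<Prod>i\<in>Basis.
    exp_recip 0 (real n * (x \<bullet> i - a \<bullet> i)) * exp_recip 0 (real n * (b \<bullet> i - x \<bullet> i)))"

lemma exp_recip_0_bounds: "0 \<le> exp_recip 0 s" "exp_recip 0 s \<le> 1"
  by (auto simp: exp_recip_def)

lemma box_bump_bounds: "0 \<le> box_bump a b n x" "box_bump a b n x \<le> 1"
  unfolding box_bump_def
  by (auto intro!: prod_nonneg prod_le_1 mult_nonneg_nonneg mult_le_one exp_recip_0_bounds)

lemma box_bump_eq_0: "x \<notin> box a b \<Longrightarrow> box_bump a b n x = 0"
proof -
  assume "x \<notin> box a b"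
  then obtain i where i: "i \<in> Basis" "\<not> (a \<bullet> i < x \<bullet> i \<and> x \<bullet> i < b \<bullet> i)"
    by (auto simp: mem_box)
  then have "exp_recip 0 (real n * (x \<bullet> i - a \<bullet> i)) * exp_recip 0 (real n * (b \<bullet> i - x \<bullet> i)) = 0"
    by (auto simp: exp_recip_def zero_less_mult_iff)
  then show ?thesis
    unfolding box_bump_def using i(1) by (intro prod_zero) auto
qed

lemma test_function_box_bump:
  assumes "cbox a b \<subseteq> S"
  shows "test_function S (box_bump a b n)"
  unfolding test_function_def
proof (intro conjI allI exI[of _ "cbox a b"] impI)
  fix m
  have "C_k m (\<lambda>x. exp_recip 0 (real n * (x \<bullet> i - a \<bullet> i)) * exp_recip 0 (real n * (b \<bullet> i - x \<bullet> i)))" for i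
    using C_k_mult[OF C_k_exp_recip[of m 0 "- real n * (a \<bullet> i)" "real n" i]
        C_k_exp_recip[of m 0 "real n * (b \<bullet> i)" "- real n" i]]
    by (simp add: algebra_simps)
  then show "C_k m (box_bump a b n)"
    unfolding box_bump_def by (rule C_k_prod)
next
  fix x assume "x \<notin> cbox a b"
  then show "box_bump a b n x = 0"
    using box_bump_eq_0 box_subset_cbox by blast
qed (use assms in auto)

lemma box_bump_tendsto: "(\<lambda>n. box_bump a b n x) \<longlonglongrightarrow> indicat_real (box a b) x"
proof (cases "x \<in> box a b")
  case True
  have 1: "(\<lambda>n. exp_recip 0 (real n * c)) \<longlonglongrightarrow> 1" if "c > 0" for c :: real
  proof -
    have "(\<lambda>n. exp (- (1 / c) * (1 / real n))) \<longlonglongrightarrow> exp (- (1 / c) * 0)"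
      by (intro tendsto_intros lim_1_over_n)
    then have "(\<lambda>n. exp (- (1 / c) * (1 / real n))) \<longlonglongrightarrow> 1"
      by simp
    then show ?thesis
      by (rule Lim_transform_eventually)
        (use that in \<open>auto simp: exp_recip_def eventually_sequentially field_simps intro!: exI[of _ 1]\<close>)
  qed
  have "(\<lambda>n. box_bump a b n x) \<longlonglongrightarrow> (\<Prod>i\<in>(Basis::'a set). 1 * 1)"
    unfolding box_bump_def
    by (intro tendsto_prod tendsto_mult 1) (use True in \<open>auto simp: mem_box\<close>)
  then show ?thesis using True by simp
qed (simp add: box_bump_eq_0)

text \<open>
  The gradient vanishes outside \<open>C\<close> too, because the complement of \<open>C\<close> is open.
\<close>

lemma test_functionD:
  assumes "test_function S \<phi>"
  obtains g C where "\<And>x. GDERIV \<phi> x :> g x" "continuous_on UNIV g" "continuous_on UNIV \<phi>"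
    "compact C" "C \<subseteq> S" "\<And>x. x \<notin> C \<Longrightarrow> \<phi> x = 0" "\<And>x. x \<notin> C \<Longrightarrow> g x = 0"
proof -
  have "C_k (Suc 0) \<phi>" using assms unfolding test_function_def by blast
  then obtain g where g: "\<And>x. GDERIV \<phi> x :> g x" "\<And>b. b \<in> Basis \<Longrightarrow> continuous_on UNIV (\<lambda>x. g x \<bullet> b)"
    by auto
  have cont: "continuous_on UNIV g"
    using g(2) continuous_on_componentwise by blast
  obtain C where C: "compact C" "C \<subseteq> S" "\<And>x. x \<notin> C \<Longrightarrow> \<phi> x = 0"
    using assms unfolding test_function_def by blast
  have "g x = 0" if "x \<notin> C" for x
  proof -
    have "open (- C)" using C(1) by (simp add: compact_imp_closed open_Compl)
    have "((\<lambda>x. 0) has_derivative (\<lambda>h. h \<bullet> g x)) (at x)"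
      by (rule has_derivative_transform_within_open[where f = \<phi>, OF _ \<open>open (- C)\<close>])
        (use g(1) that C in \<open>auto simp: gderiv_def\<close>)
    then have "(\<lambda>h. h \<bullet> g x) = (\<lambda>h. 0)"
      using has_derivative_const has_derivative_unique by blast
    then have "g x \<bullet> g x = 0" by metis
    then show ?thesis by simp
  qed
  then show ?thesis
    using that[OF g(1) cont GDERIV_imp_continuous_on[OF g(1)] C] by blast
qed

lemma borel_measurable_continuous_UNIV:
  "continuous_on UNIV f \<Longrightarrow> f \<in> borel_measurable (lebesgue_on S)"
  by (simp add: borel_measurable_continuous_onI measurable_completion measurable_restrict_space1)

lemma bounded_continuous_compact_support:
  fixes f :: "'a::topological_space \<Rightarrow> 'b::real_normed_vector"
  assumes "continuous_on UNIV f" "compact C" "\<And>x. x \<notin> C \<Longrightarrow> f x = 0"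
  obtains M where "0 < M" "\<And>x. norm (f x) \<le> M"
proof -
  have "compact (f ` C)"
    using assms(1,2) compact_continuous_image continuous_on_subset by blast
  then obtain M where "0 < M" "\<And>x. x \<in> C \<Longrightarrow> norm (f x) \<le> M"
    by (metis bounded_pos compact_imp_bounded imageI)
  then show ?thesis
    using that[of M] assms(3) by (metis less_imp_le norm_zero)
qed

lemma integrable_mult_bounded_continuous:
  fixes g \<phi> :: "'a::euclidean_space \<Rightarrow> real"
  assumes "integrable (lebesgue_on S) g" "continuous_on UNIV \<phi>" "\<And>x. \<bar>\<phi> x\<bar> \<le> M"
  shows "integrable (lebesgue_on S) (\<lambda>x. g x * \<phi> x)"
proof (rule Bochner_Integration.integrable_bound)
  show "integrable (lebesgue_on S) (\<lambda>x. M * g x)" using assms(1) by simp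
  show "(\<lambda>x. g x * \<phi> x) \<in> borel_measurable (lebesgue_on S)"
    using assms(1,2) borel_measurable_continuous_UNIV by (intro borel_measurable_times) auto
  have "\<bar>g x * \<phi> x\<bar> \<le> \<bar>M * g x\<bar>" for x
    using mult_left_mono[OF assms(3)[of x], of "\<bar>g x\<bar>"] assms(3)[of x]
    by (simp add: abs_mult mult.commute)
  then show "AE x in lebesgue_on S. norm (g x * \<phi> x) \<le> norm (M * g x)" by simp
qed

text \<open>
  The fundamental lemma of the calculus of variations. Testing with bumps that increase to the
  indicator of a box shows that the integral over each box in \<open>S\<close> vanishes, so almost every point
  of \<open>S\<close> is a Lebesgue point of \<open>g\<close> with value zero.
\<close>

lemma fundamental_lemma_variations:
  fixes g :: "'a::euclidean_space \<Rightarrow> real"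
  assumes "open S" and int: "integrable (lebesgue_on S) g"
    and zero: "\<And>\<phi>. test_function S \<phi> \<Longrightarrow> (\<forall>x. 0 \<le> \<phi> x) \<Longrightarrow> (\<integral>x. g x * \<phi> x \<partial>lebesgue_on S) = 0"
  shows "AE x in lebesgue_on S. g x = 0"
proof -
  \<comment> \<open>The differentiation theorem below concerns functions on the whole space.\<close>
  define f where "f x = (if x \<in> S then g x else 0)" for x
  have S: "S \<in> sets lebesgue" using \<open>open S\<close> by simp
  have intf: "integrable lebesgue f"
    unfolding f_def using int S by (simp add: Lebesgue_Measure.integrable_restrict_UNIV)
  have box0: "integral (cbox a b) f = 0" if ab: "cbox a b \<subseteq> S" for a b
  proof -
    have b0: "(\<integral>x. f x * box_bump a b n x \<partial>lebesgue) = 0" for n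
    proof -
      have "(\<lambda>x. f x * box_bump a b n x) = (\<lambda>x. if x \<in> S then g x * box_bump a b n x else 0)"
        by (auto simp: f_def)
      then show ?thesis
        using zero[OF test_function_box_bump[OF ab, of n] allI[OF box_bump_bounds(1)]]
        by (simp add: Lebesgue_Measure.integral_restrict_UNIV S)
    qed
    have "(\<lambda>n. \<integral>x. f x * box_bump a b n x \<partial>lebesgue) \<longlonglongrightarrow> (\<integral>x. f x * indicat_real (box a b) x \<partial>lebesgue)"
    proof (rule integral_dominated_convergence[where w = "\<lambda>x. \<bar>f x\<bar>"])
      show "(\<lambda>x. f x * indicat_real (box a b) x) \<in> borel_measurable lebesgue"
        using intf by (intro borel_measurable_times borel_measurable_indicator) auto
      show "(\<lambda>x. f x * box_bump a b n x) \<in> borel_measurable lebesgue" for n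
      proof -
        have "continuous_on UNIV (box_bump a b n)"
          using test_function_box_bump[OF ab, of n] test_functionD by blast
        then have "box_bump a b n \<in> borel_measurable lebesgue"
          using borel_measurable_continuous_UNIV[of _ UNIV] by (simp add: lebesgue_on_UNIV_eq)
        then show ?thesis using intf by (intro borel_measurable_times) auto
      qed
      show "AE x in lebesgue. norm (f x * box_bump a b n x) \<le> \<bar>f x\<bar>" for n
        using box_bump_bounds[of a b n] by (auto simp: abs_mult intro!: mult_left_le)
    qed (use intf in \<open>auto intro!: tendsto_intros box_bump_tendsto\<close>)
    then have "(\<integral>x. f x * indicat_real (box a b) x \<partial>lebesgue) = 0"
      by (simp add: b0 LIMSEQ_const_iff)
    moreover have "(\<integral>x. f x * indicat_real (box a b) x \<partial>lebesgue) = integral (box a b) f"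
    proof -
      have "(\<lambda>x. f x * indicat_real (box a b) x) = (\<lambda>x. if x \<in> box a b then f x else 0)"
        by (auto simp: indicator_def)
      moreover have "integrable (lebesgue_on (box a b)) f"
        using integrable_mult_indicator[OF _ intf, of "box a b"] by (simp add: integrable_restrict_space)
      ultimately show ?thesis
        by (simp add: Lebesgue_Measure.integral_restrict_UNIV lebesgue_integral_eq_integral)
    qed
    ultimately show ?thesis by (simp add: integral_open_interval)
  qed
  have "f integrable_on cbox a b" for a b
    using integrable_on_subcbox[OF integrable_on_lebesgue[OF intf]] by simp
  then obtain N where N: "negligible N"
    "\<And>x e. \<lbrakk>x \<notin> N; 0 < e\<rbrakk> \<Longrightarrow>
       \<exists>d>0. \<forall>h. 0 < h \<and> h < d \<longrightarrow> norm (integral (cbox x (x + h *\<^sub>R One)) f /\<^sub>R h ^ DIM('a) - f x) < e"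
    by (rule integrable_ccontinuous_explicit) blast
  have "g x = 0" if "x \<in> S" "x \<notin> N" for x
  proof (rule ccontr)
    assume "g x \<noteq> 0"
    then have "0 < \<bar>f x\<bar>" using that by (simp add: f_def)
    then obtain d where d: "d > 0"
      "\<And>h. \<lbrakk>0 < h; h < d\<rbrakk> \<Longrightarrow> norm (integral (cbox x (x + h *\<^sub>R One)) f /\<^sub>R h ^ DIM('a) - f x) < \<bar>f x\<bar>"
      using N(2)[OF \<open>x \<notin> N\<close>] by blast
    obtain r where r: "r > 0" "cball x r \<subseteq> S"
      using \<open>open S\<close> \<open>x \<in> S\<close> open_contains_cball by blast
    \<comment> \<open>A cube of side \<open>h\<close> at \<open>x\<close> lies in the ball of radius \<open>r\<close>, by comparison with the 1-norm.\<close>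
    define h where "h = min (d / 2) (r / DIM('a))"
    have h: "0 < h" "h < d" "DIM('a) * h \<le> r"
      using d(1) r(1) by (auto simp: h_def min_def field_simps)
    have "cbox x (x + h *\<^sub>R One) \<subseteq> cball x r"
    proof
      fix y assume y: "y \<in> cbox x (x + h *\<^sub>R One)"
      have "norm (y - x) \<le> (\<Sum>i\<in>Basis. \<bar>(y - x) \<bullet> i\<bar>)" by (rule norm_le_l1)
      also have "\<dots> \<le> (\<Sum>i\<in>(Basis::'a set). h)"
        using y by (intro sum_mono) (auto simp: mem_box inner_diff_left inner_add_left)
      finally show "y \<in> cball x r"
        using h by (simp add: dist_norm norm_minus_commute)
    qed
    then show False using d(2)[OF h(1,2)] box0 r(2) by force
  qed
  moreover have "AE x in lebesgue. x \<notin> N"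
    using N(1) by (simp add: negligible_iff_null_sets AE_not_in)
  then have "AE x in lebesgue. x \<in> S \<longrightarrow> x \<notin> N"
    by eventually_elim simp
  then have "AE x in lebesgue_on S. x \<notin> N"
    using S by (simp add: AE_restrict_space_iff)
  ultimately show ?thesis
    by (rule_tac lebesgue_on_mono) auto
qed

section \<open>Weak gradients\<close>

lemma integrable_compact_support:
  fixes f :: "'a::euclidean_space \<Rightarrow> real"
  assumes "continuous_on UNIV f" "compact C" "\<And>x. x \<notin> C \<Longrightarrow> f x = 0"
  shows "integrable lebesgue f"
proof -
  obtain M where M: "0 < M" "\<And>x. norm (f x) \<le> M"
    using bounded_continuous_compact_support[OF assms] by blast
  show ?thesis
  proof (rule Bochner_Integration.integrable_bound)
    show "integrable lebesgue (\<lambda>x. M * indicat_real C x)"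
      using lmeasurable_compact[OF assms(2)]
      by (intro integrable_mult_right) (simp add: lmeasurable_iff_integrable)
    show "f \<in> borel_measurable lebesgue"
      using borel_measurable_continuous_UNIV[OF assms(1), of UNIV] by (simp add: lebesgue_on_UNIV_eq)
    show "AE x in lebesgue. norm (f x) \<le> norm (M * indicat_real C x)"
      using M assms(3) by (auto simp: indicator_def)
  qed
qed

lemma integral_lebesgue_on_superset_support:
  fixes f :: "'a::euclidean_space \<Rightarrow> real"
  assumes "S \<in> sets lebesgue" "\<And>x. x \<notin> S \<Longrightarrow> f x = 0"
  shows "(\<integral>x. f x \<partial>lebesgue_on S) = (\<integral>x. f x \<partial>lebesgue)"
proof -
  have "f = (\<lambda>x. if x \<in> S then f x else 0)"
    using assms(2) by auto
  then show ?thesis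
    using Lebesgue_Measure.integral_restrict_UNIV[OF assms(1), of f] by simp
qed

lemma integrable_lebesgue_on:
  fixes f :: "'a::euclidean_space \<Rightarrow> real"
  assumes "integrable lebesgue f" "S \<in> sets lebesgue"
  shows "integrable (lebesgue_on S) f"
  using integrable_mult_indicator[of S lebesgue f] assms by (simp add: integrable_restrict_space)

lemma lborel_integral_translation:
  fixes f :: "'a::euclidean_space \<Rightarrow> real"
  assumes [measurable]: "f \<in> borel_measurable borel"
  shows "(\<integral>x. f (c + x) \<partial>lborel) = (\<integral>x. f x \<partial>lborel)"
proof -
  have "(\<integral>x. f x \<partial>lborel) = (\<integral>x. f x \<partial>distr lborel borel ((+) c))"
    by (simp add: lborel_distr_plus)
  also have "\<dots> = (\<integral>x. f (c + x) \<partial>lborel)"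
    by (subst integral_distr) auto
  finally show ?thesis by simp
qed

text \<open>
  Integration by parts without boundary terms: the integral of a directional derivative is the limit
  of the integrals of the difference quotients, which vanish by translation invariance.
\<close>

lemma integral_gradient_compact_support:
  fixes F :: "'a::euclidean_space \<Rightarrow> real"
  assumes F: "\<And>x. GDERIV F x :> G x" and G: "continuous_on UNIV G"
    and C: "compact C" "\<And>x. x \<notin> C \<Longrightarrow> F x = 0" "\<And>x. x \<notin> C \<Longrightarrow> G x = 0"
  shows "(\<integral>x. G x \<bullet> b \<partial>lebesgue) = 0"
proof -
  obtain M where M: "0 < M" "\<And>x. norm (G x) \<le> M"
    using bounded_continuous_compact_support[OF G C(1,3)] by blast
  have contF: "continuous_on UNIV F" by (rule GDERIV_imp_continuous_on[OF F])
  have [measurable]: "F \<in> borel_measurable borel" "G \<in> borel_measurable borel"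
    using contF G by (auto intro: borel_measurable_continuous_onI)
  have lip: "norm (F y - F x) \<le> M * norm (y - x)" for x y
  proof (rule differentiable_bound[where S = UNIV])
    show "(F has_derivative (\<lambda>h. h \<bullet> G z)) (at z within UNIV)" for z
      using F by (simp add: gderiv_def)
    show "onorm (\<lambda>h. h \<bullet> G z) \<le> M" for z
    proof (rule onorm_bound)
      show "norm (h \<bullet> G z) \<le> M * norm h" for h
        using Cauchy_Schwarz_ineq2[of h "G z"] mult_left_mono[OF M(2)[of z], of "norm h"]
        by (simp add: mult.commute)
    qed (use M in simp)
  qed auto
  obtain R where R: "0 < R" "\<And>x. x \<in> C \<Longrightarrow> norm x \<le> R"
    using compact_imp_bounded[OF C(1)] by (meson bounded_pos)
  define h where "h n = 1 / (real n + 1)" for n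
  have h: "0 < h n" "h n \<le> 1" for n by (auto simp: h_def field_simps)
  have h0: "h \<longlonglongrightarrow> 0"
    unfolding h_def using LIMSEQ_inverse_real_of_nat by (simp add: inverse_eq_divide add.commute)
  define D where "D n x = (F (h n *\<^sub>R b + x) - F x) / h n" for n x
  define B where "B = cball (0::'a) (R + norm b)"
  have intF: "integrable lborel F"
    using integrable_compact_support[OF contF C(1,2)] by (simp add: integrable_completion)
  have intD: "(\<integral>x. D n x \<partial>lborel) = 0" for n
  proof -
    have 1: "integrable lborel (\<lambda>x. F (h n *\<^sub>R b + x))"
      using integrable_distr[of "(+) (h n *\<^sub>R b)" lborel borel F] intF by (simp add: lborel_distr_plus)
    show ?thesis
      unfolding D_def using 1 intF lborel_integral_translation[of F] by simp
  qed
  have "(\<lambda>n. \<integral>x. D n x \<partial>lborel) \<longlonglongrightarrow> (\<integral>x. G x \<bullet> b \<partial>lborel)"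
  proof (rule integral_dominated_convergence[where w = "\<lambda>x. M * norm b * indicat_real B x"])
    have "emeasure lborel B < \<infinity>" unfolding B_def by (rule emeasure_lborel_cball_finite)
    then show "integrable lborel (\<lambda>x. M * norm b * indicat_real B x)"
      by (auto simp: B_def intro!: integrable_mult_right)
    show "(\<lambda>x. D n x) \<in> borel_measurable lborel" for n
      unfolding D_def by simp
    show "(\<lambda>x. G x \<bullet> b) \<in> borel_measurable lborel" by simp
    show "AE x in lborel. (\<lambda>n. D n x) \<longlonglongrightarrow> G x \<bullet> b"
    proof (rule AE_I2)
      fix x
      have "((\<lambda>t. F (x + t *\<^sub>R b)) has_real_derivative b \<bullet> G x) (at 0)"
      proof -
        have 1: "((\<lambda>t. x + t *\<^sub>R b) has_derivative (\<lambda>t. t *\<^sub>R b)) (at 0)"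
          by (auto intro!: derivative_eq_intros)
        have "((\<lambda>t. F (x + t *\<^sub>R b)) has_derivative (\<lambda>t. (t *\<^sub>R b) \<bullet> G x)) (at 0)"
          by (rule has_derivative_compose[OF 1, where g = F]) (use F[of x] in \<open>simp add: gderiv_def\<close>)
        then show ?thesis
          by (simp add: has_field_derivative_def mult_commute_abs)
      qed
      then have "((\<lambda>t. (F (x + t *\<^sub>R b) - F x) / t) \<longlongrightarrow> b \<bullet> G x) (at 0)"
        by (simp add: DERIV_def)
      moreover have "filterlim h (at 0) sequentially"
        using h0 h(1) by (simp add: filterlim_at less_imp_neq[symmetric])
      ultimately have "(\<lambda>n. (F (x + h n *\<^sub>R b) - F x) / h n) \<longlonglongrightarrow> b \<bullet> G x"
        by (rule filterlim_compose)
      then show "(\<lambda>n. D n x) \<longlonglongrightarrow> G x \<bullet> b"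
        by (simp add: D_def add.commute inner_commute)
    qed
    show "AE x in lborel. norm (D n x) \<le> M * norm b * indicat_real B x" for n
    proof (rule AE_I2)
      fix x
      show "norm (D n x) \<le> M * norm b * indicat_real B x"
      proof (cases "x \<in> B")
        case True
        have "\<bar>F (h n *\<^sub>R b + x) - F x\<bar> \<le> M * norm b * h n"
          using lip[of "h n *\<^sub>R b + x" x] h(1)[of n] by (simp add: ac_simps)
        then show ?thesis
          using True h(1)[of n] by (simp add: D_def field_simps)
      next
        case False
        have "norm x \<le> norm (h n *\<^sub>R b + x) + norm (h n *\<^sub>R b)"
          using norm_triangle_ineq4[of "h n *\<^sub>R b + x" "h n *\<^sub>R b"] by simp
        moreover have "norm (h n *\<^sub>R b) \<le> norm b"
          using h[of n] by (simp add: mult_left_le_one_le)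
        ultimately have "R < norm x" "R < norm (h n *\<^sub>R b + x)"
          using False norm_ge_zero[of b] by (auto simp: B_def simp del: norm_ge_zero)
        then have "x \<notin> C" "h n *\<^sub>R b + x \<notin> C"
          using R(2) by force+
        then show ?thesis using C(2) False by (simp add: D_def)
      qed
    qed
  qed
  then have "(\<integral>x. G x \<bullet> b \<partial>lborel) = 0"
    by (simp add: intD LIMSEQ_const_iff)
  then show ?thesis
    by (simp add: integral_completion)
qed

lemma test_function_L2:
  assumes "open S" "test_function S \<phi>"
  shows "\<phi> \<in> L2 S"
proof -
  obtain g C where c: "continuous_on UNIV \<phi>" "compact C" "\<And>x. x \<notin> C \<Longrightarrow> \<phi> x = 0"
    using test_functionD[OF assms(2)] by metis
  have "integrable lebesgue (\<lambda>x. (norm (\<phi> x))\<^sup>2)"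
    by (rule integrable_compact_support[OF _ c(2)]) (use c in \<open>auto intro!: continuous_intros\<close>)
  then show ?thesis
    using assms(1) c(1) borel_measurable_continuous_UNIV by (auto simp: L2_def intro!: integrable_lebesgue_on)
qed

lemma test_function_gradient_L2:
  assumes "open S" "test_function S \<phi>" "\<And>x. GDERIV \<phi> x :> g x"
  shows "g \<in> L2 S"
proof -
  obtain g' C where c: "\<And>x. GDERIV \<phi> x :> g' x" "continuous_on UNIV g'" "compact C" "\<And>x. x \<notin> C \<Longrightarrow> g' x = 0"
    using test_functionD[OF assms(2)] by metis
  have "g' = g"
    by (rule GDERIV_unique[OF c(1) assms(3)])
  have "integrable lebesgue (\<lambda>x. (norm (g' x))\<^sup>2)"
    by (rule integrable_compact_support[OF _ c(3)]) (use c in \<open>auto intro!: continuous_intros\<close>)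
  then show ?thesis
    using assms(1) c(2) borel_measurable_continuous_UNIV unfolding \<open>g' = g\<close>
    by (auto simp: L2_def intro!: integrable_lebesgue_on)
qed

text \<open>
  The gradient of the product \<open>\<phi> \<eta>\<close> integrates to zero.
\<close>

lemma weak_gradient_test_function:
  assumes "open S" "test_function S \<phi>" "\<And>x. GDERIV \<phi> x :> g x"
  shows "weak_gradient S \<phi> g"
  unfolding weak_gradient_def
proof (intro allI impI ballI)
  fix \<eta> :: "'a \<Rightarrow> real" and b :: 'a
  assume eta: "test_function S \<eta>" and b: "b \<in> Basis"
  obtain g' C where p: "\<And>x. GDERIV \<phi> x :> g' x" "continuous_on UNIV g'" "continuous_on UNIV \<phi>"
    "compact C" "C \<subseteq> S" "\<And>x. x \<notin> C \<Longrightarrow> \<phi> x = 0" "\<And>x. x \<notin> C \<Longrightarrow> g' x = 0"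
    using test_functionD[OF assms(2)] by metis
  have g': "g' = g"
    by (rule GDERIV_unique[OF p(1) assms(3)])
  obtain h D where e: "\<And>x. GDERIV \<eta> x :> h x" "continuous_on UNIV h" "continuous_on UNIV \<eta>"
    "compact D" "D \<subseteq> S" "\<And>x. x \<notin> D \<Longrightarrow> \<eta> x = 0" "\<And>x. x \<notin> D \<Longrightarrow> h x = 0"
    using test_functionD[OF eta] by metis
  have S: "S \<in> sets lebesgue" using assms(1) by simp
  have 1: "integrable lebesgue (\<lambda>x. \<phi> x * (h x \<bullet> b))" "integrable lebesgue (\<lambda>x. (g' x \<bullet> b) * \<eta> x)"
    by (rule integrable_compact_support[OF _ p(4)]; use p e in \<open>auto intro!: continuous_intros\<close>)+
  have "(\<integral>x. (\<phi> x *\<^sub>R h x + \<eta> x *\<^sub>R g' x) \<bullet> b \<partial>lebesgue) = 0"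
    by (rule integral_gradient_compact_support[OF GDERIV_mult[OF p(1) e(1)] _ p(4)])
      (use p e in \<open>auto intro!: continuous_intros\<close>)
  moreover have "(\<lambda>x. (\<phi> x *\<^sub>R h x + \<eta> x *\<^sub>R g' x) \<bullet> b) = (\<lambda>x. \<phi> x * (h x \<bullet> b) + (g' x \<bullet> b) * \<eta> x)"
    by (simp add: inner_add_left mult.commute)
  ultimately have parts: "(\<integral>x. \<phi> x * (h x \<bullet> b) \<partial>lebesgue) = - (\<integral>x. (g' x \<bullet> b) * \<eta> x \<partial>lebesgue)"
    using 1 by simp
  have zero: "\<phi> x = 0" "g' x = 0" if "x \<notin> S" for x
    using p(5-7) that by blast+
  have "(\<integral>x. \<phi> x * (h x \<bullet> b) \<partial>lebesgue_on S) = (\<integral>x. \<phi> x * (h x \<bullet> b) \<partial>lebesgue)"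
    "(\<integral>x. (g' x \<bullet> b) * \<eta> x \<partial>lebesgue_on S) = (\<integral>x. (g' x \<bullet> b) * \<eta> x \<partial>lebesgue)"
    by (rule integral_lebesgue_on_superset_support[OF S]; use zero in simp)+
  then show "(\<integral>x. \<phi> x * frechet_derivative \<eta> (at x) b \<partial>lebesgue_on S) =
      - (\<integral>x. (g x \<bullet> b) * \<eta> x \<partial>lebesgue_on S)"
    using parts by (simp add: GDERIV_frechet_derivative[OF e(1)] g')
qed

text \<open>
  The \<open>H\<^sup>1\<close> norm in the definition of \<open>H\<^sup>1\<^sub>0\<close> is applied to the difference of a test function and the
  limit. It has its intended meaning because this difference belongs to \<open>H\<^sup>1\<close>.
\<close>

lemma test_function_H1: "\<lbrakk>open S; test_function S \<phi>\<rbrakk> \<Longrightarrow> \<phi> \<in> H1 S"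
  unfolding H1_def
  using test_functionD[of S \<phi>] test_function_L2 test_function_gradient_L2 weak_gradient_test_function
  by (metis (mono_tags, lifting) mem_Collect_eq)

lemma test_function_comb:
  assumes "test_function S \<phi>" "test_function S \<eta>"
  shows "test_function S (\<lambda>x. a * \<phi> x + b * \<eta> x)"
proof -
  obtain C D where "compact C" "C \<subseteq> S" "\<And>x. x \<notin> C \<Longrightarrow> \<phi> x = 0"
    "compact D" "D \<subseteq> S" "\<And>x. x \<notin> D \<Longrightarrow> \<eta> x = 0"
    using assms unfolding test_function_def by metis
  then have "\<exists>E. compact E \<and> E \<subseteq> S \<and> (\<forall>x. x \<notin> E \<longrightarrow> a * \<phi> x + b * \<eta> x = 0)"
    by (intro exI[of _ "C \<union> D"]) auto
  then show ?thesis
    using assms unfolding test_function_def by (auto intro!: C_k_add C_k_mult C_k_const)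
qed

lemma grad_H1:
  assumes "u \<in> H1 S"
  shows "grad S u \<in> L2 S" "weak_gradient S u (grad S u)"
  using assms someI_ex[of "\<lambda>g. g \<in> L2 S \<and> weak_gradient S u g"] by (auto simp: H1_def grad_def)

lemma L2_norm_square: "(L2_norm S u)\<^sup>2 = L2_inner S u u"
  by (simp add: L2_norm_def L2_inner_def)

lemma L2_norm_cong_AE:
  "\<lbrakk>AE x in lebesgue_on S. u x = v x; u \<in> L2 S; v \<in> L2 S\<rbrakk> \<Longrightarrow> L2_norm S u = L2_norm S v"
  unfolding L2_norm_def by (simp add: L2_inner_cong_AE[of u v S u v])

lemma L2_norm_mono:
  assumes "u \<in> L2 S" "v \<in> L2 S" "\<And>x. x \<in> S \<Longrightarrow> norm (u x) \<le> c * norm (v x)" "0 \<le> c"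
  shows "L2_norm S u \<le> c * L2_norm S v"
proof -
  have "L2_inner S u u \<le> (\<integral>x. c\<^sup>2 * (v x \<bullet> v x) \<partial>lebesgue_on S)"
    unfolding L2_inner_def
  proof (rule integral_mono)
    show "integrable (lebesgue_on S) (\<lambda>x. u x \<bullet> u x)" "integrable (lebesgue_on S) (\<lambda>x. c\<^sup>2 * (v x \<bullet> v x))"
      using assms integrable_inner_L2 by auto
    show "u x \<bullet> u x \<le> c\<^sup>2 * (v x \<bullet> v x)" if "x \<in> space (lebesgue_on S)" for x
      using power_mono[OF assms(3)[of x], of 2] that by (simp add: power_mult_distrib power2_norm_eq_inner)
  qed
  also have "\<dots> = (c * L2_norm S v)\<^sup>2"
    by (simp add: L2_inner_def power_mult_distrib L2_norm_square)
  finally have "(L2_norm S u)\<^sup>2 \<le> (c * L2_norm S v)\<^sup>2"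
    by (simp add: L2_norm_square)
  then show ?thesis
    by (rule power2_le_imp_le) (use assms(4) L2.nrm_nonneg[OF assms(2)] in simp)
qed

definition H1_inner :: "'a::euclidean_space set \<Rightarrow> ('a \<Rightarrow> real) \<Rightarrow> ('a \<Rightarrow> real) \<Rightarrow> real" where
  "H1_inner S u v = L2_inner S u v + dirichlet_form S u v"

lemma H1_norm_eq: "H1_norm S u = sqrt (H1_inner S u u)"
  by (simp add: H1_norm_def H1_inner_def L2_norm_square dirichlet_form_def)

lemma H10_subset_H1: "u \<in> H10 S \<Longrightarrow> u \<in> H1 S"
  by (simp add: H10_def)

lemma H1_subset_L2: "u \<in> H1 S \<Longrightarrow> u \<in> L2 S"
  by (simp add: H1_def)

section \<open>The spaces \<open>H\<^sup>1\<close> and \<open>H\<^sup>1\<^sub>0\<close>\<close>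

text \<open>
  On a bounded set \<open>L\<^sup>2\<close> functions are integrable, which gives a meaning to the integrals in the
  definition of the weak gradient, and the Poincare inequality holds.
\<close>

locale bounded_open_set =
  fixes \<Omega> :: "'a::euclidean_space set"
  assumes open_domain: "open \<Omega>" and bounded_domain: "bounded \<Omega>"
begin

lemma domain_lmeasurable: "\<Omega> \<in> lmeasurable"
  by (rule lmeasurable_open[OF bounded_domain open_domain])

lemma L2_const: "(\<lambda>x. c) \<in> L2 \<Omega>"
proof -
  interpret finite_measure "lebesgue_on \<Omega>"
    by (rule finite_measure_lebesgue_on[OF domain_lmeasurable])
  show ?thesis by (simp add: L2_def)
qed

lemma L2_component_integrable:
  assumes "u \<in> L2 \<Omega>"
  shows "integrable (lebesgue_on \<Omega>) (\<lambda>x. u x \<bullet> b)"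
  using integrable_inner_L2[OF assms L2_const[of b]] .

lemma L2_integrable:
  fixes u :: "'a \<Rightarrow> real"
  shows "u \<in> L2 \<Omega> \<Longrightarrow> integrable (lebesgue_on \<Omega>) u"
  using L2_component_integrable[of u 1] by simp

lemma integrable_mult_test:
  assumes "integrable (lebesgue_on \<Omega>) u" "test_function \<Omega> \<phi>"
  shows "integrable (lebesgue_on \<Omega>) (\<lambda>x. u x * \<phi> x)"
    and "integrable (lebesgue_on \<Omega>) (\<lambda>x. u x * frechet_derivative \<phi> (at x) b)"
proof -
  obtain g C where p: "\<And>x. GDERIV \<phi> x :> g x" "continuous_on UNIV g" "continuous_on UNIV \<phi>"
    "compact C" "\<And>x. x \<notin> C \<Longrightarrow> \<phi> x = 0" "\<And>x. x \<notin> C \<Longrightarrow> g x = 0"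
    using test_functionD[OF assms(2)] by metis
  obtain M where "\<And>x. norm (\<phi> x) \<le> M"
    using bounded_continuous_compact_support[OF p(3,4,5)] by blast
  then show "integrable (lebesgue_on \<Omega>) (\<lambda>x. u x * \<phi> x)"
    using integrable_mult_bounded_continuous[OF assms(1) p(3), of M] by simp
  have c: "continuous_on UNIV (\<lambda>x. g x \<bullet> b)"
    using p(2) by (intro continuous_intros)
  obtain M' where "\<And>x. norm (g x \<bullet> b) \<le> M'"
    using bounded_continuous_compact_support[OF c p(4)] p(6) by (metis inner_zero_left)
  then have "integrable (lebesgue_on \<Omega>) (\<lambda>x. u x * (g x \<bullet> b))"
    using integrable_mult_bounded_continuous[OF assms(1) c, of M'] by simp
  then show "integrable (lebesgue_on \<Omega>) (\<lambda>x. u x * frechet_derivative \<phi> (at x) b)"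
    by (simp add: GDERIV_frechet_derivative[OF p(1)])
qed

text \<open>
  Uniqueness makes the gradient, which is defined by a choice, linear up to null sets.
\<close>

lemma weak_gradient_unique:
  assumes "weak_gradient \<Omega> u g" "weak_gradient \<Omega> u g'" "g \<in> L2 \<Omega>" "g' \<in> L2 \<Omega>"
  shows "AE x in lebesgue_on \<Omega>. g x = g' x"
proof -
  have "AE x in lebesgue_on \<Omega>. (g x - g' x) \<bullet> b = 0" if b: "b \<in> Basis" for b
  proof (rule fundamental_lemma_variations[OF open_domain])
    show "integrable (lebesgue_on \<Omega>) (\<lambda>x. (g x - g' x) \<bullet> b)"
      using L2.diff_mem[OF assms(3,4)] L2_component_integrable by blast
    fix \<phi> :: "'a \<Rightarrow> real" assume phi: "test_function \<Omega> \<phi>"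
    have "(\<integral>x. (g x \<bullet> b) * \<phi> x \<partial>lebesgue_on \<Omega>) = (\<integral>x. (g' x \<bullet> b) * \<phi> x \<partial>lebesgue_on \<Omega>)"
      using assms(1)[unfolded weak_gradient_def, rule_format, OF phi b]
        assms(2)[unfolded weak_gradient_def, rule_format, OF phi b] by simp
    then show "(\<integral>x. (g x - g' x) \<bullet> b * \<phi> x \<partial>lebesgue_on \<Omega>) = 0"
      using integrable_mult_test(1)[OF L2_component_integrable phi, of g b]
        integrable_mult_test(1)[OF L2_component_integrable phi, of g' b] assms(3,4)
      by (simp add: inner_diff_left left_diff_distrib)
  qed
  then have "AE x in lebesgue_on \<Omega>. \<forall>b\<in>Basis. (g x - g' x) \<bullet> b = 0"
    by (intro AE_finite_allI) auto
  then show ?thesis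
    by eventually_elim (metis eq_iff_diff_eq_0 euclidean_all_zero_iff)
qed

lemma grad_eq_AE:
  assumes "u \<in> H1 \<Omega>" "weak_gradient \<Omega> u g" "g \<in> L2 \<Omega>"
  shows "AE x in lebesgue_on \<Omega>. grad \<Omega> u x = g x"
  using weak_gradient_unique grad_H1 assms by blast

lemma weak_gradient_comb:
  assumes "u \<in> H1 \<Omega>" "v \<in> H1 \<Omega>"
  shows "weak_gradient \<Omega> (\<lambda>x. a * u x + b * v x) (\<lambda>x. a *\<^sub>R grad \<Omega> u x + b *\<^sub>R grad \<Omega> v x)"
  unfolding weak_gradient_def
proof (intro allI impI ballI)
  fix \<phi> :: "'a \<Rightarrow> real" and i :: 'a
  assume phi: "test_function \<Omega> \<phi>" and i: "i \<in> Basis"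
  have L: "integrable (lebesgue_on \<Omega>) u" "integrable (lebesgue_on \<Omega>) v"
    "integrable (lebesgue_on \<Omega>) (\<lambda>x. grad \<Omega> u x \<bullet> i)" "integrable (lebesgue_on \<Omega>) (\<lambda>x. grad \<Omega> v x \<bullet> i)"
    using assms by (auto intro!: L2_integrable L2_component_integrable H1_subset_L2 grad_H1)
  let ?D = "\<lambda>x. frechet_derivative \<phi> (at x) i"
  have "(\<integral>x. (a * u x + b * v x) * ?D x \<partial>lebesgue_on \<Omega>) =
    a * (\<integral>x. u x * ?D x \<partial>lebesgue_on \<Omega>) + b * (\<integral>x. v x * ?D x \<partial>lebesgue_on \<Omega>)"
    using integrable_mult_test(2)[OF L(1) phi] integrable_mult_test(2)[OF L(2) phi]
    by (simp add: distrib_right mult.assoc)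
  also have "\<dots> = - (a * (\<integral>x. (grad \<Omega> u x \<bullet> i) * \<phi> x \<partial>lebesgue_on \<Omega>)
      + b * (\<integral>x. (grad \<Omega> v x \<bullet> i) * \<phi> x \<partial>lebesgue_on \<Omega>))"
    using grad_H1(2)[OF assms(1)] grad_H1(2)[OF assms(2)] phi i unfolding weak_gradient_def by simp
  also have "\<dots> = - (\<integral>x. ((a *\<^sub>R grad \<Omega> u x + b *\<^sub>R grad \<Omega> v x) \<bullet> i) * \<phi> x \<partial>lebesgue_on \<Omega>)"
    using integrable_mult_test(1)[OF L(3) phi] integrable_mult_test(1)[OF L(4) phi]
    by (simp add: distrib_right mult.assoc inner_add_left)
  finally show "(\<integral>x. (a * u x + b * v x) * ?D x \<partial>lebesgue_on \<Omega>) =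
    - (\<integral>x. ((a *\<^sub>R grad \<Omega> u x + b *\<^sub>R grad \<Omega> v x) \<bullet> i) * \<phi> x \<partial>lebesgue_on \<Omega>)" .
qed

lemma H1_comb:
  assumes "u \<in> H1 \<Omega>" "v \<in> H1 \<Omega>"
  shows "(\<lambda>x. a * u x + b * v x) \<in> H1 \<Omega>"
  using weak_gradient_comb[OF assms, of a b] L2_comb[of "grad \<Omega> u" \<Omega> "grad \<Omega> v" a b]
    L2_comb[of u \<Omega> v a b] assms grad_H1
  by (auto simp: H1_def)

lemma grad_comb:
  assumes "u \<in> H1 \<Omega>" "v \<in> H1 \<Omega>"
  shows "AE x in lebesgue_on \<Omega>. grad \<Omega> (\<lambda>x. a * u x + b * v x) x = a *\<^sub>R grad \<Omega> u x + b *\<^sub>R grad \<Omega> v x"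
  by (rule grad_eq_AE[OF H1_comb weak_gradient_comb]) (auto simp: assms grad_H1 L2_comb)

lemma semi_inner_dirichlet: "semi_inner_space (H1 \<Omega>) (dirichlet_form \<Omega>)"
proof
  have "test_function \<Omega> (\<lambda>x. 0)"
    unfolding test_function_def using C_k_const by blast
  then show "(\<lambda>x. 0) \<in> H1 \<Omega>" by (rule test_function_H1[OF open_domain])
  show "(\<lambda>x. a *\<^sub>R u x + b *\<^sub>R v x) \<in> H1 \<Omega>" if "u \<in> H1 \<Omega>" "v \<in> H1 \<Omega>" for u v a b
    using H1_comb[OF that] by simp
  show "dirichlet_form \<Omega> (\<lambda>x. a *\<^sub>R u x + b *\<^sub>R v x) g = a * dirichlet_form \<Omega> u g + b * dirichlet_form \<Omega> v g"
    if "u \<in> H1 \<Omega>" "v \<in> H1 \<Omega>" "g \<in> H1 \<Omega>" for u v g a b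
  proof -
    have "dirichlet_form \<Omega> (\<lambda>x. a *\<^sub>R u x + b *\<^sub>R v x) g
        = L2_inner \<Omega> (\<lambda>x. a *\<^sub>R grad \<Omega> u x + b *\<^sub>R grad \<Omega> v x) (grad \<Omega> g)"
      unfolding dirichlet_form_def
      using that grad_comb[OF that(1,2), of a b] H1_comb[OF that(1,2), of a b]
      by (intro L2_inner_cong_AE) (auto simp: grad_H1 L2_comb)
    then show ?thesis
      using that by (simp add: L2.ip_comb grad_H1 dirichlet_form_def)
  qed
  show "dirichlet_form \<Omega> u v = dirichlet_form \<Omega> v u" for u v
    by (simp add: dirichlet_form_def L2_inner_def inner_commute)
  show "0 \<le> dirichlet_form \<Omega> u u" for u
    by (simp add: dirichlet_form_def L2_inner_def)
qed

lemma semi_inner_H1: "semi_inner_space (H1 \<Omega>) (H1_inner \<Omega>)"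
proof -
  interpret D: semi_inner_space "H1 \<Omega>" "dirichlet_form \<Omega>" by (rule semi_inner_dirichlet)
  show ?thesis
  proof
    show "H1_inner \<Omega> (\<lambda>x. a *\<^sub>R u x + b *\<^sub>R v x) g = a * H1_inner \<Omega> u g + b * H1_inner \<Omega> v g"
      if "u \<in> H1 \<Omega>" "v \<in> H1 \<Omega>" "g \<in> H1 \<Omega>" for u v g a b
      using D.ip_comb[OF that, of a b] L2.ip_comb[OF that[THEN H1_subset_L2], of a b]
      by (simp add: H1_inner_def algebra_simps)
    show "H1_inner \<Omega> u v = H1_inner \<Omega> v u" if "u \<in> H1 \<Omega>" "v \<in> H1 \<Omega>" for u v
      using D.ip_sym[OF that] by (simp add: H1_inner_def L2_inner_def mult.commute)
    show "0 \<le> H1_inner \<Omega> u u" if "u \<in> H1 \<Omega>" for u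
      using D.ip_nonneg[OF that] L2.ip_nonneg[OF H1_subset_L2[OF that]] by (simp add: H1_inner_def)
  qed (use D.zero_mem D.comb_mem in auto)
qed

sublocale H1: semi_inner_space "H1 \<Omega>" "H1_inner \<Omega>"
  rewrites "semi_inner_space.nrm (H1_inner \<Omega>) = H1_norm \<Omega>"
proof -
  show "semi_inner_space (H1 \<Omega>) (H1_inner \<Omega>)" by (rule semi_inner_H1)
  show "semi_inner_space.nrm (H1_inner \<Omega>) = H1_norm \<Omega>"
    by (simp add: semi_inner_space.nrm_def[OF semi_inner_H1] H1_norm_eq fun_eq_iff)
qed

lemma H10_comb:
  assumes "u \<in> H10 \<Omega>" "v \<in> H10 \<Omega>"
  shows "(\<lambda>x. a * u x + b * v x) \<in> H10 \<Omega>"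
proof -
  obtain \<phi> \<eta> where phi: "\<And>n::nat. test_function \<Omega> (\<phi> n)" "(\<lambda>n. H1_norm \<Omega> (\<lambda>x. \<phi> n x - u x)) \<longlonglongrightarrow> 0"
    and eta: "\<And>n::nat. test_function \<Omega> (\<eta> n)" "(\<lambda>n. H1_norm \<Omega> (\<lambda>x. \<eta> n x - v x)) \<longlonglongrightarrow> 0"
    using assms unfolding H10_def by auto
  have uv: "u \<in> H1 \<Omega>" "v \<in> H1 \<Omega>" using assms by (auto intro: H10_subset_H1)
  have d: "(\<lambda>x. \<phi> n x - u x) \<in> H1 \<Omega>" "(\<lambda>x. \<eta> n x - v x) \<in> H1 \<Omega>" for n
    using test_function_H1[OF open_domain] phi(1) eta(1) uv H1.diff_mem by blast+
  have "(\<lambda>n. H1_norm \<Omega> (\<lambda>x. (a * \<phi> n x + b * \<eta> n x) - (a * u x + b * v x))) \<longlonglongrightarrow> 0"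
  proof (rule tendsto_sandwich[where f = "\<lambda>n. 0"])
    have "(\<lambda>n. \<bar>a\<bar> * H1_norm \<Omega> (\<lambda>x. \<phi> n x - u x) + \<bar>b\<bar> * H1_norm \<Omega> (\<lambda>x. \<eta> n x - v x)) \<longlonglongrightarrow> \<bar>a\<bar> * 0 + \<bar>b\<bar> * 0"
      by (intro tendsto_intros phi(2) eta(2))
    then show "(\<lambda>n. \<bar>a\<bar> * H1_norm \<Omega> (\<lambda>x. \<phi> n x - u x) + \<bar>b\<bar> * H1_norm \<Omega> (\<lambda>x. \<eta> n x - v x)) \<longlonglongrightarrow> 0"
      by simp
    have eq: "(\<lambda>x. (a * \<phi> n x + b * \<eta> n x) - (a * u x + b * v x)) =
        (\<lambda>x. a *\<^sub>R (\<phi> n x - u x) + b *\<^sub>R (\<eta> n x - v x))" for n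
      by (simp add: algebra_simps)
    have "H1_norm \<Omega> (\<lambda>x. (a * \<phi> n x + b * \<eta> n x) - (a * u x + b * v x))
        \<le> \<bar>a\<bar> * H1_norm \<Omega> (\<lambda>x. \<phi> n x - u x) + \<bar>b\<bar> * H1_norm \<Omega> (\<lambda>x. \<eta> n x - v x)" for n
      unfolding eq using H1.nrm_triangle[OF H1.scale_mem[OF d(1)] H1.scale_mem[OF d(2)], of a n b n]
      by (simp only: H1.nrm_scale d)
    then show "\<forall>\<^sub>F n in sequentially. H1_norm \<Omega> (\<lambda>x. (a * \<phi> n x + b * \<eta> n x) - (a * u x + b * v x))
        \<le> \<bar>a\<bar> * H1_norm \<Omega> (\<lambda>x. \<phi> n x - u x) + \<bar>b\<bar> * H1_norm \<Omega> (\<lambda>x. \<eta> n x - v x)"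
      by simp
    show "\<forall>\<^sub>F n in sequentially. 0 \<le> H1_norm \<Omega> (\<lambda>x. (a * \<phi> n x + b * \<eta> n x) - (a * u x + b * v x))"
      by (simp add: H1_norm_def)
  qed simp
  moreover have "test_function \<Omega> (\<lambda>x. a * \<phi> n x + b * \<eta> n x)" for n
    using test_function_comb phi(1) eta(1) by blast
  ultimately show ?thesis
    unfolding H10_def using H1_comb[OF uv, of a b]
    by (auto intro!: exI[of _ "\<lambda>n x. a * \<phi> n x + b * \<eta> n x"])
qed

lemma test_function_H10: "test_function \<Omega> \<phi> \<Longrightarrow> \<phi> \<in> H10 \<Omega>"
  unfolding H10_def using test_function_H1[OF open_domain]
  by (auto intro!: exI[of _ "\<lambda>n. \<phi>"] simp: H1.nrm_zero)

lemma semi_inner_H10: "semi_inner_space (H10 \<Omega>) (dirichlet_form \<Omega>)"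
proof -
  interpret D: semi_inner_space "H1 \<Omega>" "dirichlet_form \<Omega>" by (rule semi_inner_dirichlet)
  have "test_function \<Omega> (\<lambda>x. 0)"
    unfolding test_function_def using C_k_const by blast
  then show ?thesis
    using H10_comb test_function_H10 D.ip_comb D.ip_sym D.ip_nonneg
    by unfold_locales (auto dest!: H10_subset_H1)
qed

sublocale H10: semi_inner_space "H10 \<Omega>" "dirichlet_form \<Omega>"
  by (rule semi_inner_H10)

sublocale D: semi_inner_space "H1 \<Omega>" "dirichlet_form \<Omega>"
  by (rule semi_inner_dirichlet)

lemma dirichlet_nrm_eq: "H10.nrm u = L2_norm \<Omega> (grad \<Omega> u)"
  by (simp add: H10.nrm_def L2_norm_def dirichlet_form_def)

lemma L2_norm_le_H1_norm: "L2_norm \<Omega> u \<le> H1_norm \<Omega> u"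
  by (simp add: H1_norm_def real_le_rsqrt)

lemma grad_norm_le_H1_norm: "L2_norm \<Omega> (grad \<Omega> u) \<le> H1_norm \<Omega> u"
  by (simp add: H1_norm_def real_le_rsqrt)

text \<open>
  The Poincare inequality. For a test function the identity
  \<open>\<integral> \<phi>\<^sup>2 = - 2 \<integral> (x \<bullet> b) \<phi> (\<nabla>\<phi> \<bullet> b)\<close> results from integrating the derivative of \<open>(x \<bullet> b) \<phi>\<^sup>2\<close> in
  the direction \<open>b\<close>; on a bounded set the factor \<open>x \<bullet> b\<close> is bounded.
\<close>

lemma Poincare_test_function:
  assumes phi: "test_function \<Omega> \<phi>" and R: "\<And>x. x \<in> \<Omega> \<Longrightarrow> norm x \<le> R" "0 \<le> R"
  shows "L2_norm \<Omega> \<phi> \<le> 2 * R * L2_norm \<Omega> (grad \<Omega> \<phi>)"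
proof -
  obtain g C where p: "\<And>x. GDERIV \<phi> x :> g x" "continuous_on UNIV g" "continuous_on UNIV \<phi>"
    "compact C" "C \<subseteq> \<Omega>" "\<And>x. x \<notin> C \<Longrightarrow> \<phi> x = 0" "\<And>x. x \<notin> C \<Longrightarrow> g x = 0"
    using test_functionD[OF phi] by metis
  obtain b :: 'a where b: "b \<in> Basis" using nonempty_Basis by blast
  have gL: "g \<in> L2 \<Omega>" by (rule test_function_gradient_L2[OF open_domain phi p(1)])
  have pL: "\<phi> \<in> L2 \<Omega>" by (rule test_function_L2[OF open_domain phi])
  have "AE x in lebesgue_on \<Omega>. grad \<Omega> \<phi> x = g x"
    by (rule grad_eq_AE[OF test_function_H1[OF open_domain phi]
          weak_gradient_test_function[OF open_domain phi p(1)] gL])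
  then have gn: "L2_norm \<Omega> (grad \<Omega> \<phi>) = L2_norm \<Omega> g"
    using gL grad_H1(1)[OF test_function_H1[OF open_domain phi]] by (rule_tac L2_norm_cong_AE)
  define u where "u x = ((x \<bullet> b) * \<phi> x) *\<^sub>R b" for x
  have ub: "norm (u x) \<le> R * norm (\<phi> x)" if "x \<in> \<Omega>" for x
    using b Basis_le_norm[OF b, of x] R(1)[OF that] by (simp add: u_def abs_mult mult_right_mono)
  have uL: "u \<in> L2 \<Omega>"
  proof -
    have "integrable lebesgue (\<lambda>x. (norm (u x))\<^sup>2)"
      by (rule integrable_compact_support[OF _ p(4)]) (use p in \<open>auto simp: u_def intro!: continuous_intros\<close>)
    moreover have "continuous_on UNIV u"
      unfolding u_def by (intro continuous_intros p(3))
    ultimately show ?thesis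
      using open_domain borel_measurable_continuous_UNIV by (auto simp: L2_def intro!: integrable_lebesgue_on)
  qed
  have uR: "L2_norm \<Omega> u \<le> R * L2_norm \<Omega> \<phi>"
    by (rule L2_norm_mono[OF uL pL ub R(2)])
  have i: "integrable lebesgue (\<lambda>x. \<phi> x * \<phi> x)" "integrable lebesgue (\<lambda>x. u x \<bullet> g x)"
    by (rule integrable_compact_support[OF _ p(4)];
        use p in \<open>auto simp: u_def intro!: continuous_intros\<close>)+
  have G: "GDERIV (\<lambda>x. (x \<bullet> b) * (\<phi> x * \<phi> x)) x :>
      (x \<bullet> b) *\<^sub>R (\<phi> x *\<^sub>R g x + \<phi> x *\<^sub>R g x) + (\<phi> x * \<phi> x) *\<^sub>R b" for x
    by (rule GDERIV_mult[OF GDERIV_component GDERIV_mult[OF p(1) p(1)]])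
  have "(\<integral>x. ((x \<bullet> b) *\<^sub>R (\<phi> x *\<^sub>R g x + \<phi> x *\<^sub>R g x) + (\<phi> x * \<phi> x) *\<^sub>R b) \<bullet> b \<partial>lebesgue) = 0"
    by (rule integral_gradient_compact_support[OF G _ p(4)])
      (use p in \<open>auto intro!: continuous_intros\<close>)
  moreover have "(\<lambda>x. ((x \<bullet> b) *\<^sub>R (\<phi> x *\<^sub>R g x + \<phi> x *\<^sub>R g x) + (\<phi> x * \<phi> x) *\<^sub>R b) \<bullet> b)
      = (\<lambda>x. 2 * (u x \<bullet> g x) + \<phi> x * \<phi> x)"
    using b by (simp add: u_def inner_add_left inner_commute algebra_simps)
  ultimately have "(\<integral>x. \<phi> x * \<phi> x \<partial>lebesgue) = - 2 * (\<integral>x. u x \<bullet> g x \<partial>lebesgue)"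
    using i by simp
  moreover have zero: "\<phi> x = 0" if "x \<notin> \<Omega>" for x
    using p(5,6) that by blast
  have "(\<integral>x. \<phi> x * \<phi> x \<partial>lebesgue_on \<Omega>) = (\<integral>x. \<phi> x * \<phi> x \<partial>lebesgue)"
    "(\<integral>x. u x \<bullet> g x \<partial>lebesgue_on \<Omega>) = (\<integral>x. u x \<bullet> g x \<partial>lebesgue)"
    by (rule integral_lebesgue_on_superset_support; use zero open_domain in \<open>simp add: u_def\<close>)+
  ultimately have "(L2_norm \<Omega> \<phi>)\<^sup>2 = - 2 * L2_inner \<Omega> u g"
    by (simp add: L2_norm_square L2_inner_def)
  also have "\<dots> \<le> 2 * (L2_norm \<Omega> u * L2_norm \<Omega> g)"
    using L2.Cauchy_Schwarz[OF uL gL] by linarith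
  also have "\<dots> \<le> 2 * (R * L2_norm \<Omega> \<phi> * L2_norm \<Omega> g)"
    using uR L2.nrm_nonneg[OF gL] by (simp add: mult_right_mono)
  finally have "L2_norm \<Omega> \<phi> * L2_norm \<Omega> \<phi> \<le> (2 * R * L2_norm \<Omega> g) * L2_norm \<Omega> \<phi>"
    by (simp add: power2_eq_square algebra_simps)
  then show ?thesis
    using L2.nrm_nonneg[OF pL] L2.nrm_nonneg[OF gL] R(2) gn
    by (cases "L2_norm \<Omega> \<phi> = 0") auto
qed

text \<open>
  Both sides of the inequality for test functions are continuous in the \<open>H\<^sup>1\<close> norm, in which test
  functions are dense in \<open>H\<^sup>1\<^sub>0\<close> by definition.
\<close>

lemma Poincare:
  obtains C where "0 < C" "\<And>u. u \<in> H10 \<Omega> \<Longrightarrow> L2_norm \<Omega> u \<le> C * H10.nrm u"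
proof -
  obtain R where R: "0 < R" "\<And>x. x \<in> \<Omega> \<Longrightarrow> norm x \<le> R"
    using bounded_domain by (meson bounded_pos)
  have "L2_norm \<Omega> u \<le> 2 * R * H10.nrm u" if u: "u \<in> H10 \<Omega>" for u
  proof -
    obtain \<phi> where phi: "\<And>n::nat. test_function \<Omega> (\<phi> n)" "(\<lambda>n. H1_norm \<Omega> (\<lambda>x. \<phi> n x - u x)) \<longlonglongrightarrow> 0"
      using u unfolding H10_def by auto
    let ?d = "\<lambda>n. H1_norm \<Omega> (\<lambda>x. \<phi> n x - u x)"
    have u1: "u \<in> H1 \<Omega>" using u by (rule H10_subset_H1)
    \<comment> \<open>\<open>u\<close> is replaced by \<open>\<phi> n\<close> on the left and \<open>\<phi> n\<close> by \<open>u\<close> on the right.\<close>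
    have "L2_norm \<Omega> u \<le> 2 * R * H10.nrm u + (1 + 2 * R) * ?d n" for n
    proof -
      have p1: "\<phi> n \<in> H1 \<Omega>" by (rule test_function_H1[OF open_domain phi(1)])
      have "L2_norm \<Omega> u \<le> L2_norm \<Omega> (\<phi> n) + L2_norm \<Omega> (\<lambda>x. \<phi> n x - u x)"
        using L2.nrm_reverse_triangle[OF H1_subset_L2[OF p1] H1_subset_L2[OF u1]] by simp
      also have "L2_norm \<Omega> (\<phi> n) \<le> 2 * R * H10.nrm (\<phi> n)"
        using Poincare_test_function[OF phi(1) R(2)] R(1) by (simp add: dirichlet_nrm_eq)
      also have "H10.nrm (\<phi> n) \<le> H10.nrm u + H10.nrm (\<lambda>x. \<phi> n x - u x)"
        using H10.nrm_reverse_triangle[OF test_function_H10[OF phi(1)] u, of n] by simp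
      finally show ?thesis
        using R(1) L2_norm_le_H1_norm[of "\<lambda>x. \<phi> n x - u x"] grad_norm_le_H1_norm[of "\<lambda>x. \<phi> n x - u x"]
        by (simp add: dirichlet_nrm_eq algebra_simps) (smt (verit) mult_left_mono)
    qed
    moreover have "(\<lambda>n. 2 * R * H10.nrm u + (1 + 2 * R) * ?d n) \<longlonglongrightarrow> 2 * R * H10.nrm u + (1 + 2 * R) * 0"
      by (intro tendsto_intros phi(2))
    ultimately show ?thesis
      by (intro LIMSEQ_le_const[of _ "2 * R * H10.nrm u"]) auto
  qed
  then show ?thesis
    using that[of "2 * R"] R(1) by simp
qed

end

section \<open>Functionals along Bochner measurable maps\<close>

text \<open>
  Convergence almost everywhere suffices because Lebesgue measure is complete.
\<close>

lemma borel_measurable_AE_limit: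
  fixes g :: "'a::euclidean_space \<Rightarrow> real"
  assumes I: "I \<in> sets lebesgue" and f: "\<And>n::nat. f n \<in> borel_measurable (lebesgue_on I)"
    and lim: "AE t in lebesgue_on I. (\<lambda>n. f n t) \<longlonglongrightarrow> g t"
  shows "g \<in> borel_measurable (lebesgue_on I)"
proof -
  define F where "F n t = (if t \<in> I then f n t else 0)" for n t
  have "F n \<in> borel_measurable lebesgue" for n
    unfolding F_def using borel_measurable_if_I[OF f I] .
  then have "(\<lambda>t. lim (\<lambda>n. F n t)) \<in> borel_measurable lebesgue"
    by (rule borel_measurable_lim_metric)
  moreover have "AE t in lebesgue. lim (\<lambda>n. F n t) = (if t \<in> I then g t else 0)"
  proof -
    have "AE t in lebesgue. t \<in> I \<longrightarrow> (\<lambda>n. f n t) \<longlonglongrightarrow> g t"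
      using lim I by (simp add: AE_restrict_space_iff)
    then show ?thesis
      by eventually_elim (auto simp: F_def limI)
  qed
  ultimately have "(\<lambda>t. if t \<in> I then g t else 0) \<in> borel_measurable lebesgue"
    by (rule borel_measurable_AE)
  then show ?thesis by (rule borel_measurable_if_D)
qed

lemma integrable_AE_eq:
  fixes g :: "'a::euclidean_space \<Rightarrow> real"
  assumes "I \<in> sets lebesgue" "integrable (lebesgue_on I) f" "AE t in lebesgue_on I. f t = g t"
  shows "integrable (lebesgue_on I) g" and "(\<integral>t. g t \<partial>lebesgue_on I) = (\<integral>t. f t \<partial>lebesgue_on I)"
proof -
  have m: "g \<in> borel_measurable (lebesgue_on I)"
  proof (rule borel_measurable_AE_limit[OF assms(1) borel_measurable_integrable[OF assms(2)]])
    show "AE t in lebesgue_on I. (\<lambda>n. f t) \<longlonglongrightarrow> g t"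
      using assms(3) by eventually_elim simp
  qed
  show "integrable (lebesgue_on I) g"
    by (rule integrable_cong_AE_imp[OF assms(2) m]) (use assms(3) in auto)
  show "(\<integral>t. g t \<partial>lebesgue_on I) = (\<integral>t. f t \<partial>lebesgue_on I)"
    by (rule integral_cong_AE[symmetric]) (use assms m in auto)
qed

lemma strongly_measurableE:
  assumes "strongly_measurable I X N u"
  obtains s where "\<And>n::nat. finite (s n ` I)" "\<And>n. s n ` I \<subseteq> X"
    "\<And>n y. {t \<in> I. s n t = y} \<in> sets lebesgue"
    "AE t in lebesgue_on I. (\<lambda>n. N (\<lambda>x. s n t x - u t x)) \<longlonglongrightarrow> 0"
  using assms unfolding strongly_measurable_def by blast

text \<open>
  A functional composed with a simple map is a simple function, and the Lipschitz condition carries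
  measurability over to the limit. Besides linear functionals this covers norms.
\<close>

lemma bochner_functional_measurable:
  assumes I: "I \<in> sets lebesgue" and u: "strongly_measurable I X N u" "AE t in lebesgue_on I. u t \<in> X"
    and lip: "\<And>s u. \<lbrakk>s \<in> X; u \<in> X\<rbrakk> \<Longrightarrow> \<bar>\<Lambda> s - \<Lambda> u\<bar> \<le> C * N (\<lambda>x. s x - u x)"
  shows "(\<lambda>t. \<Lambda> (u t)) \<in> borel_measurable (lebesgue_on I)"
proof -
  obtain s where s: "\<And>n::nat. finite (s n ` I)" "\<And>n. s n ` I \<subseteq> X"
    "\<And>n y. {t \<in> I. s n t = y} \<in> sets lebesgue"
    and conv: "AE t in lebesgue_on I. (\<lambda>n. N (\<lambda>x. s n t x - u t x)) \<longlonglongrightarrow> 0"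
    by (rule strongly_measurableE[OF u(1)]) blast
  show ?thesis
  proof (rule borel_measurable_AE_limit[OF I])
    fix n
    have "(\<lambda>t. \<Sum>y\<in>s n ` I. \<Lambda> y * indicat_real {t \<in> I. s n t = y} t) \<in> borel_measurable (lebesgue_on I)"
      using s(3) I by (intro borel_measurable_sum borel_measurable_times borel_measurable_const
          borel_measurable_indicator) (auto simp: sets_restrict_space_iff)
    moreover have "(\<Sum>y\<in>s n ` I. \<Lambda> y * indicat_real {t \<in> I. s n t = y} t) = \<Lambda> (s n t)" if "t \<in> I" for t
    proof -
      have "(\<Sum>y\<in>s n ` I. \<Lambda> y * indicat_real {t \<in> I. s n t = y} t) = (\<Sum>y\<in>s n ` I. if y = s n t then \<Lambda> y else 0)"
        using that by (intro sum.cong) (auto simp: indicator_def)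
      then show ?thesis using that s(1) by simp
    qed
    ultimately show "(\<lambda>t. \<Lambda> (s n t)) \<in> borel_measurable (lebesgue_on I)"
      by (rule measurable_lebesgue_cong[THEN iffD1, rotated])
  next
    have "AE t in lebesgue_on I. t \<in> I" by (rule AE_I2) simp
    with conv u(2) show "AE t in lebesgue_on I. (\<lambda>n. \<Lambda> (s n t)) \<longlonglongrightarrow> \<Lambda> (u t)"
    proof eventually_elim
      case (elim t)
      have "(\<lambda>n. C * N (\<lambda>x. s n t x - u t x)) \<longlonglongrightarrow> C * 0"
        by (intro tendsto_intros elim)
      then have lim: "(\<lambda>n. C * N (\<lambda>x. s n t x - u t x)) \<longlonglongrightarrow> 0" by simp
      have "(\<lambda>n. \<Lambda> (s n t) - \<Lambda> (u t)) \<longlonglongrightarrow> 0"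
      proof (rule Lim_null_comparison[OF _ lim], rule always_eventually[OF allI])
        fix n
        have "s n t \<in> X" using s(2) elim by blast
        then show "norm (\<Lambda> (s n t) - \<Lambda> (u t)) \<le> C * N (\<lambda>x. s n t x - u t x)"
          using lip[of "s n t" "u t"] elim by simp
      qed
      then show ?case by (simp add: LIM_zero_iff)
    qed
  qed
qed

lemma bochner_functional_integrable:
  assumes u: "u \<in> bochner p I X N" and I: "I \<in> lmeasurable" and p: "p > 0"
    and lip: "\<And>s u. \<lbrakk>s \<in> X; u \<in> X\<rbrakk> \<Longrightarrow> \<bar>\<Lambda> s - \<Lambda> u\<bar> \<le> C * N (\<lambda>x. s x - u x)"
    and bound: "\<And>u. u \<in> X \<Longrightarrow> \<bar>\<Lambda> u\<bar> \<le> C * N u" and N: "\<And>u. u \<in> X \<Longrightarrow> 0 \<le> N u" and C: "0 \<le> C"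
  shows "integrable (lebesgue_on I) (\<lambda>t. \<Lambda> (u t))"
proof (rule Bochner_Integration.integrable_bound)
  interpret finite_measure "lebesgue_on I" by (rule finite_measure_lebesgue_on[OF I])
  show "integrable (lebesgue_on I) (\<lambda>t. C * (1 + N (u t) ^ p))"
    using u by (simp add: bochner_def)
  show "(\<lambda>t. \<Lambda> (u t)) \<in> borel_measurable (lebesgue_on I)"
    by (rule bochner_functional_measurable[where u = u and X = X and N = N and \<Lambda> = \<Lambda> and C = C])
      (use u I lip in \<open>auto simp: bochner_def fmeasurableD\<close>)
  have "AE t in lebesgue_on I. u t \<in> X" using u by (simp add: bochner_def)
  then show "AE t in lebesgue_on I. norm (\<Lambda> (u t)) \<le> norm (C * (1 + N (u t) ^ p))"
  proof eventually_elim
    case (elim t)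
    \<comment> \<open>A time interval of finite measure makes \<open>L\<^sup>p\<close> functions integrable.\<close>
    have "N (u t) \<le> 1 + N (u t) ^ p"
    proof (cases "N (u t) \<le> 1")
      case True
      then show ?thesis using N[OF elim] by (simp add: add_increasing2)
    next
      case False
      then show ?thesis using self_le_power[of "N (u t)" p] p by linarith
    qed
    then have "\<bar>\<Lambda> (u t)\<bar> \<le> C * (1 + N (u t) ^ p)"
      using bound[OF elim] mult_left_mono[OF _ C] by (meson order_trans)
    then show ?case by simp
  qed
qed

text \<open>
  A level set of the difference of two simple maps is a finite union of intersections of their level
  sets.
\<close>

lemma strongly_measurable_diff:
  assumes u: "strongly_measurable I X N u" "AE t in lebesgue_on I. u t \<in> X"
    and v: "strongly_measurable I X N v" "AE t in lebesgue_on I. v t \<in> X"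
    and X: "\<And>a b. \<lbrakk>a \<in> X; b \<in> X\<rbrakk> \<Longrightarrow> (\<lambda>x. a x - b x) \<in> X"
    and N: "\<And>a b. \<lbrakk>a \<in> X; b \<in> X\<rbrakk> \<Longrightarrow> N (\<lambda>x. a x - b x) \<le> N a + N b" "\<And>a. a \<in> X \<Longrightarrow> 0 \<le> N a"
  shows "strongly_measurable I X N (\<lambda>t x. u t x - v t x)"
proof -
  obtain s where s: "\<And>n::nat. finite (s n ` I)" "\<And>n. s n ` I \<subseteq> X"
    "\<And>n y. {t \<in> I. s n t = y} \<in> sets lebesgue"
    and convs: "AE t in lebesgue_on I. (\<lambda>n. N (\<lambda>x. s n t x - u t x)) \<longlonglongrightarrow> 0"
    by (rule strongly_measurableE[OF u(1)]) blast
  obtain r where r: "\<And>n::nat. finite (r n ` I)" "\<And>n. r n ` I \<subseteq> X"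
    "\<And>n y. {t \<in> I. r n t = y} \<in> sets lebesgue"
    and convr: "AE t in lebesgue_on I. (\<lambda>n. N (\<lambda>x. r n t x - v t x)) \<longlonglongrightarrow> 0"
    by (rule strongly_measurableE[OF v(1)]) blast
  show ?thesis
    unfolding strongly_measurable_def
  proof (intro exI[of _ "\<lambda>n t x. s n t x - r n t x"] conjI allI)
    fix n
    have sub: "(\<lambda>t x. s n t x - r n t x) ` I \<subseteq> (\<lambda>(a, b) x. a x - b x) ` (s n ` I \<times> r n ` I)"
      by force
    show "finite ((\<lambda>t x. s n t x - r n t x) ` I)"
      by (rule finite_subset[OF sub]) (use s(1) r(1) in auto)
    show "(\<lambda>t x. s n t x - r n t x) ` I \<subseteq> X"
      using s(2)[of n] r(2)[of n] X by blast
    fix y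
    have "{t \<in> I. (\<lambda>x. s n t x - r n t x) = y} =
      (\<Union>(a, b)\<in>{(a, b) \<in> s n ` I \<times> r n ` I. (\<lambda>x. a x - b x) = y}. {t \<in> I. s n t = a} \<inter> {t \<in> I. r n t = b})"
      by auto
    moreover have "finite {(a, b) \<in> s n ` I \<times> r n ` I. (\<lambda>x. a x - b x) = y}"
      by (rule finite_subset[of _ "s n ` I \<times> r n ` I"]) (use s(1) r(1) in auto)
    ultimately show "{t \<in> I. (\<lambda>x. s n t x - r n t x) = y} \<in> sets lebesgue"
      using s(3) r(3) by (auto intro!: sets.finite_UN sets.Int)
  next
    have "AE t in lebesgue_on I. t \<in> I" by (rule AE_I2) simp
    with convs convr u(2) v(2)
    show "AE t in lebesgue_on I. (\<lambda>n. N (\<lambda>x. s n t x - r n t x - (u t x - v t x))) \<longlonglongrightarrow> 0"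
    proof eventually_elim
      case (elim t)
      have mem: "(\<lambda>x. s n t x - u t x) \<in> X" "(\<lambda>x. r n t x - v t x) \<in> X" for n
        using elim s(2)[of n] r(2)[of n] X by blast+
      have eq: "(\<lambda>x. s n t x - r n t x - (u t x - v t x)) = (\<lambda>x. (s n t x - u t x) - (r n t x - v t x))" for n
        by (simp add: algebra_simps)
      have "(\<lambda>n. N (\<lambda>x. s n t x - u t x) + N (\<lambda>x. r n t x - v t x)) \<longlonglongrightarrow> 0 + 0"
        by (intro tendsto_intros elim)
      then have lim: "(\<lambda>n. N (\<lambda>x. s n t x - u t x) + N (\<lambda>x. r n t x - v t x)) \<longlonglongrightarrow> 0"
        by simp
      show ?case
        unfolding eq
      proof (rule tendsto_sandwich[OF _ _ tendsto_const lim])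
        show "\<forall>\<^sub>F n in sequentially. 0 \<le> N (\<lambda>x. (s n t x - u t x) - (r n t x - v t x))"
          using N(2)[OF X[OF mem]] by (rule always_eventually[OF allI])
        show "\<forall>\<^sub>F n in sequentially. N (\<lambda>x. (s n t x - u t x) - (r n t x - v t x))
            \<le> N (\<lambda>x. s n t x - u t x) + N (\<lambda>x. r n t x - v t x)"
          using N(1)[OF mem] by (rule always_eventually[OF allI])
      qed
    qed
  qed
qed

context bounded_open_set
begin

section \<open>The dual space\<close>

lemma dual_bdd_above:
  assumes "l \<in> H10_dual \<Omega>"
  shows "bdd_above ((\<lambda>v. \<bar>l v\<bar>) ` {v \<in> H10 \<Omega>. H1_norm \<Omega> v \<le> 1})"
proof -
  obtain C where C: "\<And>v. v \<in> H10 \<Omega> \<Longrightarrow> \<bar>l v\<bar> \<le> C * H1_norm \<Omega> v"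
    using assms unfolding H10_dual_def by blast
  have "\<bar>l v\<bar> \<le> \<bar>C\<bar>" if "v \<in> H10 \<Omega>" "H1_norm \<Omega> v \<le> 1" for v
  proof -
    have n: "0 \<le> H1_norm \<Omega> v" by (simp add: H1_norm_def)
    have "C * H1_norm \<Omega> v \<le> \<bar>C\<bar> * H1_norm \<Omega> v" using n by (simp add: mult_right_mono)
    also have "\<dots> \<le> \<bar>C\<bar>" using that(2) by (simp add: mult_left_le)
    finally show ?thesis using C[OF that(1)] by linarith
  qed
  then show ?thesis by (auto simp: bdd_above_def)
qed

lemma dual_norm_bound:
  assumes l: "l \<in> H10_dual \<Omega>" and v: "v \<in> H10 \<Omega>"
  shows "\<bar>l v\<bar> \<le> H10_dual_norm \<Omega> l * H1_norm \<Omega> v"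
proof (cases "H1_norm \<Omega> v = 0")
  case True
  then show ?thesis
    using l v unfolding H10_dual_def by fastforce
next
  case False
  then have pos: "0 < H1_norm \<Omega> v"
    using H1.nrm_nonneg[OF H10_subset_H1[OF v]] by linarith
  define a where "a = 1 / H1_norm \<Omega> v"
  have a: "a > 0" "a * H1_norm \<Omega> v = 1" using pos by (auto simp: a_def)
  have v1: "v \<in> H1 \<Omega>" using v by (rule H10_subset_H1)
  have m: "(\<lambda>x. a * v x) \<in> H10 \<Omega>" using H10.scale_mem[OF v, of a] by simp
  have "H1_norm \<Omega> (\<lambda>x. a * v x) = 1" using H1.nrm_scale[OF v1, of a] a by simp
  then have "\<bar>l (\<lambda>x. a * v x)\<bar> \<le> H10_dual_norm \<Omega> l"
    unfolding H10_dual_norm_def using m by (intro cSUP_upper[OF _ dual_bdd_above[OF l]]) simp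
  moreover have lin: "l (\<lambda>x. a * u x + b * w x) = a * l u + b * l w" if "u \<in> H10 \<Omega>" "w \<in> H10 \<Omega>" for u w a b
    using l that unfolding H10_dual_def by blast
  have "l (\<lambda>x. a * v x) = a * l v"
    using lin[OF v v, of a 0] by simp
  ultimately have "a * \<bar>l v\<bar> \<le> H10_dual_norm \<Omega> l" using a by (simp add: abs_mult)
  then show ?thesis using pos by (simp add: a_def field_simps)
qed

lemma dual_norm_nonneg:
  assumes "l \<in> H10_dual \<Omega>"
  shows "0 \<le> H10_dual_norm \<Omega> l"
proof -
  have "\<bar>l (\<lambda>x. 0)\<bar> \<le> H10_dual_norm \<Omega> l"
    unfolding H10_dual_norm_def
    by (intro cSUP_upper[OF _ dual_bdd_above[OF assms]]) (simp add: H10.zero_mem H1.nrm_zero)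
  then show ?thesis by simp
qed

lemma dual_diff:
  assumes l: "l \<in> H10_dual \<Omega>" "m \<in> H10_dual \<Omega>"
  shows "(\<lambda>v. l v - m v) \<in> H10_dual \<Omega>"
    and "H10_dual_norm \<Omega> (\<lambda>v. l v - m v) \<le> H10_dual_norm \<Omega> l + H10_dual_norm \<Omega> m"
proof -
  have b: "\<bar>l v - m v\<bar> \<le> (H10_dual_norm \<Omega> l + H10_dual_norm \<Omega> m) * H1_norm \<Omega> v" if "v \<in> H10 \<Omega>" for v
    using dual_norm_bound[OF l(1) that] dual_norm_bound[OF l(2) that] by (simp add: distrib_right)
  show "(\<lambda>v. l v - m v) \<in> H10_dual \<Omega>"
    unfolding H10_dual_def
  proof (intro CollectI conjI ballI allI exI)
    fix u v a c assume "u \<in> H10 \<Omega>" "v \<in> H10 \<Omega>"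
    then have "l (\<lambda>x. a * u x + c * v x) = a * l u + c * l v" "m (\<lambda>x. a * u x + c * v x) = a * m u + c * m v"
      using l unfolding H10_dual_def by blast+
    then show "l (\<lambda>x. a * u x + c * v x) - m (\<lambda>x. a * u x + c * v x) = a * (l u - m u) + c * (l v - m v)"
      by (simp add: algebra_simps)
  qed (rule b)
  have "\<bar>l v - m v\<bar> \<le> H10_dual_norm \<Omega> l + H10_dual_norm \<Omega> m" if "v \<in> H10 \<Omega>" "H1_norm \<Omega> v \<le> 1" for v
  proof -
    have "(H10_dual_norm \<Omega> l + H10_dual_norm \<Omega> m) * H1_norm \<Omega> v \<le> (H10_dual_norm \<Omega> l + H10_dual_norm \<Omega> m) * 1"
      using that(2) dual_norm_nonneg[OF l(1)] dual_norm_nonneg[OF l(2)] by (intro mult_left_mono) auto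
    then show ?thesis using b[OF that(1)] by simp
  qed
  moreover have "{v \<in> H10 \<Omega>. H1_norm \<Omega> v \<le> 1} \<noteq> {}"
    using H10.zero_mem H1.nrm_zero by force
  ultimately show "H10_dual_norm \<Omega> (\<lambda>v. l v - m v) \<le> H10_dual_norm \<Omega> l + H10_dual_norm \<Omega> m"
    unfolding H10_dual_norm_def[of \<Omega> "\<lambda>v. l v - m v"] by (intro cSUP_least) auto
qed

text \<open>
  Strong measurability lets the exceptional null set be chosen independently of the test function:
  the countably many values of the approximating simple maps have countably many almost norming
  elements, and testing with those alone already bounds the norm of the limit.
\<close>

lemma dual_AE_zero:
  assumes l: "strongly_measurable I (H10_dual \<Omega>) (H10_dual_norm \<Omega>) l" "AE t in lebesgue_on I. l t \<in> H10_dual \<Omega>"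
    and zero: "\<And>v. v \<in> H10 \<Omega> \<Longrightarrow> AE t in lebesgue_on I. l t v = 0"
  shows "AE t in lebesgue_on I. \<forall>v\<in>H10 \<Omega>. l t v = 0"
proof -
  let ?N = "H10_dual_norm \<Omega>"
  obtain s where s: "\<And>n::nat. finite (s n ` I)" "\<And>n. s n ` I \<subseteq> H10_dual \<Omega>"
    "\<And>n y. {t \<in> I. s n t = y} \<in> sets lebesgue"
    and conv: "AE t in lebesgue_on I. (\<lambda>n. ?N (\<lambda>v. s n t v - l t v)) \<longlonglongrightarrow> 0"
    by (rule strongly_measurableE[OF l(1)]) blast
  define Y where "Y = (\<Union>n. s n ` I)"
  have Y: "countable Y" "Y \<subseteq> H10_dual \<Omega>"
    unfolding Y_def by (intro countable_UN countableI_type countable_finite s(1)) (use s(2) in blast)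
  have "\<exists>v\<in>H10 \<Omega>. H1_norm \<Omega> v \<le> 1 \<and> ?N y - 1 / (real m + 1) < \<bar>y v\<bar>" if "y \<in> Y" for y m
  proof -
    have "?N y - 1 / (real m + 1) < ?N y" by simp
    moreover have "{v \<in> H10 \<Omega>. H1_norm \<Omega> v \<le> 1} \<noteq> {}"
      using H10.zero_mem H1.nrm_zero by force
    ultimately show ?thesis
      using less_cSUP_iff[OF _ dual_bdd_above[of y]] that Y(2) unfolding H10_dual_norm_def by blast
  qed
  then obtain V where V: "\<And>y m. y \<in> Y \<Longrightarrow> V y m \<in> H10 \<Omega>" "\<And>y m. y \<in> Y \<Longrightarrow> H1_norm \<Omega> (V y m) \<le> 1"
    "\<And>y m. y \<in> Y \<Longrightarrow> ?N y - 1 / (real m + 1) < \<bar>y (V y m)\<bar>"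
    by metis
  have "AE t in lebesgue_on I. \<forall>y\<in>Y. \<forall>m. l t (V y m) = 0"
    using zero V(1) by (simp add: AE_ball_countable[OF Y(1)] AE_all_countable)
  moreover have "AE t in lebesgue_on I. t \<in> I" by (rule AE_I2) simp
  ultimately show ?thesis
    using conv l(2)
  proof eventually_elim
    case (elim t)
    show ?case
    proof
      fix v assume v: "v \<in> H10 \<Omega>"
      have est: "\<bar>l t v\<bar> \<le> 2 * H1_norm \<Omega> v * ?N (\<lambda>v. s n t v - l t v)" for n
      proof -
        let ?y = "s n t"
        let ?\<delta> = "?N (\<lambda>v. s n t v - l t v)"
        have y: "?y \<in> Y" using elim by (auto simp: Y_def)
        with Y(2) have y: "?y \<in> Y" "?y \<in> H10_dual \<Omega>" by auto
        have d: "(\<lambda>v. s n t v - l t v) \<in> H10_dual \<Omega>"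
          using dual_diff(1)[OF y(2)] elim by blast
        \<comment> \<open>\<open>l t\<close> vanishes at the almost norming element of \<open>s n t\<close>,
          so \<open>s n t\<close> is as small as its distance to \<open>l t\<close>.\<close>
        have "?N ?y \<le> ?\<delta> + 1 / (real m + 1)" for m
        proof -
          have "?N ?y - 1 / (real m + 1) \<le> \<bar>?y (V ?y m) - l t (V ?y m)\<bar>"
            using V(3)[OF y(1), of m] elim y(1) by simp
          also have "\<dots> \<le> ?\<delta> * H1_norm \<Omega> (V ?y m)"
            by (rule dual_norm_bound[OF d V(1)[OF y(1)]])
          also have "\<dots> \<le> ?\<delta>"
            using V(2)[OF y(1)] dual_norm_nonneg[OF d] by (simp add: mult_left_le)
          finally show ?thesis by simp
        qed
        moreover have "(\<lambda>m. ?\<delta> + 1 / (real m + 1)) \<longlonglongrightarrow> ?\<delta> + 0"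
          using LIMSEQ_inverse_real_of_nat by (intro tendsto_intros) (simp add: inverse_eq_divide add.commute)
        ultimately have Ny: "?N ?y \<le> ?\<delta>"
          by (intro LIMSEQ_le_const[of _ ?\<delta>]) auto
        have "\<bar>l t v\<bar> \<le> \<bar>?y v\<bar> + \<bar>?y v - l t v\<bar>" by simp
        also have "\<dots> \<le> ?N ?y * H1_norm \<Omega> v + ?\<delta> * H1_norm \<Omega> v"
          using dual_norm_bound[OF y(2) v] dual_norm_bound[OF d v] by simp
        also have "\<dots> \<le> ?\<delta> * H1_norm \<Omega> v + ?\<delta> * H1_norm \<Omega> v"
          using Ny by (simp add: mult_right_mono H1_norm_def)
        finally show ?thesis by (simp add: algebra_simps)
      qed
      have "(\<lambda>n. 2 * H1_norm \<Omega> v * ?N (\<lambda>v. s n t v - l t v)) \<longlonglongrightarrow> 2 * H1_norm \<Omega> v * 0"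
        by (intro tendsto_intros elim)
      then have "\<bar>l t v\<bar> \<le> 0"
        using est by (intro LIMSEQ_le_const[of _ 0]) auto
      then show "l t v = 0" by simp
    qed
  qed
qed

end

section \<open>Time derivatives\<close>

lemma deriv_eq_frechet:
  assumes "test_function S (\<psi> :: real \<Rightarrow> real)"
  shows "deriv \<psi> t = frechet_derivative \<psi> (at t) 1"
  using assms test_functionD[OF assms] 
  by (metis DERIV_imp_deriv GDERIV_frechet_derivative gderiv_deriv inner_real_def mult.right_neutral)

lemma bounded_open_interval: "bounded_open_set {0<..<T::real}"
  by unfold_locales auto

lemma integrable_mult_time_test:
  fixes g :: "real \<Rightarrow> real"
  assumes "integrable (lebesgue_on {0<..<T}) g" "test_function {0<..<T} \<psi>"
  shows "integrable (lebesgue_on {0<..<T}) (\<lambda>t. g t * \<psi> t)"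
    and "integrable (lebesgue_on {0<..<T}) (\<lambda>t. g t * deriv \<psi> t)"
  using bounded_open_set.integrable_mult_test[OF bounded_open_interval assms]
  by (simp_all add: deriv_eq_frechet[OF assms(2)])

context bounded_open_set
begin

lemma bochner_L2_inner_integrable:
  assumes "u \<in> bochner p {0<..<T} (L2 \<Omega>) (L2_norm \<Omega>)" "p > 0" "g \<in> L2 \<Omega>"
  shows "integrable (lebesgue_on {0<..<T}) (\<lambda>t. L2_inner \<Omega> (u t) g)"
proof (rule bochner_functional_integrable[OF assms(1) _ assms(2), where C = "L2_norm \<Omega> g"])
  show "\<bar>L2_inner \<Omega> s g - L2_inner \<Omega> v g\<bar> \<le> L2_norm \<Omega> g * L2_norm \<Omega> (\<lambda>x. s x - v x)"
    if "s \<in> L2 \<Omega>" "v \<in> L2 \<Omega>" for s v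
    using L2.Cauchy_Schwarz[OF L2.diff_mem[OF that] assms(3)] L2.ip_diff[OF that assms(3)]
    by (simp add: mult.commute)
  show "\<bar>L2_inner \<Omega> v g\<bar> \<le> L2_norm \<Omega> g * L2_norm \<Omega> v" if "v \<in> L2 \<Omega>" for v
    using L2.Cauchy_Schwarz[OF that assms(3)] by (simp add: mult.commute)
qed (use assms(3) L2.nrm_nonneg in auto)

lemma bochner_L2_norm_integrable:
  assumes "u \<in> bochner p {0<..<T} (L2 \<Omega>) (L2_norm \<Omega>)" "p > 0"
  shows "integrable (lebesgue_on {0<..<T}) (\<lambda>t. L2_norm \<Omega> (u t))"
  by (rule bochner_functional_integrable[OF assms(1) _ assms(2), where C = 1])
    (use L2.nrm_reverse_triangle L2.nrm_nonneg in auto)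

lemma bochner_H1_inner_integrable:
  assumes "u \<in> bochner p {0<..<T} X (H1_norm \<Omega>)" "p > 0" "X \<subseteq> H1 \<Omega>" "g \<in> L2 \<Omega>"
  shows "integrable (lebesgue_on {0<..<T}) (\<lambda>t. L2_inner \<Omega> (u t) g)"
proof (rule bochner_functional_integrable[OF assms(1) _ assms(2), where C = "L2_norm \<Omega> g"])
  have b: "\<bar>L2_inner \<Omega> v g\<bar> \<le> L2_norm \<Omega> g * H1_norm \<Omega> v" if "v \<in> H1 \<Omega>" for v
    using L2.Cauchy_Schwarz[OF H1_subset_L2[OF that] assms(4)]
      mult_left_mono[OF L2_norm_le_H1_norm[of v] L2.nrm_nonneg[OF assms(4)]]
    by (simp add: mult.commute)
  show "\<bar>L2_inner \<Omega> v g\<bar> \<le> L2_norm \<Omega> g * H1_norm \<Omega> v" if "v \<in> X" for v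
    using b that assms(3) by blast
  show "\<bar>L2_inner \<Omega> s g - L2_inner \<Omega> v g\<bar> \<le> L2_norm \<Omega> g * H1_norm \<Omega> (\<lambda>x. s x - v x)"
    if "s \<in> X" "v \<in> X" for s v
  proof -
    have m: "s \<in> H1 \<Omega>" "v \<in> H1 \<Omega>" using that assms(3) by auto
    show ?thesis
      using b[OF H1.diff_mem[OF m]] L2.ip_diff[OF m[THEN H1_subset_L2] assms(4)] by simp
  qed
qed (use L2.nrm_nonneg[OF assms(4)] in \<open>auto simp: H1_norm_def\<close>)

lemma bochner_H1_L2_norm_integrable:
  assumes "u \<in> bochner p {0<..<T} X (H1_norm \<Omega>)" "p > 0" "X \<subseteq> H1 \<Omega>"
  shows "integrable (lebesgue_on {0<..<T}) (\<lambda>t. L2_norm \<Omega> (u t))"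
proof (rule bochner_functional_integrable[OF assms(1) _ assms(2), where C = 1])
  show "\<bar>L2_norm \<Omega> s - L2_norm \<Omega> v\<bar> \<le> 1 * H1_norm \<Omega> (\<lambda>x. s x - v x)" if "s \<in> X" "v \<in> X" for s v
  proof -
    have m: "s \<in> L2 \<Omega>" "v \<in> L2 \<Omega>" using that assms(3) H1_subset_L2 by auto
    show ?thesis
      using L2.nrm_reverse_triangle[OF m] L2_norm_le_H1_norm[of "\<lambda>x. s x - v x"] by simp
  qed
  show "\<bar>L2_norm \<Omega> v\<bar> \<le> 1 * H1_norm \<Omega> v" if "v \<in> X" for v
    using L2.nrm_nonneg[of v \<Omega>] L2_norm_le_H1_norm[of v] that assms(3) H1_subset_L2[of v \<Omega>] by auto
qed (auto simp: H1_norm_def)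

lemma bochner_dirichlet_integrable:
  assumes "u \<in> bochner p {0<..<T} (H1 \<Omega>) (H1_norm \<Omega>)" "p > 0" "g \<in> H1 \<Omega>"
  shows "integrable (lebesgue_on {0<..<T}) (\<lambda>t. dirichlet_form \<Omega> (u t) g)"
proof (rule bochner_functional_integrable[OF assms(1) _ assms(2), where C = "D.nrm g"])
  have b: "\<bar>dirichlet_form \<Omega> v g\<bar> \<le> D.nrm g * H1_norm \<Omega> v" if "v \<in> H1 \<Omega>" for v
    using D.Cauchy_Schwarz[OF that assms(3)]
      mult_left_mono[OF grad_norm_le_H1_norm[of v] D.nrm_nonneg[OF assms(3)]]
    by (simp add: mult.commute dirichlet_nrm_eq)
  then show "\<bar>dirichlet_form \<Omega> v g\<bar> \<le> D.nrm g * H1_norm \<Omega> v" if "v \<in> H1 \<Omega>" for v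
    using that .
  show "\<bar>dirichlet_form \<Omega> s g - dirichlet_form \<Omega> v g\<bar> \<le> D.nrm g * H1_norm \<Omega> (\<lambda>x. s x - v x)"
    if "s \<in> H1 \<Omega>" "v \<in> H1 \<Omega>" for s v
    using b[OF H1.diff_mem[OF that]] D.ip_diff[OF that assms(3)] by simp
qed (use D.nrm_nonneg[OF assms(3)] H1.nrm_nonneg in auto)

lemma bochner_dual_integrable:
  assumes "l \<in> bochner p {0<..<T} (H10_dual \<Omega>) (H10_dual_norm \<Omega>)" "p > 0" "v \<in> H10 \<Omega>"
  shows "integrable (lebesgue_on {0<..<T}) (\<lambda>t. l t v)"
proof (rule bochner_functional_integrable[where \<Lambda> = "\<lambda>l. l v", OF assms(1) _ assms(2), where C = "H1_norm \<Omega> v"])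
  show "\<bar>s v - m v\<bar> \<le> H1_norm \<Omega> v * H10_dual_norm \<Omega> (\<lambda>x. s x - m x)"
    if "s \<in> H10_dual \<Omega>" "m \<in> H10_dual \<Omega>" for s m
    using dual_norm_bound[OF dual_diff(1)[OF that] assms(3)] by (simp add: mult.commute)
  show "\<bar>m v\<bar> \<le> H1_norm \<Omega> v * H10_dual_norm \<Omega> m" if "m \<in> H10_dual \<Omega>" for m
    using dual_norm_bound[OF that assms(3)] by (simp add: mult.commute)
qed (use dual_norm_nonneg in \<open>auto simp: H1_norm_def\<close>)

text \<open>
  Equality as distributions on \<open>(0,T)\<close> is equality at almost every time as functionals. It is stated for
  differences because \<open>p - q\<close> and \<open>r - s\<close> arise as differences of time derivatives.
\<close>

lemma dual_AE_eq:
  assumes bochner: "p \<in> bochner 1 {0<..<T} (H10_dual \<Omega>) (H10_dual_norm \<Omega>)"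
      "q \<in> bochner 1 {0<..<T} (H10_dual \<Omega>) (H10_dual_norm \<Omega>)"
      "r \<in> bochner 1 {0<..<T} (H10_dual \<Omega>) (H10_dual_norm \<Omega>)"
      "s \<in> bochner 1 {0<..<T} (H10_dual \<Omega>) (H10_dual_norm \<Omega>)"
    and test: "\<And>\<psi> v. \<lbrakk>test_function {0<..<T} \<psi>; v \<in> H10 \<Omega>\<rbrakk> \<Longrightarrow>
      (\<integral>t. p t v * \<psi> t \<partial>lebesgue_on {0<..<T}) - (\<integral>t. q t v * \<psi> t \<partial>lebesgue_on {0<..<T})
      = (\<integral>t. r t v * \<psi> t \<partial>lebesgue_on {0<..<T}) - (\<integral>t. s t v * \<psi> t \<partial>lebesgue_on {0<..<T})"
  shows "AE t in lebesgue_on {0<..<T}. \<forall>v\<in>H10 \<Omega>. p t v - q t v = r t v - s t v"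
proof -
  let ?I = "{0<..<T}" and ?X = "H10_dual \<Omega>" and ?N = "H10_dual_norm \<Omega>"
  note diff = strongly_measurable_diff[where X = ?X and N = ?N, OF _ _ _ _ dual_diff dual_norm_nonneg]
  have mem: "AE t in lebesgue_on ?I. (\<lambda>v. a t v - b t v) \<in> ?X"
    if "AE t in lebesgue_on ?I. a t \<in> ?X" "AE t in lebesgue_on ?I. b t \<in> ?X" for a b
    using that by eventually_elim (rule dual_diff(1))
  have "AE t in lebesgue_on ?I. \<forall>v\<in>H10 \<Omega>. (p t v - q t v) - (r t v - s t v) = 0"
  proof (rule dual_AE_zero)
    show "strongly_measurable ?I ?X ?N (\<lambda>t v. (p t v - q t v) - (r t v - s t v))"
      by (intro diff mem; use bochner in \<open>simp add: bochner_def\<close>)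
    show "AE t in lebesgue_on ?I. (\<lambda>v. (p t v - q t v) - (r t v - s t v)) \<in> ?X"
      by (intro mem; use bochner in \<open>simp add: bochner_def\<close>)
    fix v assume v: "v \<in> H10 \<Omega>"
    note i = bochner[THEN bochner_dual_integrable, OF zero_less_one v]
    show "AE t in lebesgue_on ?I. (p t v - q t v) - (r t v - s t v) = 0"
    proof (rule fundamental_lemma_variations)
      show "integrable (lebesgue_on ?I) (\<lambda>t. (p t v - q t v) - (r t v - s t v))"
        using i by simp
      fix \<psi> :: "real \<Rightarrow> real" assume psi: "test_function ?I \<psi>"
      show "(\<integral>t. ((p t v - q t v) - (r t v - s t v)) * \<psi> t \<partial>lebesgue_on ?I) = 0"
        using test[OF psi v] i[THEN integrable_mult_time_test(1), OF psi]
        by (simp add: left_diff_distrib)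
    qed simp
  qed
  then show ?thesis by eventually_elim simp
qed

end

section \<open>Finite element functions\<close>

context semi_inner_space
begin

lemma sum_mem:
  assumes "\<And>i. i \<in> I \<Longrightarrow> h i \<in> X"
  shows "(\<lambda>x. \<Sum>i\<in>I. a i *\<^sub>R h i x) \<in> X"
  using assms
proof (induction I rule: infinite_finite_induct)
  case (insert j I)
  then show ?case
    using comb_mem[of "h j" "\<lambda>x. \<Sum>i\<in>I. a i *\<^sub>R h i x" "a j" 1] by simp
qed (simp_all add: zero_mem)

lemma ip_sum:
  assumes "\<And>i. i \<in> I \<Longrightarrow> h i \<in> X" and g: "g \<in> X"
  shows "ip (\<lambda>x. \<Sum>i\<in>I. a i *\<^sub>R h i x) g = (\<Sum>i\<in>I. a i * ip (h i) g)"
  using assms(1)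
proof (induction I rule: infinite_finite_induct)
  case (insert j I)
  have "ip (\<lambda>x. a j *\<^sub>R h j x + 1 *\<^sub>R (\<Sum>i\<in>I. a i *\<^sub>R h i x)) g =
      a j * ip (h j) g + 1 * ip (\<lambda>x. \<Sum>i\<in>I. a i *\<^sub>R h i x) g"
    using insert.prems by (intro ip_comb sum_mem g) auto
  then show ?case
    using insert by simp
qed (simp_all add: ip_zero g)

lemma ip_null: "\<lbrakk>u \<in> X; g \<in> X; ip u u = 0\<rbrakk> \<Longrightarrow> ip u g = 0"
  using Cauchy_Schwarz[of u g] by (simp add: nrm_def)

text \<open>
  A substitute for an orthonormal basis. If the members of \<open>X\<close> are, on \<open>S\<close>, combinations of finitely
  many functions \<open>\<beta> b\<close>, which need not lie in \<open>X\<close> themselves, then \<open>v = (\<Sum>i<n. ip v (d i) e i)\<close> holds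
  weakly in \<open>X\<close>. The system is built by induction on the number of functions \<open>\<beta> b\<close>, as in the
  Gram-Schmidt process: an element \<open>u\<close> that involves the new function contributes the residual
  \<open>r\<close> of its expansion, and the residual of every other element is a multiple of \<open>r\<close>.
\<close>

lemma finite_reproducing_system:
  fixes \<beta> :: "'i \<Rightarrow> 'c \<Rightarrow> 'b"
  assumes null: "\<And>u. \<lbrakk>u \<in> X; \<forall>x\<in>S. u x = 0\<rbrakk> \<Longrightarrow> ip u u = 0" and "finite B"
  shows "\<exists>(n::nat) d e. (\<forall>i<n. d i \<in> X \<and> e i \<in> X) \<and>
    (\<forall>v\<in>X. (\<exists>c. \<forall>x\<in>S. v x = (\<Sum>b\<in>B. c b *\<^sub>R \<beta> b x)) \<longrightarrow>
      (\<forall>g\<in>X. ip v g = (\<Sum>i<n. ip v (d i) * ip (e i) g)))"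
  using \<open>finite B\<close>
proof (induction B rule: finite_induct)
  case empty
  show ?case
    by (rule exI[of _ 0]) (use null ip_null in auto)
next
  case (insert b B)
  then obtain n :: nat and d e where de: "\<And>i. i < n \<Longrightarrow> d i \<in> X" "\<And>i. i < n \<Longrightarrow> e i \<in> X"
    and exp: "\<And>v c g. \<lbrakk>v \<in> X; \<forall>x\<in>S. v x = (\<Sum>b\<in>B. c b *\<^sub>R \<beta> b x); g \<in> X\<rbrakk> \<Longrightarrow>
      ip v g = (\<Sum>i<n. ip v (d i) * ip (e i) g)"
    by blast
  have system: ?case
    if "\<And>i. i < m \<Longrightarrow> d i \<in> X" "\<And>i. i < m \<Longrightarrow> e i \<in> X"
      and "\<And>v c g. \<lbrakk>v \<in> X; \<forall>x\<in>S. v x = (\<Sum>b\<in>insert b B. c b *\<^sub>R \<beta> b x); g \<in> X\<rbrakk> \<Longrightarrow>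
        ip v g = (\<Sum>i<m. ip v (d i) * ip (e i) g)" for m :: nat and d e
    using that
    by (intro exI[of _ m] exI[of _ d] exI[of _ e] conjI allI ballI impI) (assumption+, elim exE)
  show ?case
  proof (cases "\<exists>u\<in>X. \<exists>c. c b \<noteq> 0 \<and> (\<forall>x\<in>S. u x = (\<Sum>b\<in>insert b B. c b *\<^sub>R \<beta> b x))")
    case False
    have "ip v g = (\<Sum>i<n. ip v (d i) * ip (e i) g)"
      if v: "v \<in> X" "\<forall>x\<in>S. v x = (\<Sum>b\<in>insert b B. c b *\<^sub>R \<beta> b x)" "g \<in> X" for v c g
    proof (rule exp[OF v(1) _ v(3)])
      have "c b = 0" using False v by blast
      then show "\<forall>x\<in>S. v x = (\<Sum>b\<in>B. c b *\<^sub>R \<beta> b x)"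
        using v(2) insert.hyps by simp
    qed
    then show ?thesis
      using de by (rule_tac system)
  next
    case True
    then obtain u cu where u: "u \<in> X" "cu b \<noteq> 0"
      "\<And>x. x \<in> S \<Longrightarrow> u x = (\<Sum>b\<in>insert b B. cu b *\<^sub>R \<beta> b x)"
      by blast
    define P where "P v g = (\<Sum>i<n. ip v (d i) * ip (e i) g)" for v g
    define r where "r x = u x - (\<Sum>i<n. ip u (d i) *\<^sub>R e i x)" for x
    have s: "(\<lambda>x. \<Sum>i<n. ip u (d i) *\<^sub>R e i x) \<in> X"
      using de by (intro sum_mem) auto
    have r: "r \<in> X" unfolding r_def using u(1) s by (rule diff_mem)
    have ipr: "ip r g = ip u g - P u g" if "g \<in> X" for g
      unfolding r_def P_def using ip_diff[OF u(1) s that] ip_sum[of "{..<n}" e g] de that by simp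
    \<comment> \<open>Subtracting a multiple of \<open>u\<close> from \<open>v\<close> removes the new function from its representation.\<close>
    have key: "ip v g - P v g = (c b / cu b) * ip r g"
      if v: "v \<in> X" "\<forall>x\<in>S. v x = (\<Sum>b\<in>insert b B. c b *\<^sub>R \<beta> b x)" and g: "g \<in> X" for v c g
    proof -
      define \<kappa> where "\<kappa> = c b / cu b"
      have m: "(\<lambda>x. v x - \<kappa> *\<^sub>R u x) \<in> X"
        using v(1) scale_mem[OF u(1)] by (rule diff_mem)
      have ipm: "ip (\<lambda>x. v x - \<kappa> *\<^sub>R u x) h = ip v h - \<kappa> * ip u h" if "h \<in> X" for h
        using ip_diff[OF v(1) scale_mem[OF u(1)] that] ip_scale[OF u(1) that] by simp
      have "\<forall>x\<in>S. v x - \<kappa> *\<^sub>R u x = (\<Sum>j\<in>B. (c j - \<kappa> * cu j) *\<^sub>R \<beta> j x)"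
      proof
        fix x assume x: "x \<in> S"
        have "v x - \<kappa> *\<^sub>R u x = (\<Sum>j\<in>insert b B. (c j - \<kappa> * cu j) *\<^sub>R \<beta> j x)"
          using v(2) u(3)[OF x] x
          by (simp add: scaleR_sum_right sum_subtractf scaleR_left_diff_distrib del: sum.insert)
        also have "\<dots> = (\<Sum>j\<in>B. (c j - \<kappa> * cu j) *\<^sub>R \<beta> j x)"
          using insert.hyps u(2) by (simp add: \<kappa>_def)
        finally show "v x - \<kappa> *\<^sub>R u x = (\<Sum>j\<in>B. (c j - \<kappa> * cu j) *\<^sub>R \<beta> j x)" .
      qed
      then have "ip v g - \<kappa> * ip u g = (\<Sum>i<n. (ip v (d i) - \<kappa> * ip u (d i)) * ip (e i) g)"
        using exp[OF m, of "\<lambda>j. c j - \<kappa> * cu j", OF _ g] ipm[OF g] ipm[OF de(1)] by simp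
      also have "\<dots> = P v g - \<kappa> * P u g"
        by (simp add: P_def sum_subtractf sum_distrib_left algebra_simps)
      finally show ?thesis
        by (simp add: \<kappa>_def[symmetric] ipr[OF g] algebra_simps)
    qed
    show ?thesis
    proof (cases "ip r r = 0")
      case True
      have "ip v g = (\<Sum>i<n. ip v (d i) * ip (e i) g)"
        if v: "v \<in> X" "\<forall>x\<in>S. v x = (\<Sum>b\<in>insert b B. c b *\<^sub>R \<beta> b x)" "g \<in> X" for v c g
        using key[OF v] ip_null[OF r v(3) True] by (simp add: P_def)
      then show ?thesis
        using de by (rule_tac system)
    next
      case False
      \<comment> \<open>Chosen such that \<open>ip v d'\<close> is the factor by which the residual of \<open>v\<close> is a multiple of \<open>r\<close>: that
        factor is \<open>(ip v r - P v r) / ip r r\<close>, and \<open>d'\<close> represents this functional of \<open>v\<close>.\<close>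
      define d' where "d' x = (1 / ip r r) *\<^sub>R r x - (\<Sum>i<n. (ip (e i) r / ip r r) *\<^sub>R d i x)" for x
      have sd: "(\<lambda>x. \<Sum>i<n. (ip (e i) r / ip r r) *\<^sub>R d i x) \<in> X"
        using de by (intro sum_mem) auto
      have d': "d' \<in> X" unfolding d'_def using scale_mem[OF r] sd by (rule diff_mem)
      have ipd': "ip v d' = c b / cu b"
        if v: "v \<in> X" "\<forall>x\<in>S. v x = (\<Sum>b\<in>insert b B. c b *\<^sub>R \<beta> b x)" for v c
      proof -
        have "ip v d' = ip d' v" by (rule ip_sym[OF v(1) d'])
        also have "\<dots> = (1 / ip r r) * ip r v - (\<Sum>i<n. (ip (e i) r / ip r r) * ip (d i) v)"
          unfolding d'_def
          using ip_diff[OF scale_mem[OF r] sd v(1)] ip_scale[OF r v(1)] ip_sum[of "{..<n}" d v] de v(1)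
          by simp
        also have "\<dots> = (ip v r - P v r) / ip r r"
          using ip_sym[OF r v(1)] ip_sym[OF de(1) v(1)]
          by (simp add: P_def sum_divide_distrib diff_divide_distrib mult.commute)
        also have "\<dots> = c b / cu b"
          using key[OF v r] False by simp
        finally show ?thesis .
      qed
      have "ip v g = (\<Sum>i<Suc n. ip v ((d(n := d')) i) * ip ((e(n := r)) i) g)"
        if v: "v \<in> X" "\<forall>x\<in>S. v x = (\<Sum>b\<in>insert b B. c b *\<^sub>R \<beta> b x)" "g \<in> X" for v c g
        using key[OF v] ipd'[OF v(1,2)] by (simp add: P_def)
      moreover have "(d(n := d')) i \<in> X" "(e(n := r)) i \<in> X" if "i < Suc n" for i
        using de d' r that by (auto simp: less_Suc_eq)
      ultimately show ?thesis
        by (rule_tac system)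
    qed
  qed
qed

end

lemma finite_multi_indices: "finite {\<alpha> :: 'n::finite \<Rightarrow> nat. (\<Sum>i\<in>UNIV. \<alpha> i) \<le> k}"
proof (rule finite_subset)
  show "{\<alpha> :: 'n \<Rightarrow> nat. (\<Sum>i\<in>UNIV. \<alpha> i) \<le> k} \<subseteq> PiE UNIV (\<lambda>_. {..k})"
  proof
    fix \<alpha> :: "'n \<Rightarrow> nat" assume "\<alpha> \<in> {\<alpha>. (\<Sum>i\<in>UNIV. \<alpha> i) \<le> k}"
    then have "\<alpha> i \<le> k" for i
      using member_le_sum[of i UNIV \<alpha>] by simp
    then show "\<alpha> \<in> PiE UNIV (\<lambda>_. {..k})" by auto
  qed
qed (auto intro: finite_PiE)

lemma fe_space_coefficients:
  assumes "v \<in> fe_space \<Omega> \<T> k" "K \<in> \<T>"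
  obtains c where "\<And>x. x \<in> K \<Longrightarrow> v x = (\<Sum>\<alpha> | (\<Sum>i\<in>UNIV. \<alpha> i) \<le> k. c \<alpha> * (\<Prod>i\<in>UNIV. (x $ i) ^ \<alpha> i))"
proof -
  obtain p where p: "p \<in> polynomials k" "\<And>x. x \<in> K \<Longrightarrow> v x = p x"
    using assms unfolding fe_space_def by blast
  obtain c where "\<And>x. p x = (\<Sum>\<alpha> | (\<Sum>i\<in>UNIV. \<alpha> i) \<le> k. c \<alpha> * (\<Prod>i\<in>UNIV. (x $ i) ^ \<alpha> i))"
    using p(1) unfolding polynomials_def by blast
  then show ?thesis
    using that[of c] p(2) by simp
qed

lemma fe_space_comb:
  assumes \<Omega>: "bounded_open_set \<Omega>" and uv: "u \<in> fe_space \<Omega> \<T> k" "v \<in> fe_space \<Omega> \<T> k"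
  shows "(\<lambda>x. a *\<^sub>R u x + b *\<^sub>R v x) \<in> fe_space \<Omega> \<T> k"
proof -
  have "\<exists>p\<in>polynomials k. \<forall>x\<in>K. a * u x + b * v x = p x" if K: "K \<in> \<T>" for K
  proof -
    let ?S = "{\<alpha> :: 'a \<Rightarrow> nat. (\<Sum>i\<in>UNIV. \<alpha> i) \<le> k}"
    obtain c where c: "\<And>x. x \<in> K \<Longrightarrow> u x = (\<Sum>\<alpha>\<in>?S. c \<alpha> * (\<Prod>i\<in>UNIV. (x $ i) ^ \<alpha> i))"
      by (rule fe_space_coefficients[OF uv(1) K]) blast
    obtain c' where c': "\<And>x. x \<in> K \<Longrightarrow> v x = (\<Sum>\<alpha>\<in>?S. c' \<alpha> * (\<Prod>i\<in>UNIV. (x $ i) ^ \<alpha> i))"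
      by (rule fe_space_coefficients[OF uv(2) K]) blast
    show ?thesis
    proof (intro bexI ballI)
      show "(\<lambda>x. \<Sum>\<alpha>\<in>?S. (a * c \<alpha> + b * c' \<alpha>) * (\<Prod>i\<in>UNIV. (x $ i) ^ \<alpha> i)) \<in> polynomials k"
        unfolding polynomials_def by (intro CollectI exI[of _ "\<lambda>\<alpha>. a * c \<alpha> + b * c' \<alpha>"] allI refl)
      fix x assume "x \<in> K"
      then show "a * u x + b * v x = (\<Sum>\<alpha>\<in>?S. (a * c \<alpha> + b * c' \<alpha>) * (\<Prod>i\<in>UNIV. (x $ i) ^ \<alpha> i))"
        by (simp add: c c' sum_distrib_left sum.distrib[symmetric] algebra_simps)
    qed
  qed
  then show ?thesis
    using bounded_open_set.H10_comb[OF \<Omega>] uv unfolding fe_space_def by simp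
qed

lemma fe_space_zero:
  assumes "bounded_open_set \<Omega>"
  shows "(\<lambda>x. 0) \<in> fe_space \<Omega> \<T> k"
proof -
  interpret bounded_open_set \<Omega> by fact
  have "(\<lambda>x. 0) \<in> polynomials k"
    unfolding polynomials_def by (intro CollectI exI[of _ "\<lambda>\<alpha>. 0"]) simp
  then show ?thesis
    using H10.zero_mem unfolding fe_space_def by force
qed

lemma semi_inner_fe_space:
  assumes \<Omega>: "bounded_open_set \<Omega>"
  shows "semi_inner_space (fe_space \<Omega> \<T> k) (L2_inner \<Omega>)"
proof -
  have "v \<in> L2 \<Omega>" if "v \<in> fe_space \<Omega> \<T> k" for v
    using that H10_subset_H1 H1_subset_L2 unfolding fe_space_def by blast
  then show ?thesis
    using fe_space_comb[OF \<Omega>] fe_space_zero[OF \<Omega>]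
    by unfold_locales (simp_all only: L2.ip_comb L2.ip_sym L2.ip_nonneg)
qed

text \<open>
  On \<open>\<Omega>\<close>, a finite element function is a combination of the finitely many functions that are a monomial
  on one simplex and zero elsewhere, a point that belongs to several simplices being assigned to one
  of them.
\<close>

lemma fe_space_span:
  assumes v: "v \<in> fe_space \<Omega> \<T> k" and \<T>: "finite \<T>" "\<Omega> \<subseteq> \<Union>\<T>"
  shows "\<exists>c. \<forall>x\<in>\<Omega>. v x = (\<Sum>b\<in>\<T> \<times> {\<alpha>. (\<Sum>i\<in>UNIV. \<alpha> i) \<le> k}.
    c b *\<^sub>R (if fst b = (SOME K. K \<in> \<T> \<and> x \<in> K) then \<Prod>i\<in>UNIV. (x $ i) ^ snd b i else 0))"
proof -
  let ?S = "{\<alpha> :: 'a \<Rightarrow> nat. (\<Sum>i\<in>UNIV. \<alpha> i) \<le> k}"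
  have "\<exists>c. \<forall>x\<in>K. v x = (\<Sum>\<alpha>\<in>?S. c \<alpha> * (\<Prod>i\<in>UNIV. (x $ i) ^ \<alpha> i))" if "K \<in> \<T>" for K
    by (rule fe_space_coefficients[OF v that]) blast
  then have "\<forall>K\<in>\<T>. \<exists>c. \<forall>x\<in>K. v x = (\<Sum>\<alpha>\<in>?S. c \<alpha> * (\<Prod>i\<in>UNIV. (x $ i) ^ \<alpha> i))"
    by blast
  from bchoice[OF this] obtain c
    where c: "\<And>K x. \<lbrakk>K \<in> \<T>; x \<in> K\<rbrakk> \<Longrightarrow> v x = (\<Sum>\<alpha>\<in>?S. c K \<alpha> * (\<Prod>i\<in>UNIV. (x $ i) ^ \<alpha> i))"
    by blast
  show ?thesis
  proof (intro exI[of _ "\<lambda>b. c (fst b) (snd b)"] ballI)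
    fix x assume "x \<in> \<Omega>"
    define K0 where "K0 = (SOME K. K \<in> \<T> \<and> x \<in> K)"
    have K0: "K0 \<in> \<T>" "x \<in> K0"
      using someI_ex[of "\<lambda>K. K \<in> \<T> \<and> x \<in> K"] \<T>(2) \<open>x \<in> \<Omega>\<close> unfolding K0_def by blast+
    have "(\<Sum>b\<in>\<T> \<times> ?S. c (fst b) (snd b) *\<^sub>R (if fst b = K0 then \<Prod>i\<in>UNIV. (x $ i) ^ snd b i else 0))
      = (\<Sum>(K, \<alpha>)\<in>\<T> \<times> ?S. if K = K0 then c K \<alpha> * (\<Prod>i\<in>UNIV. (x $ i) ^ \<alpha> i) else 0)"
      by (rule sum.cong) (simp_all split: prod.split)
    also have "\<dots> = (\<Sum>K\<in>\<T>. \<Sum>\<alpha>\<in>?S. if K = K0 then c K \<alpha> * (\<Prod>i\<in>UNIV. (x $ i) ^ \<alpha> i) else 0)"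
      by (rule sum.cartesian_product[symmetric])
    also have "\<dots> = (\<Sum>K\<in>\<T>. if K = K0 then \<Sum>\<alpha>\<in>?S. c K \<alpha> * (\<Prod>i\<in>UNIV. (x $ i) ^ \<alpha> i) else 0)"
      by (intro sum.cong) auto
    also have "\<dots> = v x"
      using K0 \<T>(1) c[OF K0] by simp
    finally show "v x = (\<Sum>b\<in>\<T> \<times> ?S. c (fst b) (snd b) *\<^sub>R
        (if fst b = (SOME K. K \<in> \<T> \<and> x \<in> K) then \<Prod>i\<in>UNIV. (x $ i) ^ snd b i else 0))"
      unfolding K0_def by simp
  qed
qed

text \<open>
  The expansion holds when tested with all of \<open>L\<^sup>2\<close>: the difference \<open>r\<close> of the two sides lies in the
  finite element space and is orthogonal to it, so \<open>r\<close> has norm zero.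
\<close>

lemma fe_reproducing_system:
  assumes \<Omega>: "bounded_open_set \<Omega>" and \<T>: "finite \<T>" "\<Omega> \<subseteq> \<Union>\<T>"
  obtains n :: nat and d e where "\<And>i. i < n \<Longrightarrow> d i \<in> fe_space \<Omega> \<T> k" "\<And>i. i < n \<Longrightarrow> e i \<in> fe_space \<Omega> \<T> k"
    "\<And>v g. \<lbrakk>v \<in> fe_space \<Omega> \<T> k; g \<in> L2 \<Omega>\<rbrakk> \<Longrightarrow>
      L2_inner \<Omega> v g = (\<Sum>i<n. L2_inner \<Omega> v (d i) * L2_inner \<Omega> (e i) g)"
proof -
  interpret V: semi_inner_space "fe_space \<Omega> \<T> k" "L2_inner \<Omega>"
    by (rule semi_inner_fe_space[OF \<Omega>])
  have VL: "v \<in> L2 \<Omega>" if "v \<in> fe_space \<Omega> \<T> k" for v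
    using that H10_subset_H1 H1_subset_L2 unfolding fe_space_def by blast
  have null: "L2_inner \<Omega> u u = 0" if "u \<in> fe_space \<Omega> \<T> k" "\<forall>x\<in>\<Omega>. u x = 0" for u
  proof -
    have "L2_inner \<Omega> u u = (\<integral>x. 0 \<partial>lebesgue_on \<Omega>)"
      unfolding L2_inner_def by (rule Bochner_Integration.integral_cong) (use that in auto)
    then show ?thesis by simp
  qed
  have fin: "finite (\<T> \<times> {\<alpha> :: 'a \<Rightarrow> nat. (\<Sum>i\<in>UNIV. \<alpha> i) \<le> k})"
    using \<T>(1) finite_multi_indices by blast
  define \<beta> :: "(real ^ 'a) set \<times> ('a \<Rightarrow> nat) \<Rightarrow> real ^ 'a \<Rightarrow> real" where
    "\<beta> b x = (if fst b = (SOME K. K \<in> \<T> \<and> x \<in> K) then \<Prod>i\<in>UNIV. (x $ i) ^ snd b i else 0)" for b x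
  let ?B = "\<T> \<times> {\<alpha> :: 'a \<Rightarrow> nat. (\<Sum>i\<in>UNIV. \<alpha> i) \<le> k}"
  have "\<exists>(n::nat) d e. (\<forall>i<n. d i \<in> fe_space \<Omega> \<T> k \<and> e i \<in> fe_space \<Omega> \<T> k) \<and>
    (\<forall>v\<in>fe_space \<Omega> \<T> k. (\<exists>c. \<forall>x\<in>\<Omega>. v x = (\<Sum>b\<in>?B. c b *\<^sub>R \<beta> b x)) \<longrightarrow>
      (\<forall>g\<in>fe_space \<Omega> \<T> k. L2_inner \<Omega> v g = (\<Sum>i<n. L2_inner \<Omega> v (d i) * L2_inner \<Omega> (e i) g)))"
    by (rule V.finite_reproducing_system) (use null fin in blast)+
  then obtain n :: nat and d e where de': "\<forall>i<n. d i \<in> fe_space \<Omega> \<T> k \<and> e i \<in> fe_space \<Omega> \<T> k"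
    and exp': "\<forall>v\<in>fe_space \<Omega> \<T> k. (\<exists>c. \<forall>x\<in>\<Omega>. v x = (\<Sum>b\<in>?B. c b *\<^sub>R \<beta> b x)) \<longrightarrow>
      (\<forall>g\<in>fe_space \<Omega> \<T> k. L2_inner \<Omega> v g = (\<Sum>i<n. L2_inner \<Omega> v (d i) * L2_inner \<Omega> (e i) g))"
    by (elim exE conjE)
  have de: "\<And>i. i < n \<Longrightarrow> d i \<in> fe_space \<Omega> \<T> k" "\<And>i. i < n \<Longrightarrow> e i \<in> fe_space \<Omega> \<T> k"
    using de' by auto
  have exp: "L2_inner \<Omega> v g = (\<Sum>i<n. L2_inner \<Omega> v (d i) * L2_inner \<Omega> (e i) g)"
    if "v \<in> fe_space \<Omega> \<T> k" "g \<in> fe_space \<Omega> \<T> k" for v g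
    using exp'[rule_format, OF that(1) fe_space_span[OF that(1) \<T>, folded \<beta>_def] that(2)] .
  show ?thesis
  proof (rule that[OF de])
    fix v and g :: "real ^ 'a \<Rightarrow> real"
    assume v: "v \<in> fe_space \<Omega> \<T> k" and g: "g \<in> L2 \<Omega>"
    define r where "r x = v x - (\<Sum>i<n. L2_inner \<Omega> v (d i) *\<^sub>R e i x)" for x
    have s: "(\<lambda>x. \<Sum>i<n. L2_inner \<Omega> v (d i) *\<^sub>R e i x) \<in> fe_space \<Omega> \<T> k"
      using de by (intro V.sum_mem) auto
    have r: "r \<in> fe_space \<Omega> \<T> k" unfolding r_def using v s by (rule V.diff_mem)
    have ipr: "L2_inner \<Omega> r h = L2_inner \<Omega> v h - (\<Sum>i<n. L2_inner \<Omega> v (d i) * L2_inner \<Omega> (e i) h)"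
      if "h \<in> L2 \<Omega>" for h
      unfolding r_def using L2.ip_diff[OF VL[OF v] VL[OF s] that] L2.ip_sum[of "{..<n}" e \<Omega> h] de VL that
      by simp
    have "L2_inner \<Omega> r r = 0"
      using ipr[OF VL[OF r]] exp[OF v r] by simp
    then have "L2_inner \<Omega> r g = 0"
      using L2.ip_null[OF VL[OF r] g] by blast
    then show "L2_inner \<Omega> v g = (\<Sum>i<n. L2_inner \<Omega> v (d i) * L2_inner \<Omega> (e i) g)"
      using ipr[OF g] by simp
  qed
qed

section \<open>Measurability of the multiplier and of the reconstruction\<close>

lemma integrable_on_open_interval:
  fixes f :: "real \<Rightarrow> real"
  assumes "continuous_on {0..T} f"
  shows "integrable (lebesgue_on {0<..<T}) f"
proof -
  have "integrable lebesgue (\<lambda>t. if t \<in> {0..T} then f t else 0)"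
    using continuous_imp_integrable_real[OF assms] by (subst Lebesgue_Measure.integrable_restrict_UNIV) auto
  then have "integrable (lebesgue_on {0<..<T}) (\<lambda>t. if t \<in> {0..T} then f t else 0)"
    by (rule integrable_lebesgue_on) simp
  then show ?thesis
    by (rule Bochner_Integration.integrable_cong[THEN iffD1, rotated -1]) auto
qed

context bounded_open_set
begin

lemma time_continuous_dirichlet_integrable:
  assumes u: "time_continuous T X (H1_norm \<Omega>) u" and X: "X \<subseteq> H1 \<Omega>" and g: "g \<in> H1 \<Omega>"
  shows "integrable (lebesgue_on {0<..<T}) (\<lambda>t. dirichlet_form \<Omega> (u t) g)"
proof (rule integrable_on_open_interval)
  show "continuous_on {0..T} (\<lambda>t. dirichlet_form \<Omega> (u t) g)"
    unfolding continuous_on_def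
  proof
    fix t assume t: "t \<in> {0..T}"
    have lim: "((\<lambda>s. D.nrm g * H1_norm \<Omega> (\<lambda>x. u s x - u t x)) \<longlongrightarrow> 0) (at t within {0..T})"
      using u t tendsto_mult_right_zero unfolding time_continuous_def by blast
    have "((\<lambda>s. dirichlet_form \<Omega> (u s) g - dirichlet_form \<Omega> (u t) g) \<longlongrightarrow> 0) (at t within {0..T})"
    proof (rule Lim_null_comparison[OF _ lim])
      show "\<forall>\<^sub>F s in at t within {0..T}. norm (dirichlet_form \<Omega> (u s) g - dirichlet_form \<Omega> (u t) g)
          \<le> D.nrm g * H1_norm \<Omega> (\<lambda>x. u s x - u t x)"
        unfolding eventually_at_filter
      proof (rule always_eventually, intro allI impI)
        fix s assume s: "s \<in> {0..T}"
        have m: "u s \<in> H1 \<Omega>" "u t \<in> H1 \<Omega>"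
          using u X s t unfolding time_continuous_def by blast+
        have "norm (dirichlet_form \<Omega> (u s) g - dirichlet_form \<Omega> (u t) g)
            \<le> D.nrm (\<lambda>x. u s x - u t x) * D.nrm g"
          using D.Cauchy_Schwarz[OF D.diff_mem[OF m] g] D.ip_diff[OF m g] by simp
        also have "\<dots> \<le> H1_norm \<Omega> (\<lambda>x. u s x - u t x) * D.nrm g"
          using grad_norm_le_H1_norm D.nrm_nonneg[OF g] by (simp add: mult_right_mono dirichlet_nrm_eq)
        finally show "norm (dirichlet_form \<Omega> (u s) g - dirichlet_form \<Omega> (u t) g)
            \<le> D.nrm g * H1_norm \<Omega> (\<lambda>x. u s x - u t x)"
          by (simp add: mult.commute)
      qed
    qed
    then show "((\<lambda>s. dirichlet_form \<Omega> (u s) g) \<longlongrightarrow> dirichlet_form \<Omega> (u t) g) (at t within {0..T})"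
      by (simp add: LIM_zero_iff)
  qed
qed

text \<open>
  The reconstruction is given at almost every time separately. Its measurability in time follows from
  the symmetry of the Dirichlet form: if \<open>r n\<close> approximates the solution of the elliptic problem with
  right-hand side \<open>g\<close>, then the pairing of \<open>W t\<close> with \<open>g\<close> is the limit of the pairings of \<open>z t\<close> with \<open>r n\<close>.
  Integrability is then the stability estimate of the elliptic problem.
\<close>

lemma elliptic_solution_integrable:
  assumes I: "I \<in> sets lebesgue"
    and W: "AE t in lebesgue_on I. W t \<in> H10 \<Omega>" "AE t in lebesgue_on I. z t \<in> L2 \<Omega>"
      "AE t in lebesgue_on I. \<forall>v\<in>H10 \<Omega>. dirichlet_form \<Omega> (W t) v = L2_inner \<Omega> (z t) v"
    and z: "\<And>g. g \<in> L2 \<Omega> \<Longrightarrow> (\<lambda>t. L2_inner \<Omega> (z t) g) \<in> borel_measurable (lebesgue_on I)"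
    and \<zeta>: "integrable (lebesgue_on I) \<zeta>" "AE t in lebesgue_on I. L2_norm \<Omega> (z t) \<le> \<zeta> t"
    and g: "g \<in> L2 \<Omega>"
  shows "integrable (lebesgue_on I) (\<lambda>t. L2_inner \<Omega> (W t) g)"
proof -
  have HL: "u \<in> L2 \<Omega>" if "u \<in> H10 \<Omega>" for u
    using that H10_subset_H1 H1_subset_L2 by blast
  obtain C where C: "0 < C" "\<And>u. u \<in> H10 \<Omega> \<Longrightarrow> L2_norm \<Omega> u \<le> C * H10.nrm u"
    by (rule Poincare) blast
  have gn: "0 \<le> L2_norm \<Omega> g" by (rule L2.nrm_nonneg[OF g])
  have lin: "L2_inner \<Omega> (\<lambda>x. a *\<^sub>R u x + b *\<^sub>R v x) g = a * L2_inner \<Omega> u g + b * L2_inner \<Omega> v g"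
    if "u \<in> H10 \<Omega>" "v \<in> H10 \<Omega>" for u v a b
    by (rule L2.ip_comb[OF HL[OF that(1)] HL[OF that(2)] g])
  have bd: "\<bar>L2_inner \<Omega> u g\<bar> \<le> C * L2_norm \<Omega> g * H10.nrm u" if "u \<in> H10 \<Omega>" for u
    using L2.Cauchy_Schwarz[OF HL[OF that] g] mult_right_mono[OF C(2)[OF that] gn]
    by (simp add: ac_simps)
  obtain r where r: "\<And>n::nat. r n \<in> H10 \<Omega>"
    "\<And>n u. u \<in> H10 \<Omega> \<Longrightarrow> \<bar>dirichlet_form \<Omega> (r n) u - L2_inner \<Omega> u g\<bar> \<le> H10.nrm u / (real n + 1)"
    by (rule H10.approximate_Riesz[of "\<lambda>u. L2_inner \<Omega> u g", OF lin bd]) blast+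
  show ?thesis
  proof (rule Bochner_Integration.integrable_bound)
    show "integrable (lebesgue_on I) (\<lambda>t. C\<^sup>2 * L2_norm \<Omega> g * \<zeta> t)"
      using \<zeta>(1) by simp
    show "(\<lambda>t. L2_inner \<Omega> (W t) g) \<in> borel_measurable (lebesgue_on I)"
    proof (rule borel_measurable_AE_limit[OF I z[OF HL[OF r(1)]]])
      show "AE t in lebesgue_on I. (\<lambda>n. L2_inner \<Omega> (z t) (r n)) \<longlonglongrightarrow> L2_inner \<Omega> (W t) g"
        using W
      proof eventually_elim
        case (elim t)
        have "(\<lambda>n. H10.nrm (W t) * (1 / (real n + 1))) \<longlonglongrightarrow> H10.nrm (W t) * 0"
          using LIMSEQ_inverse_real_of_nat by (intro tendsto_intros) (simp add: inverse_eq_divide add.commute)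
        then have lim: "(\<lambda>n. H10.nrm (W t) / (real n + 1)) \<longlonglongrightarrow> 0" by simp
        have "(\<lambda>n. L2_inner \<Omega> (z t) (r n) - L2_inner \<Omega> (W t) g) \<longlonglongrightarrow> 0"
        proof (rule Lim_null_comparison[OF _ lim], rule always_eventually[OF allI])
          fix n
          have "L2_inner \<Omega> (z t) (r n) = dirichlet_form \<Omega> (r n) (W t)"
            using elim r(1) H10.ip_sym by metis
          then show "norm (L2_inner \<Omega> (z t) (r n) - L2_inner \<Omega> (W t) g) \<le> H10.nrm (W t) / (real n + 1)"
            using r(2)[of "W t" n] elim by simp
        qed
        then show ?case by (simp add: LIM_zero_iff)
      qed
    qed
    show "AE t in lebesgue_on I. norm (L2_inner \<Omega> (W t) g) \<le> norm (C\<^sup>2 * L2_norm \<Omega> g * \<zeta> t)"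
      using W \<zeta>(2)
    proof eventually_elim
      case (elim t)
      have W0: "0 \<le> H10.nrm (W t)" by (rule H10.nrm_nonneg[OF elim(1)])
      have z0: "0 \<le> L2_norm \<Omega> (z t)" by (rule L2.nrm_nonneg[OF elim(2)])
      have "H10.nrm (W t) * H10.nrm (W t) = L2_inner \<Omega> (z t) (W t)"
        using H10.nrm_square[OF elim(1)] elim by (simp add: power2_eq_square)
      also have "\<dots> \<le> L2_norm \<Omega> (z t) * L2_norm \<Omega> (W t)"
        using L2.Cauchy_Schwarz[OF elim(2) HL[OF elim(1)]] by simp
      also have "\<dots> \<le> L2_norm \<Omega> (z t) * (C * H10.nrm (W t))"
        using C(2)[OF elim(1)] z0 by (rule mult_left_mono)
      finally have "H10.nrm (W t) * H10.nrm (W t) \<le> (C * L2_norm \<Omega> (z t)) * H10.nrm (W t)"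
        by (simp add: ac_simps)
      then have "H10.nrm (W t) \<le> C * L2_norm \<Omega> (z t)"
        using W0 z0 C(1) by (cases "H10.nrm (W t) = 0") auto
      also have "\<dots> \<le> C * \<zeta> t"
        using elim(4) C(1) by simp
      finally have "C * L2_norm \<Omega> g * H10.nrm (W t) \<le> C * L2_norm \<Omega> g * (C * \<zeta> t)"
        using C(1) gn by (intro mult_left_mono) auto
      then have "\<bar>L2_inner \<Omega> (W t) g\<bar> \<le> C\<^sup>2 * L2_norm \<Omega> g * \<zeta> t"
        using bd[OF elim(1)] by (simp add: power2_eq_square ac_simps)
      then show ?case by simp
    qed
  qed
qed

end

text \<open>
  The multiplier lives in a finite-dimensional space, so it is a combination of fixed functions \<open>e i\<close>,
  with coefficients \<open>c i t\<close> that are found by testing its defining equation with fixed functions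
  \<open>d i\<close>. These coefficients are pairings of the data and therefore integrable in time.
\<close>

lemma discrete_multiplier_integrable:
  fixes \<Omega> :: "(real ^ 'n) set"
  assumes \<Omega>: "bounded_open_set \<Omega>" and \<T>: "finite \<T>" "\<Omega> \<subseteq> \<Union>\<T>"
    and f: "f \<in> bochner 2 {0<..<T} (L2 \<Omega>) (L2_norm \<Omega>)"
    and wh: "time_continuous T (fe_space \<Omega> \<T> k) (H1_norm \<Omega>) wh"
    and wh_t: "wh_t \<in> bochner 1 {0<..<T} (fe_space \<Omega> \<T> k) (H1_norm \<Omega>)"
    and \<sigma>: "discrete_multiplier \<Omega> T \<T> k f wh wh_t \<sigma>"
  shows "g \<in> L2 \<Omega> \<Longrightarrow> integrable (lebesgue_on {0<..<T}) (\<lambda>t. L2_inner \<Omega> (\<sigma> t) g)"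
    and "\<exists>\<zeta>. integrable (lebesgue_on {0<..<T}) \<zeta> \<and> (AE t in lebesgue_on {0<..<T}. L2_norm \<Omega> (\<sigma> t) \<le> \<zeta> t)"
proof -
  interpret bounded_open_set \<Omega> by fact
  let ?V = "fe_space \<Omega> \<T> k"
  have V1: "?V \<subseteq> H1 \<Omega>" using H10_subset_H1 unfolding fe_space_def by blast
  have VL: "v \<in> L2 \<Omega>" if "v \<in> ?V" for v using that V1 H1_subset_L2 by blast
  obtain n :: nat and d e where de: "\<And>i. i < n \<Longrightarrow> d i \<in> ?V" "\<And>i. i < n \<Longrightarrow> e i \<in> ?V"
    and exp: "\<And>v g. \<lbrakk>v \<in> ?V; g \<in> L2 \<Omega>\<rbrakk> \<Longrightarrow>
      L2_inner \<Omega> v g = (\<Sum>i<n. L2_inner \<Omega> v (d i) * L2_inner \<Omega> (e i) g)"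
    by (rule fe_reproducing_system[OF \<Omega> \<T>]) blast
  define c where
    "c i t = L2_inner \<Omega> (wh_t t) (d i) + dirichlet_form \<Omega> (wh t) (d i) - L2_inner \<Omega> (f t) (d i)" for i t
  have c: "integrable (lebesgue_on {0<..<T}) (c i)" if "i < n" for i
  proof -
    have "d i \<in> H1 \<Omega>" "d i \<in> L2 \<Omega>" using de(1)[OF that] V1 VL by blast+
    then show ?thesis
      unfolding c_def
      using bochner_H1_inner_integrable[OF wh_t _ V1] bochner_L2_inner_integrable[OF f]
        time_continuous_dirichlet_integrable[OF wh V1] by simp
  qed
  have exp\<sigma>: "AE t in lebesgue_on {0<..<T}. \<sigma> t \<in> ?V \<and>
      (\<forall>g\<in>L2 \<Omega>. L2_inner \<Omega> (\<sigma> t) g = (\<Sum>i<n. c i t * L2_inner \<Omega> (e i) g))"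
    using \<sigma> unfolding discrete_multiplier_def
  proof eventually_elim
    case (elim t)
    then have "L2_inner \<Omega> (\<sigma> t) (d i) = c i t" if "i < n" for i
      using de(1)[OF that] by (simp add: c_def)
    then show ?case
      using elim exp[of "\<sigma> t"] by simp
  qed
  show "integrable (lebesgue_on {0<..<T}) (\<lambda>t. L2_inner \<Omega> (\<sigma> t) g)" if g: "g \<in> L2 \<Omega>"
  proof (rule integrable_AE_eq(1))
    show "integrable (lebesgue_on {0<..<T}) (\<lambda>t. \<Sum>i<n. c i t * L2_inner \<Omega> (e i) g)"
      using c by (intro Bochner_Integration.integrable_sum integrable_mult_left) auto
    show "AE t in lebesgue_on {0<..<T}. (\<Sum>i<n. c i t * L2_inner \<Omega> (e i) g) = L2_inner \<Omega> (\<sigma> t) g"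
      using exp\<sigma> by eventually_elim (use g in simp)
  qed simp
  show "\<exists>\<zeta>. integrable (lebesgue_on {0<..<T}) \<zeta> \<and> (AE t in lebesgue_on {0<..<T}. L2_norm \<Omega> (\<sigma> t) \<le> \<zeta> t)"
  proof (intro exI conjI)
    show "integrable (lebesgue_on {0<..<T}) (\<lambda>t. \<Sum>i<n. \<bar>c i t\<bar> * L2_norm \<Omega> (e i))"
      using c by (intro Bochner_Integration.integrable_sum integrable_mult_left integrable_abs) auto
    show "AE t in lebesgue_on {0<..<T}. L2_norm \<Omega> (\<sigma> t) \<le> (\<Sum>i<n. \<bar>c i t\<bar> * L2_norm \<Omega> (e i))"
      using exp\<sigma>
    proof eventually_elim
      case (elim t)
      have L: "\<sigma> t \<in> L2 \<Omega>" using elim VL by blast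
      have "L2_norm \<Omega> (\<sigma> t) * L2_norm \<Omega> (\<sigma> t) = (\<Sum>i<n. c i t * L2_inner \<Omega> (e i) (\<sigma> t))"
        using elim L L2_norm_square[of \<Omega> "\<sigma> t"] by (simp add: power2_eq_square)
      also have "\<dots> \<le> (\<Sum>i<n. \<bar>c i t\<bar> * (L2_norm \<Omega> (e i) * L2_norm \<Omega> (\<sigma> t)))"
      proof (rule sum_mono)
        fix i assume "i \<in> {..<n}"
        then have "\<bar>L2_inner \<Omega> (e i) (\<sigma> t)\<bar> \<le> L2_norm \<Omega> (e i) * L2_norm \<Omega> (\<sigma> t)"
          using L2.Cauchy_Schwarz[OF VL[OF de(2)] L] by simp
        then have "\<bar>c i t\<bar> * \<bar>L2_inner \<Omega> (e i) (\<sigma> t)\<bar> \<le> \<bar>c i t\<bar> * (L2_norm \<Omega> (e i) * L2_norm \<Omega> (\<sigma> t))"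
          by (rule mult_left_mono) simp
        then show "c i t * L2_inner \<Omega> (e i) (\<sigma> t) \<le> \<bar>c i t\<bar> * (L2_norm \<Omega> (e i) * L2_norm \<Omega> (\<sigma> t))"
          using abs_ge_self[of "c i t * L2_inner \<Omega> (e i) (\<sigma> t)"] unfolding abs_mult by linarith
      qed
      finally have "L2_norm \<Omega> (\<sigma> t) * L2_norm \<Omega> (\<sigma> t) \<le> (\<Sum>i<n. \<bar>c i t\<bar> * L2_norm \<Omega> (e i)) * L2_norm \<Omega> (\<sigma> t)"
        by (simp add: sum_distrib_right mult.assoc)
      moreover have "0 \<le> (\<Sum>i<n. \<bar>c i t\<bar> * L2_norm \<Omega> (e i))"
        using L2.nrm_nonneg[OF VL[OF de(2)]] by (intro sum_nonneg mult_nonneg_nonneg) auto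
      ultimately show ?case
        using L2.nrm_nonneg[OF L] by (cases "L2_norm \<Omega> (\<sigma> t) = 0") auto
    qed
  qed
qed

section \<open>The differential inequality\<close>

text \<open>
  The constraint bounds functions from below only, so \<open>u + v\<close> is admissible. In the application \<open>\<Phi>\<close> is the
  source and \<open>\<Psi>\<close> the sum of the time derivative and the Dirichlet form.
\<close>

lemma variational_inequality_nonneg:
  assumes \<Omega>: "bounded_open_set \<Omega>" and u: "u \<in> obstacle_set \<Omega> c" and v: "v \<in> H10_nonneg \<Omega>"
    and vi: "\<And>v. v \<in> obstacle_set \<Omega> c \<Longrightarrow> \<Phi> (\<lambda>x. v x - u x) \<le> (\<Psi> (\<lambda>x. v x - u x) :: real)"
  shows "\<Phi> v \<le> \<Psi> v"
proof -
  interpret bounded_open_set \<Omega> by fact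
  have "AE x in lebesgue_on \<Omega>. c x \<le> u x" "AE x in lebesgue_on \<Omega>. 0 \<le> v x"
    using u v by (auto simp: obstacle_set_def H10_nonneg_def)
  then have "AE x in lebesgue_on \<Omega>. c x \<le> u x + v x"
    by eventually_elim simp
  then have "(\<lambda>x. u x + v x) \<in> obstacle_set \<Omega> c"
    using u v H10.add_mem by (auto simp: obstacle_set_def H10_nonneg_def)
  from vi[OF this] show ?thesis by simp
qed

theorem lemma5p1:
  fixes \<Omega> :: "(real ^ 'n) set"
    and \<T> :: "(real ^ 'n) set set"
    and T \<kappa> :: real
    and k :: nat
    and f obs obs_h w wh wh_t \<sigma>h W :: "real \<Rightarrow> real ^ 'n \<Rightarrow> real"
    and w_t :: "real \<Rightarrow> (real ^ 'n \<Rightarrow> real) \<Rightarrow> real"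
    and w0 wh0 :: "real ^ 'n \<Rightarrow> real"
  assumes dim: "CARD('n) \<in> {2, 3}"
    and domain: "open \<Omega>" "bounded \<Omega>" "connected \<Omega>" "\<Omega> \<noteq> {}"
    and time: "T > 0"
    and source: "f \<in> bochner 2 {0<..<T} (L2 \<Omega>) (L2_norm \<Omega>)"
    and initial: "w0 \<in> L2 \<Omega>"
    and obstacle: "admissible_obstacle \<Omega> T obs"
    and mesh: "simplicial_mesh \<Omega> \<T>" "shape_regular \<kappa> \<T>"
    and degree: "k \<ge> 1"
    and discrete_obstacle: "\<forall>t\<in>{0..T}. \<forall>x\<in>frontier \<Omega>. obs_h t x \<le> 0"
    and solution: "continuous_solution \<Omega> T f obs w0 w w_t"
    and discrete: "discrete_solution \<Omega> T \<T> k f obs_h wh0 wh wh_t"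
    and multiplier: "discrete_multiplier \<Omega> T \<T> k f wh wh_t \<sigma>h"
    and reconstruction: "elliptic_reconstruction \<Omega> T f \<sigma>h wh_t W"
  shows "dist_le \<Omega> T
      (\<lambda>\<psi> v. dist_dt \<Omega> T (\<lambda>t x. W t x - w t x) \<psi> v
           + dist_of T (\<lambda>t. neg_laplacian \<Omega> (\<lambda>x. W t x - w t x)) \<psi> v)
      (\<lambda>\<psi> v. dist_of T (\<lambda>t. L2_inner \<Omega> (\<sigma>h t)) \<psi> v
           + dist_dt \<Omega> T (\<lambda>t x. W t x - wh t x) \<psi> v)
    \<and> (\<forall>p q. has_time_derivative \<Omega> T (\<lambda>t x. W t x - w t x) p \<and>
              has_time_derivative \<Omega> T (\<lambda>t x. W t x - wh t x) q \<longrightarrow>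
        (AE t in lebesgue_on {0<..<T}. \<forall>v\<in>H10_nonneg \<Omega>.
           p t v + neg_laplacian \<Omega> (\<lambda>x. W t x - w t x) v
             \<le> L2_inner \<Omega> (\<sigma>h t) v + q t v))"
proof -
  have \<Omega>: "bounded_open_set \<Omega>" using domain by unfold_locales
  interpret bounded_open_set \<Omega> by (rule \<Omega>)
  let ?\<mu> = "lebesgue_on {0<..<T}" and ?V = "fe_space \<Omega> \<T> k"
  have HL: "v \<in> L2 \<Omega>" if "v \<in> H10 \<Omega>" for v
    using that H10_subset_H1 H1_subset_L2 by blast
  have V1: "?V \<subseteq> H1 \<Omega>" using H10_subset_H1 unfolding fe_space_def by blast
  have \<T>: "finite \<T>" "\<Omega> \<subseteq> \<Union>\<T>"
    using mesh(1) closure_subset unfolding simplicial_mesh_def triangulation_def by auto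

  have w: "w \<in> bochner 2 {0<..<T} (H1 \<Omega>) (H1_norm \<Omega>)" "has_time_derivative \<Omega> T w w_t"
    and w_ae: "AE t in ?\<mu>. w t \<in> obstacle_set \<Omega> (obs t) \<and>
        (\<forall>v\<in>obstacle_set \<Omega> (obs t).
           w_t t (\<lambda>x. v x - w t x) + dirichlet_form \<Omega> (w t) (\<lambda>x. v x - w t x)
             \<ge> L2_inner \<Omega> (f t) (\<lambda>x. v x - w t x))"
    using solution unfolding continuous_solution_def by blast+
  have wh: "time_continuous T ?V (H1_norm \<Omega>) wh" "wh_t \<in> bochner 1 {0<..<T} ?V (H1_norm \<Omega>)"
    "has_time_derivative \<Omega> T wh (\<lambda>t. L2_inner \<Omega> (wh_t t))"
    using discrete unfolding discrete_solution_def by blast+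
  have wB: "w \<in> bochner 1 {0<..<T} (L2 \<Omega>) (L2_norm \<Omega>)"
      "w_t \<in> bochner 1 {0<..<T} (H10_dual \<Omega>) (H10_dual_norm \<Omega>)"
    and w_t: "\<And>\<psi> v. \<lbrakk>test_function {0<..<T} \<psi>; v \<in> H10 \<Omega>\<rbrakk> \<Longrightarrow>
      (\<integral>t. L2_inner \<Omega> (w t) v * deriv \<psi> t \<partial>?\<mu>) = - (\<integral>t. w_t t v * \<psi> t \<partial>?\<mu>)"
    using w(2) unfolding has_time_derivative_def by blast+
  have whB: "wh \<in> bochner 1 {0<..<T} (L2 \<Omega>) (L2_norm \<Omega>)"
      "(\<lambda>t. L2_inner \<Omega> (wh_t t)) \<in> bochner 1 {0<..<T} (H10_dual \<Omega>) (H10_dual_norm \<Omega>)"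
    and wh_t: "\<And>\<psi> v. \<lbrakk>test_function {0<..<T} \<psi>; v \<in> H10 \<Omega>\<rbrakk> \<Longrightarrow>
      (\<integral>t. L2_inner \<Omega> (wh t) v * deriv \<psi> t \<partial>?\<mu>) = - (\<integral>t. L2_inner \<Omega> (wh_t t) v * \<psi> t \<partial>?\<mu>)"
    using wh(3) unfolding has_time_derivative_def by blast+

  \<comment> \<open>The right-hand side of the elliptic problem for the reconstruction.\<close>
  define z where "z t x = f t x + \<sigma>h t x - wh_t t x" for t x
  have f_ae: "AE t in ?\<mu>. f t \<in> L2 \<Omega>" using source by (simp add: bochner_def)
  have wh_t_ae: "AE t in ?\<mu>. wh_t t \<in> L2 \<Omega>"
  proof -
    have "AE t in ?\<mu>. wh_t t \<in> ?V" using wh(2) by (simp add: bochner_def)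
    then show ?thesis by eventually_elim (use V1 H1_subset_L2 in blast)
  qed
  have \<sigma>_ae: "AE t in ?\<mu>. \<sigma>h t \<in> L2 \<Omega>"
    using multiplier unfolding discrete_multiplier_def
    by eventually_elim (use V1 H1_subset_L2 in blast)
  have z_ae: "AE t in ?\<mu>. z t \<in> L2 \<Omega> \<and>
      L2_norm \<Omega> (z t) \<le> L2_norm \<Omega> (f t) + L2_norm \<Omega> (\<sigma>h t) + L2_norm \<Omega> (wh_t t) \<and>
      (\<forall>g\<in>L2 \<Omega>. L2_inner \<Omega> (z t) g = L2_inner \<Omega> (f t) g + L2_inner \<Omega> (\<sigma>h t) g - L2_inner \<Omega> (wh_t t) g)"
    using f_ae \<sigma>_ae wh_t_ae
  proof eventually_elim
    case (elim t)
    have m: "(\<lambda>x. f t x + \<sigma>h t x) \<in> L2 \<Omega>" by (rule L2.add_mem[OF elim(1,2)])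
    have "L2_norm \<Omega> (z t) \<le> L2_norm \<Omega> (f t) + L2_norm \<Omega> (\<sigma>h t) + L2_norm \<Omega> (wh_t t)"
      unfolding z_def
      using L2.nrm_triangle_diff[OF m elim(3)] L2.nrm_triangle[OF elim(1,2)] by simp
    moreover have "L2_inner \<Omega> (z t) g = L2_inner \<Omega> (f t) g + L2_inner \<Omega> (\<sigma>h t) g - L2_inner \<Omega> (wh_t t) g"
      if "g \<in> L2 \<Omega>" for g
      unfolding z_def using L2.ip_diff[OF m elim(3) that] L2.ip_add[OF elim(1,2) that] by simp
    moreover have "z t \<in> L2 \<Omega>"
      unfolding z_def by (rule L2.diff_mem[OF m elim(3)])
    ultimately show ?case by blast
  qed
  have W_ae: "AE t in ?\<mu>. W t \<in> H10 \<Omega> \<and> (\<forall>v\<in>H10 \<Omega>. dirichlet_form \<Omega> (W t) v = L2_inner \<Omega> (z t) v)"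
    using reconstruction unfolding elliptic_reconstruction_def z_def .

  have f_int: "integrable ?\<mu> (\<lambda>t. L2_inner \<Omega> (f t) g)" if "g \<in> L2 \<Omega>" for g
    by (rule bochner_L2_inner_integrable[OF source _ that]) simp
  have wh_t_int: "integrable ?\<mu> (\<lambda>t. L2_inner \<Omega> (wh_t t) g)" if "g \<in> L2 \<Omega>" for g
    by (rule bochner_H1_inner_integrable[OF wh(2) _ V1 that]) simp
  note \<sigma>_int = discrete_multiplier_integrable(1)[OF \<Omega> \<T> source wh(1,2) multiplier]
  have z_int: "integrable ?\<mu> (\<lambda>t. L2_inner \<Omega> (z t) g)" if g: "g \<in> L2 \<Omega>" for g
  proof (rule integrable_AE_eq(1))
    show "integrable ?\<mu> (\<lambda>t. L2_inner \<Omega> (f t) g + L2_inner \<Omega> (\<sigma>h t) g - L2_inner \<Omega> (wh_t t) g)"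
      using f_int \<sigma>_int wh_t_int g by simp
    show "AE t in ?\<mu>. L2_inner \<Omega> (f t) g + L2_inner \<Omega> (\<sigma>h t) g - L2_inner \<Omega> (wh_t t) g = L2_inner \<Omega> (z t) g"
      using z_ae by eventually_elim (use g in simp)
  qed simp
  have W_int: "integrable ?\<mu> (\<lambda>t. L2_inner \<Omega> (W t) g)" if g: "g \<in> L2 \<Omega>" for g
  proof -
    obtain \<zeta> where \<zeta>: "integrable ?\<mu> \<zeta>" "AE t in ?\<mu>. L2_norm \<Omega> (\<sigma>h t) \<le> \<zeta> t"
      using discrete_multiplier_integrable(2)[OF \<Omega> \<T> source wh(1,2) multiplier] by blast
    show ?thesis
    proof (rule elliptic_solution_integrable[where z = z, OF _ _ _ _ _ _ _ g])
      show "integrable ?\<mu> (\<lambda>t. L2_norm \<Omega> (f t) + \<zeta> t + L2_norm \<Omega> (wh_t t))"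
        using \<zeta>(1) bochner_L2_norm_integrable[OF source] bochner_H1_L2_norm_integrable[OF wh(2) _ V1]
        by simp
      show "AE t in ?\<mu>. L2_norm \<Omega> (z t) \<le> L2_norm \<Omega> (f t) + \<zeta> t + L2_norm \<Omega> (wh_t t)"
        using z_ae \<zeta>(2) by eventually_elim simp
      show "AE t in ?\<mu>. W t \<in> H10 \<Omega>" "AE t in ?\<mu>. \<forall>v\<in>H10 \<Omega>. dirichlet_form \<Omega> (W t) v = L2_inner \<Omega> (z t) v"
        using W_ae by simp_all
      show "AE t in ?\<mu>. z t \<in> L2 \<Omega>" using z_ae by simp
      show "(\<lambda>t. L2_inner \<Omega> (z t) h) \<in> borel_measurable ?\<mu>" if "h \<in> L2 \<Omega>" for h
        by (rule borel_measurable_integrable[OF z_int[OF that]])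
    qed simp
  qed

  have A_ae: "AE t in ?\<mu>. \<forall>v\<in>H10 \<Omega>.
      dirichlet_form \<Omega> (\<lambda>x. W t x - w t x) v = L2_inner \<Omega> (z t) v - dirichlet_form \<Omega> (w t) v"
    using W_ae w_ae
  proof eventually_elim
    case (elim t)
    then have m: "W t \<in> H10 \<Omega>" "w t \<in> H10 \<Omega>" by (auto simp: obstacle_set_def)
    show ?case using H10.ip_diff[OF m] elim by simp
  qed
  have pointwise: "AE t in ?\<mu>. \<forall>v\<in>H10_nonneg \<Omega>. dirichlet_form \<Omega> (\<lambda>x. W t x - w t x) v
      \<le> w_t t v + L2_inner \<Omega> (\<sigma>h t) v - L2_inner \<Omega> (wh_t t) v"
    using A_ae z_ae w_ae
  proof eventually_elim
    case (elim t)
    show ?case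
    proof
      fix v assume v: "v \<in> H10_nonneg \<Omega>"
      then have v': "v \<in> H10 \<Omega>" by (simp add: H10_nonneg_def)
      have "L2_inner \<Omega> (f t) v \<le> w_t t v + dirichlet_form \<Omega> (w t) v"
        by (rule variational_inequality_nonneg[OF \<Omega> _ v, where c = "obs t" and u = "w t"
              and \<Psi> = "\<lambda>v. w_t t v + dirichlet_form \<Omega> (w t) v"]) (use elim in auto)
      moreover have "dirichlet_form \<Omega> (\<lambda>x. W t x - w t x) v = L2_inner \<Omega> (z t) v - dirichlet_form \<Omega> (w t) v"
        using elim(1) v' by blast
      moreover have "L2_inner \<Omega> (z t) v = L2_inner \<Omega> (f t) v + L2_inner \<Omega> (\<sigma>h t) v - L2_inner \<Omega> (wh_t t) v"
        using elim(2) HL[OF v'] by blast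
      ultimately show "dirichlet_form \<Omega> (\<lambda>x. W t x - w t x) v
          \<le> w_t t v + L2_inner \<Omega> (\<sigma>h t) v - L2_inner \<Omega> (wh_t t) v"
        by linarith
    qed
  qed

  \<comment> \<open>With \<open>u\<close> one of \<open>w\<close> and \<open>w\<^sub>h\<close>, this isolates the term in \<open>W\<close> that both sides have in common.\<close>
  have diff_dt: "(\<integral>t. L2_inner \<Omega> (\<lambda>x. W t x - u t x) v * deriv \<psi> t \<partial>?\<mu>)
      = (\<integral>t. L2_inner \<Omega> (W t) v * deriv \<psi> t \<partial>?\<mu>) - (\<integral>t. L2_inner \<Omega> (u t) v * deriv \<psi> t \<partial>?\<mu>)"
    if u: "u \<in> bochner 1 {0<..<T} (L2 \<Omega>) (L2_norm \<Omega>)" and psi: "test_function {0<..<T} \<psi>"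
      and v: "v \<in> H10 \<Omega>" for u \<psi> v
  proof -
    have i: "integrable ?\<mu> (\<lambda>t. L2_inner \<Omega> (W t) v * deriv \<psi> t)"
      "integrable ?\<mu> (\<lambda>t. L2_inner \<Omega> (u t) v * deriv \<psi> t)"
      using W_int[OF HL[OF v]] bochner_L2_inner_integrable[OF u _ HL[OF v]]
        integrable_mult_time_test(2)[OF _ psi]
      by auto
    have "AE t in ?\<mu>. u t \<in> L2 \<Omega>" using u by (simp add: bochner_def)
    with W_ae have "AE t in ?\<mu>. L2_inner \<Omega> (W t) v * deriv \<psi> t - L2_inner \<Omega> (u t) v * deriv \<psi> t =
        L2_inner \<Omega> (\<lambda>x. W t x - u t x) v * deriv \<psi> t"
    proof eventually_elim
      case (elim t)
      show ?case
        using L2.ip_diff[of "W t" \<Omega> "u t" v] HL elim v by (simp add: left_diff_distrib)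
    qed
    from integrable_AE_eq(2)[OF _ Bochner_Integration.integrable_diff[OF i] this] show ?thesis
      using i by simp
  qed

  show ?thesis
  proof (intro conjI allI impI)
    show "dist_le \<Omega> T
      (\<lambda>\<psi> v. dist_dt \<Omega> T (\<lambda>t x. W t x - w t x) \<psi> v
           + dist_of T (\<lambda>t. neg_laplacian \<Omega> (\<lambda>x. W t x - w t x)) \<psi> v)
      (\<lambda>\<psi> v. dist_of T (\<lambda>t. L2_inner \<Omega> (\<sigma>h t)) \<psi> v
           + dist_dt \<Omega> T (\<lambda>t x. W t x - wh t x) \<psi> v)"
      unfolding dist_le_def
    proof (intro allI impI ballI, elim conjE)
      fix \<psi> :: "real \<Rightarrow> real" and v
      assume psi: "test_function {0<..<T} \<psi>" and psi0: "\<forall>t. 0 \<le> \<psi> t" and v: "v \<in> H10_nonneg \<Omega>"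
      then have v': "v \<in> H10 \<Omega>" by (simp add: H10_nonneg_def)
      note test = integrable_mult_time_test(1)[OF _ psi]
      have i: "integrable ?\<mu> (\<lambda>t. w_t t v * \<psi> t)" "integrable ?\<mu> (\<lambda>t. L2_inner \<Omega> (\<sigma>h t) v * \<psi> t)"
        "integrable ?\<mu> (\<lambda>t. L2_inner \<Omega> (wh_t t) v * \<psi> t)"
        using bochner_dual_integrable[OF wB(2) _ v'] \<sigma>_int[OF HL[OF v']] wh_t_int[OF HL[OF v']]
        by (auto intro!: test)
      have iA: "integrable ?\<mu> (\<lambda>t. dirichlet_form \<Omega> (\<lambda>x. W t x - w t x) v)"
      proof (rule integrable_AE_eq(1))
        show "integrable ?\<mu> (\<lambda>t. L2_inner \<Omega> (z t) v - dirichlet_form \<Omega> (w t) v)"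
          using z_int[OF HL[OF v']] bochner_dirichlet_integrable[OF w(1) _ H10_subset_H1[OF v']] by simp
        show "AE t in ?\<mu>. L2_inner \<Omega> (z t) v - dirichlet_form \<Omega> (w t) v = dirichlet_form \<Omega> (\<lambda>x. W t x - w t x) v"
          using A_ae by eventually_elim (use v' in simp)
      qed simp
      have "(\<integral>t. dirichlet_form \<Omega> (\<lambda>x. W t x - w t x) v * \<psi> t \<partial>?\<mu>)
          \<le> (\<integral>t. w_t t v * \<psi> t + L2_inner \<Omega> (\<sigma>h t) v * \<psi> t - L2_inner \<Omega> (wh_t t) v * \<psi> t \<partial>?\<mu>)"
      proof (rule integral_mono_AE[OF test[OF iA]])
        show "integrable ?\<mu> (\<lambda>t. w_t t v * \<psi> t + L2_inner \<Omega> (\<sigma>h t) v * \<psi> t - L2_inner \<Omega> (wh_t t) v * \<psi> t)"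
          using i by simp
        show "AE t in ?\<mu>. dirichlet_form \<Omega> (\<lambda>x. W t x - w t x) v * \<psi> t
            \<le> w_t t v * \<psi> t + L2_inner \<Omega> (\<sigma>h t) v * \<psi> t - L2_inner \<Omega> (wh_t t) v * \<psi> t"
          using pointwise
        proof eventually_elim
          case (elim t)
          from mult_right_mono[OF elim[rule_format, OF v] psi0[rule_format, of t]] show ?case
            by (simp add: algebra_simps)
        qed
      qed
      also have "\<dots> = (\<integral>t. w_t t v * \<psi> t \<partial>?\<mu>) + (\<integral>t. L2_inner \<Omega> (\<sigma>h t) v * \<psi> t \<partial>?\<mu>)
          - (\<integral>t. L2_inner \<Omega> (wh_t t) v * \<psi> t \<partial>?\<mu>)"
        using i by simp
      finally show "dist_dt \<Omega> T (\<lambda>t x. W t x - w t x) \<psi> v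
           + dist_of T (\<lambda>t. neg_laplacian \<Omega> (\<lambda>x. W t x - w t x)) \<psi> v
        \<le> dist_of T (\<lambda>t. L2_inner \<Omega> (\<sigma>h t)) \<psi> v + dist_dt \<Omega> T (\<lambda>t x. W t x - wh t x) \<psi> v"
        unfolding dist_dt_def dist_of_def neg_laplacian_def diff_dt[OF wB(1) psi v'] diff_dt[OF whB(1) psi v']
          w_t[OF psi v'] wh_t[OF psi v']
        by linarith
    qed
  next
    fix p q
    assume pq: "has_time_derivative \<Omega> T (\<lambda>t x. W t x - w t x) p \<and>
      has_time_derivative \<Omega> T (\<lambda>t x. W t x - wh t x) q"
    \<comment> \<open>Both \<open>p\<close> and \<open>q\<close> contain the derivative of \<open>W\<close>, which cancels.\<close>
    have "AE t in ?\<mu>. \<forall>v\<in>H10 \<Omega>. p t v - q t v = L2_inner \<Omega> (wh_t t) v - w_t t v"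
    proof (rule dual_AE_eq)
      show "p \<in> bochner 1 {0<..<T} (H10_dual \<Omega>) (H10_dual_norm \<Omega>)"
        "q \<in> bochner 1 {0<..<T} (H10_dual \<Omega>) (H10_dual_norm \<Omega>)"
        using pq unfolding has_time_derivative_def by blast+
      fix \<psi> :: "real \<Rightarrow> real" and v
      assume psi: "test_function {0<..<T} \<psi>" and v: "v \<in> H10 \<Omega>"
      have "(\<integral>t. L2_inner \<Omega> (\<lambda>x. W t x - w t x) v * deriv \<psi> t \<partial>?\<mu>) = - (\<integral>t. p t v * \<psi> t \<partial>?\<mu>)"
        "(\<integral>t. L2_inner \<Omega> (\<lambda>x. W t x - wh t x) v * deriv \<psi> t \<partial>?\<mu>) = - (\<integral>t. q t v * \<psi> t \<partial>?\<mu>)"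
        using pq psi v unfolding has_time_derivative_def by blast+
      then show "(\<integral>t. p t v * \<psi> t \<partial>?\<mu>) - (\<integral>t. q t v * \<psi> t \<partial>?\<mu>)
          = (\<integral>t. L2_inner \<Omega> (wh_t t) v * \<psi> t \<partial>?\<mu>) - (\<integral>t. w_t t v * \<psi> t \<partial>?\<mu>)"
        unfolding diff_dt[OF wB(1) psi v] diff_dt[OF whB(1) psi v] w_t[OF psi v] wh_t[OF psi v]
        by linarith
    qed (fact whB(2) wB(2))+
    with pointwise show "AE t in ?\<mu>. \<forall>v\<in>H10_nonneg \<Omega>.
        p t v + neg_laplacian \<Omega> (\<lambda>x. W t x - w t x) v \<le> L2_inner \<Omega> (\<sigma>h t) v + q t v"
    proof eventually_elim
      case (elim t)
      show ?case
      proof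
        fix v assume v: "v \<in> H10_nonneg \<Omega>"
        then have "p t v - q t v = L2_inner \<Omega> (wh_t t) v - w_t t v"
          using elim by (simp add: H10_nonneg_def)
        moreover have "dirichlet_form \<Omega> (\<lambda>x. W t x - w t x) v
            \<le> w_t t v + L2_inner \<Omega> (\<sigma>h t) v - L2_inner \<Omega> (wh_t t) v"
          using elim v by blast
        ultimately show "p t v + neg_laplacian \<Omega> (\<lambda>x. W t x - w t x) v \<le> L2_inner \<Omega> (\<sigma>h t) v + q t v"
          by (simp add: neg_laplacian_def)
      qed
    qed
  qed
qed

end
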